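(* Let $1\le p_1\le K<\infty$ and $h\ge 1$ be integers, and let $\{x_t\}_{t\in\mathbb{Z}}$ be the stationary autoregressive process $x_{t+1}=\sum_{i=1}^{p_1}a_i x_{t+1-i}+\varepsilon_{t+1}$, where $a_{p_1}\neq 0$ and $A(z)=1-a_1z-\cdots-a_{p_1}z^{p_1}\neq 0$ for all complex $|z|\le 1$. Assume that $\{\varepsilon_t\}$ is a martingale difference sequence with respect to an increasing sequence of $\sigma$-fields $\{\mathcal{F}_t\}$ such that, for some constants $\sigma^2>0$ and $\alpha>2$, almost surely $E(\varepsilon_t^2\mid\mathcal{F}_{t-1})=\sigma^2$ for all $t$ and $\sup_t E(|\varepsilon_t|^\alpha\mid\mathcal{F}_{t-1})<\infty$. Then for every integer $k$ with $p_1\le k\le K$, as $n\to\infty$, $$\mathrm{APE}\,P_{n,h}(k)-\sum_{i=m_h}^{n-h}\eta_{i,h}^2=f_{1,h}(k)\log n+o(\log n)\qquad\text{a.s.},$$ where $$f_{1,h}(k)=\sigma^2\,\mathrm{tr}\big(\Gamma(k)L_h(k)\Gamma^{-1}(k)L_h'(k)\big).$$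
   Context: **Model notation.** "Stationary" means $x_t=\sum_{i=0}^\infty b_i\varepsilon_{t-i}$, where $\sum_{i\ge0} b_iz^i=1/A(z)$ (so $b_0=1$). Put $\eta_{t,h}=\sum_{j=0}^{h-1}b_j\varepsilon_{t+h-j}$, $\gamma_j=E(x_tx_{t-j})$, $\mathbf{x}_j(k)=(x_j,\ldots,x_{j-k+1})'$, $\Gamma(k)=E(\mathbf{x}_1(k)\mathbf{x}_1'(k))$ and $\mathbf{a}_D(h,k)=\Gamma^{-1}(k)(\gamma_h,\ldots,\gamma_{h+k-1})'$. Let $A(k)$ be the $k\times k$ matrix whose first column is $\mathbf{a}_D(1,k)$ and whose remaining $k-1$ columns form the block $\begin{pmatrix}I_{k-1}\\ \mathbf{0}_{k-1}'\end{pmatrix}$, with $A^0(k)=I_k$, and let $L_h(k)=\sum_{j=0}^{h-1}b_jA^{h-1-j}(k)$. **Plug-in predictor.** Observations are $x_1,x_2,\ldots$. Let $$\hat\Gamma_n(h,k)=\frac{1}{n-h-k+1}\sum_{j=k}^{n-h}\mathbf{x}_j(k)\mathbf{x}_j'(k),$$ and let $\hat{\mathbf{a}}_n(1,k)$ be the solution of $\hat\Gamma_n(1,k)\hat{\mathbf{a}}_n(1,k)=\frac{1}{n-k}\sum_{j=k}^{n-1}\mathbf{x}_j(k)x_{j+1}$. Let $\hat A_n(k)$ be the $k\times k$ matrix with first column $\hat{\mathbf{a}}_n(1,k)$ and remaining columns $\begin{pmatrix}I_{k-1}\\ \mathbf{0}_{k-1}'\end{pmatrix}$, and $\hat{\mathbf{a}}_n(h,k)=\hat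 A_n^{h-1}(k)\hat{\mathbf{a}}_n(1,k)$ (with $\hat A_n^0(k)=I_k$). The plug-in predictor of $x_{n+h}$ is $\hat x_{n+h}(k)=\mathbf{x}_n'(k)\hat{\mathbf{a}}_n(h,k)$. **Accumulated prediction error.** $\mathrm{APE}\,P_{n,h}(k)=\sum_{i=m_h}^{n-h}(x_{i+h}-\hat x_{i+h}(k))^2$, where $m_h$ is the smallest positive integer such that $\hat{\mathbf{a}}_i(h,K)$ and the direct $h$-step least-squares estimator $\breve{\mathbf{a}}_i(h,K)$ (the solution of $\hat\Gamma_i(h,K)\breve{\mathbf{a}}_i(h,K)=\frac{1}{i-h-K+1}\sum_{j=K}^{i-h}\mathbf{x}_j(K)x_{j+h}$) are well defined, i.e. $\hat\Gamma_i(1,K)$ and $\hat\Gamma_i(h,K)$ are nonsingular, for all $i\ge m_h$. *)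

theory Defs
  imports
    "HOL-Probability.Probability"
    "HOL-Computational_Algebra.Polynomial_FPS"
    "HOL-Library.Landau_Symbols"
    "Jordan_Normal_Form.Gauss_Jordan_Elimination"
begin

(* HOL-Analysis and Jordan_Normal_Form both use the names vec and mat and the infix $; here matrices
   and vectors are those of Jordan_Normal_Form.Matrix, indexed from 0. *)

text \<open>Noise. The conditional absolute moment is taken in \<^typ>\<open>ennreal\<close>: \<^const>\<open>real_cond_exp\<close> would
  return 0 wherever that moment is infinite.\<close>

definition martingale_diff_seq ::
  "'a measure \<Rightarrow> (int \<Rightarrow> 'a measure) \<Rightarrow> (int \<Rightarrow> 'a \<Rightarrow> real) \<Rightarrow> bool" where
  "martingale_diff_seq M F \<epsilon> \<longleftrightarrow>
     (\<forall>t. subalgebra M (F t)) \<and>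
     (\<forall>s t. s \<le> t \<longrightarrow> sets (F s) \<subseteq> sets (F t)) \<and>
     (\<forall>t. \<epsilon> t \<in> borel_measurable (F t)) \<and>
     (\<forall>t. integrable M (\<epsilon> t)) \<and>
     (\<forall>t. AE \<omega> in M. real_cond_exp M (F (t - 1)) (\<epsilon> t) \<omega> = 0)"

definition cond_abs_moment ::
  "'a measure \<Rightarrow> (int \<Rightarrow> 'a measure) \<Rightarrow> (int \<Rightarrow> 'a \<Rightarrow> real) \<Rightarrow> real \<Rightarrow> int \<Rightarrow> 'a \<Rightarrow> ennreal" where
  "cond_abs_moment M F \<epsilon> \<alpha> t = nn_cond_exp M (F (t - 1)) (\<lambda>\<omega>. ennreal (\<bar>\<epsilon> t \<omega>\<bar> powr \<alpha>))"

definition ar_poly :: "nat \<Rightarrow> (nat \<Rightarrow> real) \<Rightarrow> real poly" where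
  "ar_poly p a = 1 - (\<Sum>i=1..p. monom (a i) i)"

definition ma_coeff :: "nat \<Rightarrow> (nat \<Rightarrow> real) \<Rightarrow> nat \<Rightarrow> real" where
  "ma_coeff p a = fps_nth (1 / fps_of_poly (ar_poly p a))"

definition stationary_AR ::
  "'a measure \<Rightarrow> nat \<Rightarrow> (nat \<Rightarrow> real) \<Rightarrow> (int \<Rightarrow> 'a \<Rightarrow> real) \<Rightarrow> (int \<Rightarrow> 'a \<Rightarrow> real) \<Rightarrow> bool" where
  "stationary_AR M p a \<epsilon> x \<longleftrightarrow>
     (\<forall>t. x t \<in> borel_measurable M) \<and>
     (\<forall>t. AE \<omega> in M. x (t + 1) \<omega> = (\<Sum>i=1..p. a i * x (t + 1 - int i) \<omega>) + \<epsilon> (t + 1) \<omega>) \<and>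
     (\<forall>t. AE \<omega> in M. (\<lambda>i. ma_coeff p a i * \<epsilon> (t - int i) \<omega>) sums x t \<omega>)"

definition multistep_noise ::
  "nat \<Rightarrow> (nat \<Rightarrow> real) \<Rightarrow> (int \<Rightarrow> real) \<Rightarrow> int \<Rightarrow> nat \<Rightarrow> real" where
  "multistep_noise p a e t h = (\<Sum>j<h. ma_coeff p a j * e (t + int h - int j))"

definition lag_vec :: "(int \<Rightarrow> real) \<Rightarrow> nat \<Rightarrow> int \<Rightarrow> real Matrix.vec" where
  "lag_vec y k j = Matrix.vec k (\<lambda>r. y (j - int r))"

definition companion :: "nat \<Rightarrow> real Matrix.vec \<Rightarrow> real Matrix.mat" where
  "companion k v =
     Matrix.mat k k (\<lambda>(r, c). if c = 0 then vec_index v r else if r = c - 1 then 1 else 0)"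

definition mat_trace :: "real Matrix.mat \<Rightarrow> real" where
  "mat_trace A = (\<Sum>i<dim_row A. A $$ (i, i))"

(* E(x_t x_{t-j}) does not depend on t by stationarity; t = 0 is used. *)
definition autocov :: "'a measure \<Rightarrow> (int \<Rightarrow> 'a \<Rightarrow> real) \<Rightarrow> nat \<Rightarrow> real" where
  "autocov M x j = (\<integral>\<omega>. x 0 \<omega> * x (0 - int j) \<omega> \<partial>M)"

definition autocov_mat :: "'a measure \<Rightarrow> (int \<Rightarrow> 'a \<Rightarrow> real) \<Rightarrow> nat \<Rightarrow> real Matrix.mat" where
  "autocov_mat M x k = Matrix.mat k k (\<lambda>(r, s).
     \<integral>\<omega>. vec_index (lag_vec (\<lambda>t. x t \<omega>) k 1) r * vec_index (lag_vec (\<lambda>t. x t \<omega>) k 1) s \<partial>M)"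

definition autocov_mat_inv :: "'a measure \<Rightarrow> (int \<Rightarrow> 'a \<Rightarrow> real) \<Rightarrow> nat \<Rightarrow> real Matrix.mat" where
  "autocov_mat_inv M x k = the (mat_inverse (autocov_mat M x k))"

definition direct_coeff ::
  "'a measure \<Rightarrow> (int \<Rightarrow> 'a \<Rightarrow> real) \<Rightarrow> nat \<Rightarrow> nat \<Rightarrow> real Matrix.vec" where
  "direct_coeff M x h k = autocov_mat_inv M x k *\<^sub>v Matrix.vec k (\<lambda>r. autocov M x (h + r))"

definition L_mat ::
  "'a measure \<Rightarrow> nat \<Rightarrow> (nat \<Rightarrow> real) \<Rightarrow> (int \<Rightarrow> 'a \<Rightarrow> real) \<Rightarrow> nat \<Rightarrow> nat \<Rightarrow> real Matrix.mat" where
  "L_mat M p a x h k = Matrix.mat k k (\<lambda>(r, s).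
     \<Sum>j<h. ma_coeff p a j * (companion k (direct_coeff M x 1 k) ^\<^sub>m (h - 1 - j)) $$ (r, s))"

definition f_plugin ::
  "'a measure \<Rightarrow> nat \<Rightarrow> (nat \<Rightarrow> real) \<Rightarrow> real \<Rightarrow> (int \<Rightarrow> 'a \<Rightarrow> real) \<Rightarrow> nat \<Rightarrow> nat \<Rightarrow> real" where
  "f_plugin M p a \<sigma> x h k =
     \<sigma>\<^sup>2 * mat_trace (autocov_mat M x k * L_mat M p a x h k * autocov_mat_inv M x k
                     * transpose_mat (L_mat M p a x h k))"

text \<open>Sample quantities are functions of one sample path \<open>y\<close>, of which they use only
  \<open>y 1, y 2, \<dots>\<close>. In \<open>sample_autocov_mat\<close>, if \<open>n < h + k\<close> the sum is empty, so the matrix is 0,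
  hence singular for \<open>k \<ge> 1\<close>.\<close>

definition sample_autocov_mat :: "(int \<Rightarrow> real) \<Rightarrow> nat \<Rightarrow> nat \<Rightarrow> nat \<Rightarrow> real Matrix.mat" where
  "sample_autocov_mat y n h k = Matrix.mat k k (\<lambda>(r, s).
     1 / (real n - real h - real k + 1) *
     (\<Sum>j\<in>{int k..int n - int h}. vec_index (lag_vec y k j) r * vec_index (lag_vec y k j) s))"

definition sample_coeff1 :: "(int \<Rightarrow> real) \<Rightarrow> nat \<Rightarrow> nat \<Rightarrow> real Matrix.vec" where
  "sample_coeff1 y n k = (THE v. v \<in> carrier_vec k \<and>
     sample_autocov_mat y n 1 k *\<^sub>v v =
       Matrix.vec k (\<lambda>r. 1 / (real n - real k) *
         (\<Sum>j\<in>{int k..int n - 1}. vec_index (lag_vec y k j) r * y (j + 1))))"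

definition plugin_coeff :: "(int \<Rightarrow> real) \<Rightarrow> nat \<Rightarrow> nat \<Rightarrow> nat \<Rightarrow> real Matrix.vec" where
  "plugin_coeff y n h k =
     (companion k (sample_coeff1 y n k) ^\<^sub>m (h - 1)) *\<^sub>v sample_coeff1 y n k"

definition plugin_predictor :: "(int \<Rightarrow> real) \<Rightarrow> nat \<Rightarrow> nat \<Rightarrow> nat \<Rightarrow> real" where
  "plugin_predictor y n h k = scalar_prod (lag_vec y k (int n)) (plugin_coeff y n h k)"

(* Depends on the sample path, so it is a random index. *)
definition start_index :: "(int \<Rightarrow> real) \<Rightarrow> nat \<Rightarrow> nat \<Rightarrow> nat" where
  "start_index y h K = (LEAST m. 1 \<le> m \<and> (\<forall>i\<ge>m.
     invertible_mat (sample_autocov_mat y i 1 K) \<and> invertible_mat (sample_autocov_mat y i h K)))"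

definition APE_plugin :: "(int \<Rightarrow> real) \<Rightarrow> nat \<Rightarrow> nat \<Rightarrow> nat \<Rightarrow> nat \<Rightarrow> real" where
  "APE_plugin y K n h k =
     (\<Sum>i\<in>{start_index y h K..n - h}. (y (int i + int h) - plugin_predictor y i h k)\<^sup>2)"

end

theory Submission
  imports Defs "HOL-Complex_Analysis.Complex_Analysis" "HOL-Real_Asymp.Real_Asymp"
    "Jordan_Normal_Form.Determinant"
begin

text \<open>
  Write the regression of \<open>x\<^sub>i\<^sub>+\<^sub>1\<close> on \<open>X\<^sub>i = (x\<^sub>i, \<dots>, x\<^sub>i\<^sub>-\<^sub>k\<^sub>+\<^sub>1)\<close> with score
  \<open>S\<^sub>n = \<Sum>\<^sub>i\<^sub><\<^sub>n X\<^sub>i \<epsilon>\<^sub>i\<^sub>+\<^sub>1\<close>. Up to finitely many indices the excess of the prediction error over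
  \<open>\<eta>\<^sub>i\<close> is \<open>u\<^sub>i = X\<^sub>i' H\<^sub>i S\<^sub>i / i\<close>, where \<open>H\<^sub>i\<close> is predictable and converges to
  \<open>L \<Gamma>\<^sup>-\<^sup>1\<close>. The cross term \<open>\<Sum> u\<^sub>i \<eta>\<^sub>i\<close> is a martingale transform, hence negligible against
  \<open>\<Sum> u\<^sub>i\<^sup>2\<close>, and only finitely many terms depend on the start index.

  It remains to find \<open>\<Sum> X\<^sub>r X\<^sub>r' S\<^sub>s S\<^sub>s' / i\<^sup>2\<close>. Summation by parts replaces \<open>X\<^sub>r X\<^sub>r'\<close> by its mean
  \<open>\<Gamma>\<^sub>r\<^sub>r'\<close>. Put \<open>V\<^sub>n = S\<^sub>s S\<^sub>s' / n\<close> and \<open>Q\<^sub>n = \<Sum>\<^sub>i\<^sub><\<^sub>n V\<^sub>i / (i + 1)\<close>. Then \<open>Z = V + Q\<close> is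
  \<open>\<sigma>\<^sup>2 \<Gamma>\<^sub>s\<^sub>s' log n + o(log n)\<close>, while \<open>n Q\<^sub>n = \<Sum>\<^sub>i\<^sub><\<^sub>n Z\<^sub>i\<close>; so \<open>Q\<close> is a Cesaro mean of \<open>Z\<close> and has
  the same expansion, without any law of the iterated logarithm for \<open>S\<close>. All error terms are controlled by
  the total of the quantities being estimated, which is thereby seen to be \<open>O(log n)\<close>.
\<close>

section \<open>Convergence of square integrable martingales\<close>

text \<open>The obstacle is circular: a martingale error is small only relative to its own quadratic
  variation, and these variations are built from the score whose growth is sought. Smallness is
  therefore a bound valid for all n with an additive constant, not a limit, so that half of the
  unknown can be moved to the other side. The sum of the squared weights X_r S_s / i is itself one
  of the fourth order sums to be evaluated, and this closes the loop.

  The conditional moment of order \<alpha> is bounded only by a finite random variable, so its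
  expectation may be infinite; predictable truncation at a level N, chosen afterwards path by path,
  replaces integrability. The condition \<alpha> > 2 enters when squared noise is replaced by its
  variance, with weights whose powers of some order above 1 are summable after self-normalization.

  The trace arises because, with H = L Gamma^-1, the fourth order sums add up to tr(Gamma H Gamma
  H'), and H Gamma = L. The factor L comes from telescoping the difference of two companion powers
  exactly, with the fitted impulse response in place of b_j.\<close>

lemma abs_mult_le_sum_squares:
  fixes x y :: real
  shows "\<bar>x * y\<bar> \<le> x\<^sup>2 + y\<^sup>2"
proof -
  have "2 * (\<bar>x\<bar> * \<bar>y\<bar>) \<le> x\<^sup>2 + y\<^sup>2"
    using sum_squares_bound[of "\<bar>x\<bar>" "\<bar>y\<bar>"] by simp
  moreover have "0 \<le> \<bar>x\<bar> * \<bar>y\<bar>" by simp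
  ultimately show ?thesis unfolding abs_mult by linarith
qed

text \<open>Tonelli in the extended reals: the series has finite expectation, hence is finite almost
  everywhere.\<close>

lemma AE_summable_of_integral:
  fixes f :: "nat \<Rightarrow> 'a \<Rightarrow> real"
  assumes int: "\<And>i. integrable M (f i)" and nonneg: "\<And>i \<omega>. 0 \<le> f i \<omega>"
    and sm: "summable (\<lambda>i. \<integral>\<omega>. f i \<omega> \<partial>M)"
  shows "AE \<omega> in M. summable (\<lambda>i. f i \<omega>)"
proof -
  have [measurable]: "f i \<in> borel_measurable M" for i
    using int by auto
  have "(\<integral>\<^sup>+\<omega>. (\<Sum>i. ennreal (f i \<omega>)) \<partial>M) = (\<Sum>i. \<integral>\<^sup>+\<omega>. ennreal (f i \<omega>) \<partial>M)"
    by (rule nn_integral_suminf) simp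
  also have "\<dots> = (\<Sum>i. ennreal (\<integral>\<omega>. f i \<omega> \<partial>M))"
    using int nonneg by (simp add: nn_integral_eq_integral)
  also have "\<dots> = ennreal (\<Sum>i. \<integral>\<omega>. f i \<omega> \<partial>M)"
    by (rule suminf_ennreal2) (auto simp: nonneg sm)
  finally have "(\<integral>\<^sup>+\<omega>. (\<Sum>i. ennreal (f i \<omega>)) \<partial>M) \<noteq> \<infinity>" by simp
  then have "AE \<omega> in M. (\<Sum>i. ennreal (f i \<omega>)) \<noteq> \<infinity>"
    by (intro nn_integral_noteq_infinite) auto
  then show ?thesis
  proof eventually_elim
    case (elim \<omega>)
    show ?case by (rule summable_suminf_not_top[OF nonneg]) (use elim in simp)
  qed
qed

locale filtered_space = prob_space M for M :: "'a measure" +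
  fixes G :: "nat \<Rightarrow> 'a measure"
  assumes subalg: "subalgebra M (G i)"
    and mono: "i \<le> j \<Longrightarrow> sets (G i) \<subseteq> sets (G j)"
begin

lemma sigma_finite_subalgebra: "sigma_finite_subalgebra M (G i)"
proof -
  have "finite_measure M" by unfold_locales
  then show ?thesis
    using subalg[of i] by (simp add: finite_measure_subalgebra_is_sigma_finite
        finite_measure_subalgebra.intro finite_measure_subalgebra_axioms.intro)
qed

lemma measurable_mono: "f \<in> borel_measurable (G i) \<Longrightarrow> i \<le> j \<Longrightarrow> f \<in> borel_measurable (G j)"
proof -
  assume f: "f \<in> borel_measurable (G i)" and "i \<le> j"
  then have "subalgebra (G j) (G i)"
    using subalg[of i] subalg[of j] mono[of i j] by (simp add: subalgebra_def)
  then show "f \<in> borel_measurable (G j)" using f by (rule measurable_from_subalg)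
qed

lemma measurable_M: "f \<in> borel_measurable (G i) \<Longrightarrow> f \<in> borel_measurable M"
  by (rule measurable_from_subalg[OF subalg])

text \<open>The index is shifted: \<open>d i\<close> is revealed at stage \<open>Suc i\<close> and
  centred given \<open>G i\<close>, so a weight that is measurable for \<open>G i\<close> with the
  same index is predictable.\<close>

definition mart_diff :: "(nat \<Rightarrow> 'a \<Rightarrow> real) \<Rightarrow> bool" where
  "mart_diff d \<longleftrightarrow> (\<forall>i. d i \<in> borel_measurable (G (Suc i)) \<and> integrable M (\<lambda>\<omega>. (d i \<omega>)\<^sup>2)
     \<and> (AE \<omega> in M. real_cond_exp M (G i) (d i) \<omega> = 0))"

lemma square_integrable_integrable:
  assumes "f \<in> borel_measurable M" "integrable M (\<lambda>\<omega>. (f \<omega>)\<^sup>2)"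
  shows "integrable M (f :: 'a \<Rightarrow> real)"
proof (rule Bochner_Integration.integrable_bound)
  show "integrable M (\<lambda>\<omega>. 1 + (f \<omega>)\<^sup>2)" using assms by simp
  have "\<bar>y\<bar> \<le> \<bar>1 + y\<^sup>2\<bar>" for y :: real
  proof -
    have "0 \<le> (\<bar>y\<bar> - 1)\<^sup>2" by simp
    then have "2 * \<bar>y\<bar> \<le> 1 + y\<^sup>2" by (simp add: power2_diff)
    then show ?thesis by linarith
  qed
  then show "AE \<omega> in M. norm (f \<omega>) \<le> norm (1 + (f \<omega>)\<^sup>2)"
    by (intro AE_I2) (simp only: real_norm_def)
qed (use assms in auto)

lemma integrable_prod_squares:
  fixes f g :: "'a \<Rightarrow> real"
  assumes [measurable]: "f \<in> borel_measurable M" "g \<in> borel_measurable M"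
    and "integrable M (\<lambda>\<omega>. (f \<omega>)\<^sup>2)" "integrable M (\<lambda>\<omega>. (g \<omega>)\<^sup>2)"
  shows "integrable M (\<lambda>\<omega>. f \<omega> * g \<omega>)"
proof (rule Bochner_Integration.integrable_bound)
  show "integrable M (\<lambda>\<omega>. (f \<omega>)\<^sup>2 + (g \<omega>)\<^sup>2)" using assms by simp
  have "\<bar>x * y\<bar> \<le> \<bar>x\<^sup>2 + y\<^sup>2\<bar>" for x y :: real
    using abs_mult_le_sum_squares[of x y] by linarith
  then show "AE \<omega> in M. norm (f \<omega> * g \<omega>) \<le> norm ((f \<omega>)\<^sup>2 + (g \<omega>)\<^sup>2)"
    by (intro AE_I2) (simp only: real_norm_def)
qed simp

lemma integral_predictable_mult:
  fixes f g :: "'a \<Rightarrow> real"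
  assumes [measurable]: "f \<in> borel_measurable (G i)" "g \<in> borel_measurable M"
    and int: "integrable M (\<lambda>\<omega>. f \<omega> * g \<omega>)"
    and zero: "AE \<omega> in M. real_cond_exp M (G i) g \<omega> = 0"
  shows "(\<integral>\<omega>. f \<omega> * g \<omega> \<partial>M) = 0"
proof -
  interpret s: sigma_finite_subalgebra M "G i" by (rule sigma_finite_subalgebra)
  have [measurable]: "f \<in> borel_measurable M" by (rule measurable_M[OF assms(1)])
  have "(\<integral>\<omega>. f \<omega> * g \<omega> \<partial>M) = (\<integral>\<omega>. f \<omega> * real_cond_exp M (G i) g \<omega> \<partial>M)"
    by (rule s.real_cond_exp_intg(2)[OF int assms(1,2), symmetric])
  also have "\<dots> = (\<integral>\<omega>. 0 \<partial>M)"
  proof (rule integral_cong_AE)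
    show "AE \<omega> in M. f \<omega> * real_cond_exp M (G i) g \<omega> = 0" using zero by eventually_elim simp
  qed (simp_all add: borel_measurable_times measurable_M assms(1))
  finally show ?thesis by simp
qed

lemma mart_diff_partial_sum_measurable:
  assumes "mart_diff d" "n \<le> m"
  shows "(\<lambda>\<omega>. \<Sum>i<n. d i \<omega>) \<in> borel_measurable (G m)"
proof (rule borel_measurable_sum)
  fix i assume "i \<in> {..<n}"
  with assms show "d i \<in> borel_measurable (G m)"
    unfolding mart_diff_def by (simp add: measurable_mono[of "d i" "Suc i" m])
qed

text \<open>The partial sum is known before the next difference, so the cross term integrates to
  zero. Integrability and the formula share one induction because the cross term needs the
  former.\<close>

lemma mart_diff_square_sum:
  assumes d: "mart_diff d"
  shows "integrable M (\<lambda>\<omega>. (\<Sum>i<n. d i \<omega>)\<^sup>2) \<and>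
    (\<integral>\<omega>. (\<Sum>i<n. d i \<omega>)\<^sup>2 \<partial>M) = (\<Sum>i<n. \<integral>\<omega>. (d i \<omega>)\<^sup>2 \<partial>M)"
proof (induction n)
  case (Suc n)
  define S where "S \<omega> = (\<Sum>i<n. d i \<omega>)" for \<omega>
  have SG: "S \<in> borel_measurable (G n)"
    unfolding S_def using d by (rule mart_diff_partial_sum_measurable) simp
  have S: "S \<in> borel_measurable M" by (rule measurable_M[OF SG])
  have dn: "d n \<in> borel_measurable M" "integrable M (\<lambda>\<omega>. (d n \<omega>)\<^sup>2)"
    using d measurable_M[of "d n" "Suc n"] unfolding mart_diff_def by simp_all
  have IS: "integrable M (\<lambda>\<omega>. (S \<omega>)\<^sup>2)" using Suc unfolding S_def by simp
  have Id: "integrable M (\<lambda>\<omega>. S \<omega> * d n \<omega>)"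
    by (rule integrable_prod_squares[OF S dn(1) IS dn(2)])
  have z: "(\<integral>\<omega>. S \<omega> * d n \<omega> \<partial>M) = 0"
    by (rule integral_predictable_mult[OF SG dn(1) Id]) (use d in \<open>simp add: mart_diff_def\<close>)
  have eq: "(\<Sum>i<Suc n. d i \<omega>)\<^sup>2 = (S \<omega>)\<^sup>2 + 2 * (S \<omega> * d n \<omega>) + (d n \<omega>)\<^sup>2" for \<omega>
    by (simp add: S_def power2_eq_square algebra_simps)
  have "(\<integral>\<omega>. (S \<omega>)\<^sup>2 + 2 * (S \<omega> * d n \<omega>) + (d n \<omega>)\<^sup>2 \<partial>M)
      = (\<integral>\<omega>. (S \<omega>)\<^sup>2 \<partial>M) + 2 * (\<integral>\<omega>. S \<omega> * d n \<omega> \<partial>M) + (\<integral>\<omega>. (d n \<omega>)\<^sup>2 \<partial>M)"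
    using IS Id dn(2) by (subst Bochner_Integration.integral_add, simp_all)+
  moreover have "integrable M (\<lambda>\<omega>. (S \<omega>)\<^sup>2 + 2 * (S \<omega> * d n \<omega>) + (d n \<omega>)\<^sup>2)"
    using IS Id dn(2) by (intro Bochner_Integration.integrable_add integrable_mult_right)
  moreover have "(\<integral>\<omega>. (S \<omega>)\<^sup>2 \<partial>M) = (\<Sum>i<n. \<integral>\<omega>. (d i \<omega>)\<^sup>2 \<partial>M)"
    using Suc unfolding S_def by blast
  ultimately show ?case unfolding eq by (simp only: z sum.lessThan_Suc) simp
qed simp

lemma mart_diff_mult:
  assumes d: "mart_diff d" and v: "\<And>i. v i \<in> borel_measurable (G i)" and c: "\<And>i \<omega>. \<bar>v i \<omega>\<bar> \<le> c i"
  shows "mart_diff (\<lambda>i \<omega>. v i \<omega> * d i \<omega>)"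
  unfolding mart_diff_def
proof (intro allI conjI)
  fix i
  interpret s: sigma_finite_subalgebra M "G i" by (rule sigma_finite_subalgebra)
  have dn: "d i \<in> borel_measurable (G (Suc i))" "d i \<in> borel_measurable M" "integrable M (\<lambda>\<omega>. (d i \<omega>)\<^sup>2)"
    "AE \<omega> in M. real_cond_exp M (G i) (d i) \<omega> = 0"
    using d measurable_M[of "d i" "Suc i"] unfolding mart_diff_def by simp_all
  have vm [measurable]: "v i \<in> borel_measurable M" "v i \<in> borel_measurable (G (Suc i))"
    by (rule measurable_M[OF v], rule measurable_mono[OF v], simp)
  note [measurable] = dn(1,2)
  show "(\<lambda>\<omega>. v i \<omega> * d i \<omega>) \<in> borel_measurable (G (Suc i))" by simp
  show sq: "integrable M (\<lambda>\<omega>. (v i \<omega> * d i \<omega>)\<^sup>2)"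
  proof (rule Bochner_Integration.integrable_bound)
    show "integrable M (\<lambda>\<omega>. (c i)\<^sup>2 * (d i \<omega>)\<^sup>2)" using dn by simp
    have "(v i \<omega>)\<^sup>2 \<le> (c i)\<^sup>2" for \<omega> using c[of i \<omega>] by (simp add: abs_le_square_iff[symmetric])
    then show "AE \<omega> in M. norm ((v i \<omega> * d i \<omega>)\<^sup>2) \<le> norm ((c i)\<^sup>2 * (d i \<omega>)\<^sup>2)"
      by (intro AE_I2) (auto simp: power_mult_distrib intro: mult_right_mono)
  qed simp
  have "AE \<omega> in M. real_cond_exp M (G i) (\<lambda>\<omega>. v i \<omega> * d i \<omega>) \<omega> = v i \<omega> * real_cond_exp M (G i) (d i) \<omega>"
    by (rule s.real_cond_exp_mult[OF v dn(2)]) (rule square_integrable_integrable, use sq in auto)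
  with dn(4) show "AE \<omega> in M. real_cond_exp M (G i) (\<lambda>\<omega>. v i \<omega> * d i \<omega>) \<omega> = 0"
    by eventually_elim simp
qed

text \<open>Kolmogorov's maximal inequality: apply Chebyshev's inequality to the martingale stopped
  when it first exceeds the level.\<close>

lemma mart_diff_maximal:
  assumes d: "mart_diff d" and l: "0 < l"
  shows "measure M {\<omega>\<in>space M. \<exists>n\<le>N. l \<le> \<bar>\<Sum>i<n. d i \<omega>\<bar>} \<le> (\<Sum>i<N. \<integral>\<omega>. (d i \<omega>)\<^sup>2 \<partial>M) / l\<^sup>2"
proof -
  define S where "S n \<omega> = (\<Sum>i<n. d i \<omega>)" for n \<omega>
  have SG: "S n \<in> borel_measurable (G m)" if "n \<le> m" for n m
    unfolding S_def using d that by (rule mart_diff_partial_sum_measurable)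
  have [measurable]: "S n \<in> borel_measurable M" for n
    by (rule measurable_M[OF SG[of n n]]) simp
  \<comment> \<open>The weight is 1 until the level is first reached, so the transform by
    \<open>v\<close> is the martingale frozen at that time. Written as a finite product over
    \<open>n \<le> i\<close> it is visibly \<open>G i\<close>-measurable.\<close>
  define v where "v i \<omega> = (if \<exists>n\<in>{..i}. l \<le> \<bar>S n \<omega>\<bar> then 0 else 1 :: real)" for i \<omega>
  have v_prod: "v i = (\<lambda>\<omega>. \<Prod>n\<in>{..i}. if l \<le> \<bar>S n \<omega>\<bar> then 0 else 1)" for i
  proof
    fix \<omega>
    show "v i \<omega> = (\<Prod>n\<in>{..i}. if l \<le> \<bar>S n \<omega>\<bar> then 0 else 1)"
    proof (cases "\<exists>n\<in>{..i}. l \<le> \<bar>S n \<omega>\<bar>")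
      case True
      then have "(\<Prod>n\<in>{..i}. if l \<le> \<bar>S n \<omega>\<bar> then 0 else 1 :: real) = 0"
        by (intro prod_zero) auto
      with True show ?thesis by (simp add: v_def)
    next
      case False
      then have "(\<Prod>n\<in>{..i}. if l \<le> \<bar>S n \<omega>\<bar> then 0 else 1 :: real) = 1"
        by (intro prod.neutral) auto
      with False show ?thesis by (simp add: v_def)
    qed
  qed
  have v: "v i \<in> borel_measurable (G i)" for i
    unfolding v_prod
  proof (rule borel_measurable_prod)
    fix n assume "n \<in> {..i}"
    then have [measurable]: "S n \<in> borel_measurable (G i)" by (intro SG) simp
    show "(\<lambda>\<omega>. if l \<le> \<bar>S n \<omega>\<bar> then 0 else 1 :: real) \<in> borel_measurable (G i)" by measurable
  qed
  have vd: "mart_diff (\<lambda>i \<omega>. v i \<omega> * d i \<omega>)"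
    by (rule mart_diff_mult[OF d v, of "\<lambda>_. 1"]) (auto simp: v_def)
  define T where "T \<omega> = (\<Sum>i<N. v i \<omega> * d i \<omega>)" for \<omega>
  define B where "B = {\<omega>\<in>space M. \<exists>n\<in>{..N}. l \<le> \<bar>S n \<omega>\<bar>}"
  have B [measurable]: "B \<in> sets M" unfolding B_def by measurable
  have T2: "l\<^sup>2 * indicator B \<omega> \<le> (T \<omega>)\<^sup>2" for \<omega>
  proof (cases "\<omega> \<in> B")
    case True
    then obtain n where n: "n \<le> N" "l \<le> \<bar>S n \<omega>\<bar>" by (auto simp: B_def)
    \<comment> \<open>On \<open>B\<close> the weights are 1 exactly below the first hitting index,
      so \<open>T\<close> is the value of the martingale at the crossing.\<close>
    define \<tau> where "\<tau> = (LEAST n. l \<le> \<bar>S n \<omega>\<bar>)"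
    have \<tau>1: "l \<le> \<bar>S \<tau> \<omega>\<bar>" unfolding \<tau>_def by (rule LeastI, rule n(2))
    have "\<tau> \<le> n" unfolding \<tau>_def by (rule Least_le, rule n(2))
    then have \<tau>2: "\<tau> \<le> N" using n(1) by simp
    have \<tau>3: "\<not> l \<le> \<bar>S j \<omega>\<bar>" if "j < \<tau>" for j
      using that unfolding \<tau>_def by (rule not_less_Least)
    note \<tau> = \<tau>1 \<tau>2 \<tau>3
    have v': "v i \<omega> = (if i < \<tau> then 1 else 0)" for i
    proof (cases "i < \<tau>")
      case True
      then show ?thesis using \<tau>(3) by (auto simp: v_def)
    next
      case False
      then show ?thesis using \<tau>(1) by (auto simp: v_def)
    qed
    have "T \<omega> = (\<Sum>i<N. if i < \<tau> then d i \<omega> else 0)"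
      unfolding T_def by (rule sum.cong) (auto simp: v')
    also have "\<dots> = (\<Sum>i\<in>{..<N} \<inter> {i. i < \<tau>}. d i \<omega>)"
      by (subst sum.inter_restrict) (auto simp: Collect_conj_eq)
    also have "{..<N} \<inter> {i. i < \<tau>} = {..<\<tau>}" using \<tau>(2) by auto
    finally have "T \<omega> = S \<tau> \<omega>" by (simp add: S_def)
    then show ?thesis using \<tau>(1) True l abs_le_square_iff[of l "S \<tau> \<omega>"] by simp
  qed simp
  have "l\<^sup>2 * measure M B = (\<integral>\<omega>. l\<^sup>2 * indicator B \<omega> \<partial>M)"
    using B by simp
  also have "\<dots> \<le> (\<integral>\<omega>. (T \<omega>)\<^sup>2 \<partial>M)"
  proof (rule integral_mono)
    show "integrable M (\<lambda>\<omega>. l\<^sup>2 * indicator B \<omega>)"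
      by (intro integrable_mult_right integrable_real_indicator) (auto simp: emeasure_eq_measure)
    show "integrable M (\<lambda>\<omega>. (T \<omega>)\<^sup>2)"
      unfolding T_def by (rule mart_diff_square_sum[OF vd, THEN conjunct1])
  qed (rule T2)
  also have "\<dots> = (\<Sum>i<N. \<integral>\<omega>. (v i \<omega> * d i \<omega>)\<^sup>2 \<partial>M)"
    unfolding T_def by (rule mart_diff_square_sum[OF vd, THEN conjunct2])
  also have "\<dots> \<le> (\<Sum>i<N. \<integral>\<omega>. (d i \<omega>)\<^sup>2 \<partial>M)"
  proof (intro sum_mono integral_mono)
    show "integrable M (\<lambda>\<omega>. (v i \<omega> * d i \<omega>)\<^sup>2)" for i using vd by (simp add: mart_diff_def)
    show "integrable M (\<lambda>\<omega>. (d i \<omega>)\<^sup>2)" for i using d by (simp add: mart_diff_def)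
    have "v i \<omega> = 0 \<or> v i \<omega> = 1" for i \<omega> by (simp add: v_def)
    then show "(v i \<omega> * d i \<omega>)\<^sup>2 \<le> (d i \<omega>)\<^sup>2" for i \<omega> by (metis mult_1 mult_zero_left order_refl zero_le_power2 zero_power2)
  qed
  finally have "measure M B \<le> (\<Sum>i<N. \<integral>\<omega>. (d i \<omega>)\<^sup>2 \<partial>M) / l\<^sup>2"
    using l by (simp add: pos_le_divide_eq mult.commute)
  moreover have "B = {\<omega>\<in>space M. \<exists>n\<le>N. l \<le> \<bar>\<Sum>i<n. d i \<omega>\<bar>}"
    by (simp add: B_def S_def Bex_def)
  ultimately show ?thesis by simp
qed

text \<open>The maximal inequality for the differences beyond \<open>m\<close> bounds the chance of
  a large oscillation after \<open>m\<close> by a tail of the variance series, for every horizon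
  \<open>N\<close>. Oscillation after every \<open>m\<close> then has probability below all tails,
  hence zero.\<close>

lemma mart_diff_oscillation:
  assumes d: "mart_diff d" and sm: "summable (\<lambda>i. \<integral>\<omega>. (d i \<omega>)\<^sup>2 \<partial>M)" and l: "0 < l"
  shows "AE \<omega> in M. \<exists>m. \<forall>n\<ge>m. \<bar>(\<Sum>i<n. d i \<omega>) - (\<Sum>i<m. d i \<omega>)\<bar> < l"
proof -
  have [measurable]: "(\<lambda>\<omega>. \<Sum>i<n. d i \<omega>) \<in> borel_measurable M" for n
    by (rule measurable_M[of _ n], rule mart_diff_partial_sum_measurable[OF d]) simp
  define B where "B m N = {\<omega>\<in>space M. \<exists>n\<in>{m..N}. l \<le> \<bar>(\<Sum>i<n. d i \<omega>) - (\<Sum>i<m. d i \<omega>)\<bar>}" for m N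
  have [measurable]: "B m N \<in> sets M" for m N unfolding B_def by measurable
  define E where "E i = (\<integral>\<omega>. (d i \<omega>)\<^sup>2 \<partial>M)" for i
  have E0: "0 \<le> E i" for i by (simp add: E_def)
  have bound: "measure M (B m N) \<le> (\<Sum>i. E (i + m)) / l\<^sup>2" for m N
  proof -
    \<comment> \<open>Zeroing the first \<open>m\<close> differences is a predictable transform, so
      the maximal inequality sees only the tail.\<close>
    define d' where "d' i \<omega> = (if i < m then 0 else 1) * d i \<omega>" for i \<omega>
    have d': "mart_diff d'"
      unfolding d'_def by (rule mart_diff_mult[OF d, of _ "\<lambda>_. 1"]) auto
    have eq: "(\<Sum>i<n. d' i \<omega>) = (\<Sum>i<n. d i \<omega>) - (\<Sum>i<m. d i \<omega>)" if "m \<le> n" for n \<omega>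
    proof -
      have "(\<Sum>i<n. d' i \<omega>) = (\<Sum>i<m. d' i \<omega>) + (\<Sum>i\<in>{m..<n}. d' i \<omega>)"
        using sum.atLeastLessThan_concat[of 0 m n "\<lambda>i. d' i \<omega>"] that by (simp add: atLeast0LessThan)
      also have "\<dots> = (\<Sum>i\<in>{m..<n}. d i \<omega>)" by (simp add: d'_def)
      also have "\<dots> = (\<Sum>i<n. d i \<omega>) - (\<Sum>i<m. d i \<omega>)"
        using sum.atLeastLessThan_concat[of 0 m n "\<lambda>i. d i \<omega>"] that by (simp add: atLeast0LessThan)
      finally show ?thesis .
    qed
    have "B m N \<subseteq> {\<omega>\<in>space M. \<exists>n\<le>N. l \<le> \<bar>\<Sum>i<n. d' i \<omega>\<bar>}"
      using eq by (fastforce simp: B_def)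
    moreover have "{\<omega>\<in>space M. \<exists>n\<le>N. l \<le> \<bar>\<Sum>i<n. d' i \<omega>\<bar>} \<in> sets M"
    proof -
      have [measurable]: "(\<lambda>\<omega>. \<Sum>i<n. d' i \<omega>) \<in> borel_measurable M" for n
        by (rule measurable_M[of _ n], rule mart_diff_partial_sum_measurable[OF d']) simp
      have "{\<omega>\<in>space M. \<exists>n\<in>{..N}. l \<le> \<bar>\<Sum>i<n. d' i \<omega>\<bar>} \<in> sets M" by measurable
      then show ?thesis by (simp add: Bex_def)
    qed
    ultimately have "measure M (B m N) \<le> measure M {\<omega>\<in>space M. \<exists>n\<le>N. l \<le> \<bar>\<Sum>i<n. d' i \<omega>\<bar>}"
      by (rule finite_measure_mono)
    also have "\<dots> \<le> (\<Sum>i<N. \<integral>\<omega>. (d' i \<omega>)\<^sup>2 \<partial>M) / l\<^sup>2"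
      by (rule mart_diff_maximal[OF d' l])
    also have "(\<Sum>i<N. \<integral>\<omega>. (d' i \<omega>)\<^sup>2 \<partial>M) = (\<Sum>i<N. if i < m then 0 else E i)"
      by (rule sum.cong) (auto simp: d'_def E_def)
    also have "\<dots> \<le> (\<Sum>i<N+m. if i < m then 0 else E i)"
      by (rule sum_mono2) (auto simp: E0)
    also have "\<dots> = (\<Sum>i<N. E (i + m))"
      by (simp add: sum.nat_group[symmetric] lessThan_atLeast0 sum.atLeastLessThan_concat[of 0 m "N+m", symmetric]
          sum.shift_bounds_nat_ivl[of _ 0 m N, simplified])
    also have "\<dots> \<le> (\<Sum>i. E (i + m))"
      by (rule sum_le_suminf) (use summable_ignore_initial_segment[OF sm, of m] E0 in \<open>auto simp: E_def\<close>)
    finally show ?thesis by (simp add: divide_right_mono)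
  qed
  define BB where "BB m = (\<Union>N. B m N)" for m
  have [measurable]: "BB m \<in> sets M" for m unfolding BB_def by measurable
  have bound2: "measure M (BB m) \<le> (\<Sum>i. E (i + m)) / l\<^sup>2" for m
  proof (rule LIMSEQ_le_const2)
    show "(\<lambda>N. measure M (B m N)) \<longlonglongrightarrow> measure M (BB m)" unfolding BB_def
      by (rule finite_Lim_measure_incseq) (auto simp: incseq_def B_def)
    show "\<exists>N. \<forall>n\<ge>N. measure M (B m n) \<le> (\<Sum>i. E (i + m)) / l\<^sup>2" using bound by auto
  qed
  have tail: "(\<lambda>m. (\<Sum>i. E (i + m)) / l\<^sup>2) \<longlonglongrightarrow> 0"
    using suminf_exist_split2[of E] sm unfolding E_def by (intro tendsto_divide_zero) simp
  define Z where "Z = (\<Inter>m. BB m)"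
  have [measurable]: "Z \<in> sets M" unfolding Z_def by measurable
  have "measure M Z \<le> 0"
  proof (rule LIMSEQ_le_const[OF tail], intro exI allI impI)
    fix m
    have "measure M Z \<le> measure M (BB m)" by (rule finite_measure_mono) (auto simp: Z_def)
    then show "measure M Z \<le> (\<Sum>i. E (i + m)) / l\<^sup>2" using bound2[of m] by simp
  qed
  then have "measure M Z = 0" by (simp add: measure_le_0_iff)
  then have "AE \<omega> in M. \<omega> \<notin> Z" by (intro AE_not_in) (auto simp: null_sets_def emeasure_eq_measure)
  with AE_space show ?thesis
  proof eventually_elim
    case (elim \<omega>)
    then obtain m where m: "\<And>N. \<omega> \<notin> B m N" by (auto simp: Z_def BB_def)
    have "\<bar>(\<Sum>i<n. d i \<omega>) - (\<Sum>i<m. d i \<omega>)\<bar> < l" if "n \<ge> m" for n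
      using m[of n] that elim by (auto simp: B_def not_le)
    then show ?case by blast
  qed
qed

lemma mart_diff_convergent:
  assumes d: "mart_diff d" and sm: "summable (\<lambda>i. \<integral>\<omega>. (d i \<omega>)\<^sup>2 \<partial>M)"
  shows "AE \<omega> in M. summable (\<lambda>i. d i \<omega>)"
proof -
  have "AE \<omega> in M. \<forall>k::nat. \<exists>m. \<forall>n\<ge>m. \<bar>(\<Sum>i<n. d i \<omega>) - (\<Sum>i<m. d i \<omega>)\<bar> < 1 / (real k + 1)"
    unfolding AE_all_countable by (intro allI mart_diff_oscillation[OF d sm]) simp
  then show ?thesis
  proof eventually_elim
    case (elim \<omega>)
    have "Cauchy (\<lambda>n. \<Sum>i<n. d i \<omega>)"
    proof (rule metric_CauchyI)
      fix r :: real assume "0 < r"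
      then obtain k :: nat where k: "1 / (real k + 1) < r / 2"
        using reals_Archimedean[of "r/2"] by (auto simp: inverse_eq_divide add.commute)
      obtain m where m: "\<And>n. n \<ge> m \<Longrightarrow> \<bar>(\<Sum>i<n. d i \<omega>) - (\<Sum>i<m. d i \<omega>)\<bar> < 1 / (real k + 1)"
        using elim by meson
      have "dist (\<Sum>i<n. d i \<omega>) (\<Sum>i<n'. d i \<omega>) < r" if "n \<ge> m" "n' \<ge> m" for n n'
        using m[OF that(1)] m[OF that(2)] k by (simp add: dist_real_def)
      then show "\<exists>M. \<forall>m\<ge>M. \<forall>n\<ge>M. dist (\<Sum>i<m. d i \<omega>) (\<Sum>i<n. d i \<omega>) < r" by blast
    qed
    then show ?case by (simp add: summable_iff_convergent Cauchy_convergent_iff)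
  qed
qed

end

section \<open>Negligible sequences\<close>

text \<open>\<open>f\<close> is negligible with respect to \<open>g\<close>. If \<open>g\<close> tends to infinity this is
  \<open>f \<in> o(g)\<close>, but it also makes sense for bounded \<open>g\<close>.\<close>

definition negl :: "(nat \<Rightarrow> real) \<Rightarrow> (nat \<Rightarrow> real) \<Rightarrow> bool" where
  "negl f g \<longleftrightarrow> (\<forall>d>0. \<exists>C. \<forall>n. \<bar>f n\<bar> \<le> d * g n + C)"

lemma neglE: 
  assumes "negl f g" "d > 0" 
  obtains C where "\<And>n. \<bar>f n\<bar> \<le> d * g n + C"
  using assms unfolding negl_def by blast

lemma neglI: "(\<And>d. d > 0 \<Longrightarrow> \<exists>C. \<forall>n. \<bar>f n\<bar> \<le> d * g n + C) \<Longrightarrow> negl f g"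
  unfolding negl_def by blast

lemma negl_mono:
  assumes f: "negl f g" and K: "\<And>n. g n \<le> K * g' n + K'" and K0: "0 < K"
  shows "negl f g'"
proof (rule neglI)
  fix d :: real assume d: "d > 0"
  obtain C where C: "\<And>n. \<bar>f n\<bar> \<le> d / K * g n + C" using neglE[OF f, of "d / K"] d K0 by auto
  have "\<bar>f n\<bar> \<le> d * g' n + (d / K * K' + C)" for n
  proof -
    have "d / K * g n \<le> d / K * (K * g' n + K')" by (rule mult_left_mono[OF K]) (use d K0 in simp)
    also have "\<dots> = d * g' n + d / K * K'" using K0 by (simp add: field_simps)
    finally show ?thesis using C[of n] by simp
  qed
  then show "\<exists>C. \<forall>n. \<bar>f n\<bar> \<le> d * g' n + C" by blast
qed

lemma negl_le:
  assumes f: "negl f g" and K: "\<And>n. \<bar>f' n\<bar> \<le> K * \<bar>f n\<bar> + K'" and K0: "0 < K"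
  shows "negl f' g"
proof (rule neglI)
  fix d :: real assume d: "d > 0"
  obtain C where C: "\<And>n. \<bar>f n\<bar> \<le> d / K * g n + C" using neglE[OF f, of "d / K"] d K0 by auto
  have "\<bar>f' n\<bar> \<le> d * g n + (K * C + K')" for n
  proof -
    have "K * \<bar>f n\<bar> \<le> K * (d / K * g n + C)" by (rule mult_left_mono[OF C]) (use K0 in simp)
    also have "\<dots> = d * g n + K * C" using K0 by (simp add: field_simps)
    finally show ?thesis using K[of n] by simp
  qed
  then show "\<exists>C. \<forall>n. \<bar>f' n\<bar> \<le> d * g n + C" by blast
qed

lemma negl_add:
  assumes "negl f g" "negl f' g" shows "negl (\<lambda>n. f n + f' n) g"
proof (rule neglI)
  fix d :: real assume d: "d > 0"
  obtain C where C: "\<And>n. \<bar>f n\<bar> \<le> d / 2 * g n + C" using neglE[OF assms(1), of "d / 2"] d by auto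
  obtain C' where C': "\<And>n. \<bar>f' n\<bar> \<le> d / 2 * g n + C'" using neglE[OF assms(2), of "d / 2"] d by auto
  have "\<bar>f n + f' n\<bar> \<le> d * g n + (C + C')" for n
    using C[of n] C'[of n] by simp
  then show "\<exists>C. \<forall>n. \<bar>f n + f' n\<bar> \<le> d * g n + C" by blast
qed

lemma negl_uminus: "negl f g \<Longrightarrow> negl (\<lambda>n. - f n) g"
  unfolding negl_def by simp

lemma negl_diff: "negl f g \<Longrightarrow> negl f' g \<Longrightarrow> negl (\<lambda>n. f n - f' n) g"
  using negl_add[of f g "\<lambda>n. - f' n"] negl_uminus[of f' g] by simp

lemma negl_cmult: "negl f g \<Longrightarrow> negl (\<lambda>n. c * f n) g"
  by (rule negl_le[of f g _ "\<bar>c\<bar> + 1" 0]) (auto simp: abs_mult algebra_simps)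

lemma negl_bounded:
  assumes "\<And>n. \<bar>f n\<bar> \<le> C" "\<And>n. 0 \<le> g n" shows "negl f g"
proof (rule neglI)
  fix d :: real assume d: "d > 0"
  have "\<bar>f n\<bar> \<le> d * g n + C" for n
    using assms(1)[of n] mult_nonneg_nonneg[OF less_imp_le[OF d] assms(2)[of n]] by linarith
  then show "\<exists>C. \<forall>n. \<bar>f n\<bar> \<le> d * g n + C" by blast
qed

lemma negl_sum:
  assumes "finite I" "\<And>i. i \<in> I \<Longrightarrow> negl (f i) g" "\<And>n. 0 \<le> g n"
  shows "negl (\<lambda>n. \<Sum>i\<in>I. f i n) g"
  using assms(1,2)
proof (induction I rule: finite_induct)
  case empty
  show ?case by (rule negl_bounded[of _ 0]) (auto simp: assms)
next
  case (insert i I)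
  then show ?case by (simp add: negl_add)
qed

text \<open>Bootstrap: \<open>g\<close> is bounded through a term that is negligible against
  \<open>g\<close> itself. With \<open>d = 1/2\<close> half of \<open>g\<close> moves to the left,
  whence the factor 2.\<close>

lemma negl_absorb:
  assumes f: "negl f g" and g: "\<And>n. g n \<le> K * g' n + K' + f n"
  shows "\<exists>C. \<forall>n. g n \<le> 2 * K * g' n + C"
proof -
  obtain C where C: "\<And>n. \<bar>f n\<bar> \<le> 1 / 2 * g n + C" using neglE[OF f, of "1/2"] by auto
  have "g n \<le> 2 * K * g' n + (2 * K' + 2 * C)" for n
    using g[of n] C[of n] by simp
  then show ?thesis by blast
qed

text \<open>A Toeplitz-type statement: after finitely many terms, which go into the constant, the
  coefficients are below \<open>d\<close>.\<close>

lemma negl_weighted: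
  assumes c: "c \<longlonglongrightarrow> 0"
  shows "negl (\<lambda>n. \<Sum>i<n. c i * t i) (\<lambda>n. \<Sum>i<n. \<bar>t i\<bar>)"
proof (rule neglI)
  fix d :: real assume d: "d > 0"
  then obtain N where N: "\<And>i. i \<ge> N \<Longrightarrow> \<bar>c i\<bar> < d"
    using LIMSEQ_D[OF c, of d] by auto
  define C where "C = (\<Sum>i<N. \<bar>c i * t i\<bar>)"
  have "\<bar>\<Sum>i<n. c i * t i\<bar> \<le> d * (\<Sum>i<n. \<bar>t i\<bar>) + C" for n
  proof -
    have "\<bar>\<Sum>i<n. c i * t i\<bar> \<le> (\<Sum>i<n. \<bar>c i * t i\<bar>)" by (rule sum_abs)
    also have "\<dots> \<le> (\<Sum>i<n. d * \<bar>t i\<bar> + (if i < N then \<bar>c i * t i\<bar> else 0))"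
    proof (rule sum_mono)
      fix i
      show "\<bar>c i * t i\<bar> \<le> d * \<bar>t i\<bar> + (if i < N then \<bar>c i * t i\<bar> else 0)"
        using N[of i] d by (auto simp: abs_mult intro: mult_right_mono)
    qed
    also have "\<dots> = d * (\<Sum>i<n. \<bar>t i\<bar>) + (\<Sum>i<n. if i < N then \<bar>c i * t i\<bar> else 0)"
      by (simp add: sum.distrib sum_distrib_left)
    also have "(\<Sum>i<n. if i < N then \<bar>c i * t i\<bar> else 0) \<le> C"
    proof -
      have "(\<Sum>i<n. if i < N then \<bar>c i * t i\<bar> else 0) = (\<Sum>i\<in>{..<n} \<inter> {i. i < N}. \<bar>c i * t i\<bar>)"
        by (subst sum.inter_restrict) auto
      also have "\<dots> \<le> C" unfolding C_def by (rule sum_mono2) auto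
      finally show ?thesis .
    qed
    finally show ?thesis by simp
  qed
  then show "\<exists>C. \<forall>n. \<bar>\<Sum>i<n. c i * t i\<bar> \<le> d * (\<Sum>i<n. \<bar>t i\<bar>) + C" by blast
qed

lemma negl_mult:
  assumes c: "c \<longlonglongrightarrow> 0"
  shows "negl (\<lambda>n. c n * g n) (\<lambda>n. \<bar>g n\<bar>)"
proof (rule neglI)
  fix d :: real assume d: "d > 0"
  then obtain N where N: "\<And>i. i \<ge> N \<Longrightarrow> \<bar>c i\<bar> < d"
    using LIMSEQ_D[OF c, of d] by auto
  have "\<bar>c n * g n\<bar> \<le> d * \<bar>g n\<bar> + (\<Sum>i<N. \<bar>c i * g i\<bar>)" for n
  proof (cases "n < N")
    case True
    then have "\<bar>c n * g n\<bar> \<le> (\<Sum>i<N. \<bar>c i * g i\<bar>)" by (intro member_le_sum) auto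
    then show ?thesis using d by (simp add: add_increasing)
  next
    case False
    then have "\<bar>c n\<bar> * \<bar>g n\<bar> \<le> d * \<bar>g n\<bar>" using N[of n] by (intro mult_right_mono) auto
    moreover have "0 \<le> (\<Sum>i<N. \<bar>c i * g i\<bar>)" by (rule sum_nonneg) simp
    ultimately show ?thesis unfolding abs_mult by linarith
  qed
  then show "\<exists>C. \<forall>n. \<bar>c n * g n\<bar> \<le> d * \<bar>g n\<bar> + C" by blast
qed

section \<open>Kronecker's lemma and self-normalized series\<close>

text \<open>Kronecker's lemma, by summation by parts against the tails of the convergent series.\<close>

lemma kronecker_negl:
  fixes w B :: "nat \<Rightarrow> real"
  assumes w: "summable w" and B: "incseq B" and B0: "0 \<le> B 0"
  shows "negl (\<lambda>n. \<Sum>i<n. B (Suc i) * w i) B"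
proof -
  define R where "R i = (\<Sum>j. w (j + i))" for i
  have R: "w i = R i - R (Suc i)" for i
    unfolding R_def using suminf_split_head[OF summable_ignore_initial_segment[OF w, of i]] by simp
  have R0: "R \<longlonglongrightarrow> 0"
    using suminf_exist_split2[OF w] unfolding R_def .
  have Bn: "0 \<le> B n" for n using incseqD[OF B, of 0 n] B0 by simp
  have eq: "(\<Sum>i<n. B (Suc i) * w i) = (\<Sum>i<n. R i * (B (Suc i) - B i)) + (B 0 * R 0 - B n * R n)" for n
    by (induction n) (simp_all add: R algebra_simps)
  have "\<bar>B (Suc i) - B i\<bar> = B (Suc i) - B i" for i
    using incseq_SucD[OF B, of i] by simp
  then have "(\<Sum>i<n. \<bar>B (Suc i) - B i\<bar>) = B n - B 0" for n
    by (induction n) simp_all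
  with negl_weighted[OF R0, of "\<lambda>i. B (Suc i) - B i"]
  have "negl (\<lambda>n. \<Sum>i<n. R i * (B (Suc i) - B i)) (\<lambda>n. B n - B 0)" by simp
  then have 1: "negl (\<lambda>n. \<Sum>i<n. R i * (B (Suc i) - B i)) B"
    by (rule negl_mono[of _ _ 1 _ 0]) (use B0 in auto)
  have 2: "negl (\<lambda>n. B n * R n) B"
    using negl_mult[OF R0, of B] Bn by (simp add: mult.commute)
  have 3: "negl (\<lambda>n. B 0 * R 0) B" by (rule negl_bounded[OF order_refl Bn])
  show ?thesis unfolding eq by (intro negl_add negl_diff 1 2 3)
qed

text \<open>A series form of the integral of \<open>u powr (- q)\<close> over
  \<open>u \<ge> 1\<close>: each term is at most an increment of the antiderivative, and these
  telescope. The normalizer starts at 1 and contains the current term.\<close>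

lemma summable_self_normalized:
  fixes t :: "nat \<Rightarrow> real"
  assumes t: "\<And>i. 0 \<le> t i" and q: "1 < q"
  shows "summable (\<lambda>i. t i / (1 + (\<Sum>j<Suc i. t j)) powr q)"
proof -
  define U where "U n = 1 + (\<Sum>j<n. t j)" for n
  have U1: "1 \<le> U n" for n unfolding U_def using t by (simp add: sum_nonneg)
  have key: "(b - a) / b powr q \<le> (a powr (1 - q) - b powr (1 - q)) / (q - 1)"
    if "0 < a" "a \<le> b" for a b :: real
  proof (cases "a = b")
    case False
    then have ab: "a < b" using that by simp
    \<comment> \<open>Mean value theorem for \<open>u powr (1 - q)\<close>, whose derivative is
      smallest in absolute value at the right end \<open>b\<close>.\<close>
    have "\<exists>z>a. z < b \<and> b powr (1-q) - a powr (1-q) = (b - a) * ((1-q) * z powr (1 - q - 1))"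
      by (rule MVT2[OF ab]) (use that in \<open>auto intro!: derivative_eq_intros\<close>)
    then obtain z where z: "a < z" "z < b" "b powr (1-q) - a powr (1-q) = (b - a) * ((1-q) * z powr (1 - q - 1))"
      by blast
    have e: "(a powr (1 - q) - b powr (1 - q)) / (q - 1) = (b - a) * z powr (- q)"
      using z(3) q by (simp add: field_simps)
    have "b powr (-q) \<le> z powr (-q)"
      by (rule powr_mono2') (use z that q in auto)
    then have "(b - a) * b powr (-q) \<le> (b - a) * z powr (-q)" using ab by (intro mult_left_mono) auto
    then show ?thesis unfolding e by (simp add: powr_minus divide_inverse)
  qed simp
  have bd: "(\<Sum>i<n. t i / U (Suc i) powr q) \<le> (1 - U n powr (1 - q)) / (q - 1)" for n
  proof (induction n)
    case (Suc n)
    have "t n = U (Suc n) - U n" by (simp add: U_def)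
    then have "t n / U (Suc n) powr q \<le> (U n powr (1 - q) - U (Suc n) powr (1 - q)) / (q - 1)"
      using key[of "U n" "U (Suc n)"] U1[of n] t[of n] by (simp add: U_def)
    with Suc have "(\<Sum>i<Suc n. t i / U (Suc i) powr q) \<le> (1 - U n powr (1 - q)) / (q - 1)
       + (U n powr (1 - q) - U (Suc n) powr (1 - q)) / (q - 1)" by simp
    also have "\<dots> = (1 - U (Suc n) powr (1 - q)) / (q - 1)" by (simp add: add_divide_distrib[symmetric])
    finally show ?case .
  qed (simp add: U_def)
  have "summable (\<lambda>i. t i / U (Suc i) powr q)"
  proof (rule summableI_nonneg_bounded)
    show "0 \<le> t i / U (Suc i) powr q" for i using t by simp
    show "(\<Sum>i<n. t i / U (Suc i) powr q) \<le> 1 / (q - 1)" for n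
      by (rule order_trans[OF bd]) (use q in \<open>simp add: divide_right_mono\<close>)
  qed
  then show ?thesis unfolding U_def .
qed

text \<open>Each term is at most \<open>1 / U n - 1 / U (Suc n)\<close>. The bound does not depend
  on \<open>t\<close>, so when applied path by path it survives integration.\<close>

lemma sum_square_normalized_le_1:
  fixes t :: "nat \<Rightarrow> real"
  shows "(\<Sum>i<n. (t i / (1 + (\<Sum>j<Suc i. (t j)\<^sup>2)))\<^sup>2) \<le> 1"
proof -
  define U where "U n = 1 + (\<Sum>j<n. (t j)\<^sup>2)" for n
  have U1: "1 \<le> U n" for n unfolding U_def by (simp add: sum_nonneg)
  have "(\<Sum>i<n. (t i / U (Suc i))\<^sup>2) \<le> 1 - 1 / U n"
  proof (induction n)
    case (Suc n)
    have e: "(t n)\<^sup>2 = U (Suc n) - U n" by (simp add: U_def)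
    have "U n \<le> U (Suc n)" by (simp add: U_def)
    then have "U n * U (Suc n) \<le> U (Suc n) * U (Suc n)" using U1[of "Suc n"] by (intro mult_right_mono) auto
    then have "(U (Suc n) - U n) / (U (Suc n) * U (Suc n)) \<le> (U (Suc n) - U n) / (U n * U (Suc n))"
      using U1[of n] U1[of "Suc n"] \<open>U n \<le> U (Suc n)\<close>
      by (intro divide_left_mono) auto
    also have "\<dots> = 1 / U n - 1 / U (Suc n)" using U1[of n] U1[of "Suc n"] by (simp add: field_simps)
    finally have "(t n / U (Suc n))\<^sup>2 \<le> 1 / U n - 1 / U (Suc n)"
      by (simp add: power_divide e power2_eq_square[of "U (Suc n)"])
    with Suc show ?case by simp
  qed (simp add: U_def)
  also have "\<dots> \<le> 1" using U1[of n] by simp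
  finally show ?thesis unfolding U_def .
qed

text \<open>As the partial sums increase, the retained terms form an initial segment, whose sum is
  at most \<open>N\<close>.\<close>

lemma sum_stopped_le:
  fixes t :: "nat \<Rightarrow> real"
  assumes t: "\<And>i. 0 \<le> t i" and N: "0 \<le> N"
  shows "(\<Sum>i<n. if (\<Sum>j<Suc i. t j) \<le> N then t i else 0) \<le> N"
proof -
  have "(\<Sum>i<n. if (\<Sum>j<Suc i. t j) \<le> N then t i else 0) \<le> min N (\<Sum>j<n. t j)"
  proof (induction n)
    case (Suc n)
    show ?case
    proof (cases "(\<Sum>j<Suc n. t j) \<le> N")
      case True
      then show ?thesis using Suc by simp
    next
      case False
      then show ?thesis using Suc t[of n] by simp
    qed
  qed (simp add: N)
  then show ?thesis by simp
qed

section \<open>Martingale transforms\<close>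

context filtered_space
begin

text \<open>Truncation at 1 leaves a square integrable part and a part that is summable in \<open>L\<^sup>1\<close>.\<close>

lemma centered_convergent:
  assumes w: "\<And>i. w i \<in> borel_measurable (G (Suc i))" and q: "1 \<le> q" "q \<le> 2"
    and int: "\<And>i. integrable M (\<lambda>\<omega>. \<bar>w i \<omega>\<bar> powr q)"
    and sm: "summable (\<lambda>i. \<integral>\<omega>. \<bar>w i \<omega>\<bar> powr q \<partial>M)"
  shows "(\<forall>i. integrable M (w i)) \<and>
    (AE \<omega> in M. summable (\<lambda>i. w i \<omega> - real_cond_exp M (G i) (w i) \<omega>))"
proof -
  define W where "W i \<omega> = (if \<bar>w i \<omega>\<bar> \<le> 1 then w i \<omega> else 0)" for i \<omega>
  define r where "r i \<omega> = w i \<omega> - W i \<omega>" for i \<omega>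
  define cW where "cW i = real_cond_exp M (G i) (W i)" for i
  define cr where "cr i = real_cond_exp M (G i) (r i)" for i
  have wM [measurable]: "w i \<in> borel_measurable M" for i by (rule measurable_M[OF w])
  have WG: "W i \<in> borel_measurable (G (Suc i))" for i
    using w[of i] unfolding W_def[abs_def] by simp
  have W [measurable]: "W i \<in> borel_measurable M" for i by (rule measurable_M[OF WG])
  have rM [measurable]: "r i \<in> borel_measurable M" for i unfolding r_def[abs_def] by simp
  have W1: "\<bar>W i \<omega>\<bar> \<le> 1" for i \<omega> by (simp add: W_def)
  \<comment> \<open>Both ends of the range of \<open>q\<close> matter: where
    \<open>|w| \<le> 1\<close>, \<open>q \<le> 2\<close> gives \<open>w^2 \<le> |w|^q\<close>;
    elsewhere \<open>q \<ge> 1\<close> gives \<open>|w| \<le> |w|^q\<close>, which bounds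
    \<open>r\<close>.\<close>
  have W2: "(W i \<omega>)\<^sup>2 \<le> \<bar>w i \<omega>\<bar> powr q" for i \<omega>
  proof (cases "w i \<omega> = 0")
    case False
    show ?thesis
    proof (cases "\<bar>w i \<omega>\<bar> \<le> 1")
      case True
      have "(W i \<omega>)\<^sup>2 = \<bar>w i \<omega>\<bar> powr 2" using True False by (simp add: W_def)
      also have "\<dots> \<le> \<bar>w i \<omega>\<bar> powr q" by (rule powr_mono') (use True q in auto)
      finally show ?thesis .
    qed (simp add: W_def)
  qed (simp add: W_def)
  have r2: "\<bar>r i \<omega>\<bar> \<le> \<bar>w i \<omega>\<bar> powr q" for i \<omega>
  proof (cases "\<bar>w i \<omega>\<bar> \<le> 1")
    case False
    then have "\<bar>w i \<omega>\<bar> powr 1 \<le> \<bar>w i \<omega>\<bar> powr q" by (intro powr_mono) (use q in auto)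
    then show ?thesis using False by (simp add: r_def W_def)
  qed (simp add: r_def W_def)
  have intr: "integrable M (r i)" for i
    by (rule Bochner_Integration.integrable_bound[OF int[of i] rM]) (use r2 in simp)
  have intW: "integrable M (W i)" for i
    by (rule Bochner_Integration.integrable_bound[of _ "\<lambda>_. 1 :: real"]) (use W1 in simp_all)
  have intW2: "integrable M (\<lambda>\<omega>. (W i \<omega>)\<^sup>2)" for i
    by (rule Bochner_Integration.integrable_bound[OF int[of i]]) (use W2 in simp_all)
  have wr: "w i = (\<lambda>\<omega>. W i \<omega> + r i \<omega>)" for i by (simp add: r_def fun_eq_iff)
  have intw: "integrable M (w i)" for i
    unfolding wr by (rule Bochner_Integration.integrable_add[OF intW intr])
  have cond: "AE \<omega> in M. real_cond_exp M (G i) (w i) \<omega> = cW i \<omega> + cr i \<omega>" for i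
  proof -
    interpret s: sigma_finite_subalgebra M "G i" by (rule sigma_finite_subalgebra)
    show ?thesis unfolding wr[of i] cW_def cr_def by (rule s.real_cond_exp_add[OF intW intr])
  qed
  have cWm: "cW i \<in> borel_measurable (G i)" for i unfolding cW_def by simp
  have cWM [measurable]: "cW i \<in> borel_measurable M" for i by (rule measurable_M[OF cWm])
  have cW1: "AE \<omega> in M. \<bar>cW i \<omega>\<bar> \<le> 1" for i
  proof -
    interpret s: sigma_finite_subalgebra M "G i" by (rule sigma_finite_subalgebra)
    have "AE \<omega> in M. W i \<omega> \<le> 1" "AE \<omega> in M. - 1 \<le> W i \<omega>"
      using W1 by (auto simp: abs_le_iff)
    then have "AE \<omega> in M. cW i \<omega> \<le> 1 \<and> - 1 \<le> cW i \<omega>"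
      unfolding cW_def by (intro AE_conjI s.real_cond_exp_le_c[OF intW] s.real_cond_exp_ge_c[OF intW])
    then show ?thesis by eventually_elim linarith
  qed
  have intcW2: "integrable M (\<lambda>\<omega>. (cW i \<omega>)\<^sup>2)" for i
  proof (rule Bochner_Integration.integrable_bound[of _ "\<lambda>_. 1 :: real"])
    show "AE \<omega> in M. norm ((cW i \<omega>)\<^sup>2) \<le> norm (1::real)"
      using cW1[of i] by eventually_elim (simp add: abs_square_le_1)
  qed simp_all
  have intWc: "integrable M (\<lambda>\<omega>. cW i \<omega> * W i \<omega>)" for i
    by (rule integrable_prod_squares) (simp_all add: intW2 intcW2)
  have Wc: "(\<integral>\<omega>. cW i \<omega> * W i \<omega> \<partial>M) = (\<integral>\<omega>. (cW i \<omega>)\<^sup>2 \<partial>M)" for i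
  proof -
    interpret s: sigma_finite_subalgebra M "G i" by (rule sigma_finite_subalgebra)
    have "(\<integral>\<omega>. cW i \<omega> * real_cond_exp M (G i) (W i) \<omega> \<partial>M) = (\<integral>\<omega>. cW i \<omega> * W i \<omega> \<partial>M)"
      by (rule s.real_cond_exp_intg(2)[OF intWc cWm W])
    then show ?thesis by (simp add: cW_def power2_eq_square)
  qed
  define d where "d i \<omega> = W i \<omega> - cW i \<omega>" for i \<omega>
  have d2: "(d i \<omega>)\<^sup>2 = (W i \<omega>)\<^sup>2 - 2 * (cW i \<omega> * W i \<omega>) + (cW i \<omega>)\<^sup>2" for i \<omega>
    by (simp add: d_def power2_eq_square algebra_simps)
  have intd2: "integrable M (\<lambda>\<omega>. (d i \<omega>)\<^sup>2)" for i
    unfolding d2 by (intro Bochner_Integration.integrable_add Bochner_Integration.integrable_diff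
        integrable_mult_right intW2 intWc intcW2)
  \<comment> \<open>Conditioning is an orthogonal projection, so centring does not increase the
    second moment.\<close>
  have Ed2: "(\<integral>\<omega>. (d i \<omega>)\<^sup>2 \<partial>M) \<le> (\<integral>\<omega>. \<bar>w i \<omega>\<bar> powr q \<partial>M)" for i
  proof -
    have "(\<integral>\<omega>. (d i \<omega>)\<^sup>2 \<partial>M) = (\<integral>\<omega>. (W i \<omega>)\<^sup>2 \<partial>M) - 2 * (\<integral>\<omega>. cW i \<omega> * W i \<omega> \<partial>M) + (\<integral>\<omega>. (cW i \<omega>)\<^sup>2 \<partial>M)"
      unfolding d2 by (simp add: intW2 intWc intcW2)
    also have "\<dots> = (\<integral>\<omega>. (W i \<omega>)\<^sup>2 \<partial>M) - (\<integral>\<omega>. (cW i \<omega>)\<^sup>2 \<partial>M)" by (simp add: Wc)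
    also have "\<dots> \<le> (\<integral>\<omega>. (W i \<omega>)\<^sup>2 \<partial>M)" by simp
    also have "\<dots> \<le> (\<integral>\<omega>. \<bar>w i \<omega>\<bar> powr q \<partial>M)" by (rule integral_mono[OF intW2 int W2])
    finally show ?thesis .
  qed
  have md: "mart_diff d"
    unfolding mart_diff_def
  proof (intro allI conjI)
    fix i
    interpret s: sigma_finite_subalgebra M "G i" by (rule sigma_finite_subalgebra)
    have "cW i \<in> borel_measurable (G (Suc i))" by (rule measurable_mono[OF cWm]) simp
    then show "d i \<in> borel_measurable (G (Suc i))"
      unfolding d_def[abs_def] using WG by simp
    have intcW: "integrable M (cW i)" unfolding cW_def by (rule s.real_cond_exp_int[OF intW])
    have "AE \<omega> in M. real_cond_exp M (G i) (\<lambda>\<omega>. W i \<omega> - cW i \<omega>) \<omega>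
        = cW i \<omega> - real_cond_exp M (G i) (cW i) \<omega>"
      using s.real_cond_exp_diff[OF intW intcW] unfolding cW_def .
    moreover have "AE \<omega> in M. real_cond_exp M (G i) (cW i) \<omega> = cW i \<omega>"
      by (rule s.real_cond_exp_F_meas[OF intcW cWm])
    ultimately show "AE \<omega> in M. real_cond_exp M (G i) (d i) \<omega> = 0"
      unfolding d_def[abs_def] by eventually_elim simp
  qed (rule intd2)
  have "summable (\<lambda>i. \<integral>\<omega>. (d i \<omega>)\<^sup>2 \<partial>M)"
    by (rule summable_comparison_test'[OF sm, of 0]) (simp add: Ed2)
  then have c1: "AE \<omega> in M. summable (\<lambda>i. d i \<omega>)" by (rule mart_diff_convergent[OF md])
  have c2: "AE \<omega> in M. summable (\<lambda>i. \<bar>w i \<omega>\<bar> powr q)"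
    by (rule AE_summable_of_integral[OF int _ sm]) simp
  have c3: "AE \<omega> in M. summable (\<lambda>i. \<bar>cr i \<omega>\<bar>)"
  proof (rule AE_summable_of_integral)
    fix i
    interpret s: sigma_finite_subalgebra M "G i" by (rule sigma_finite_subalgebra)
    show "integrable M (\<lambda>\<omega>. \<bar>cr i \<omega>\<bar>)" unfolding cr_def using s.real_cond_exp_int[OF intr] by simp
  next
    \<comment> \<open>Conditional expectation contracts the \<open>L^1\<close> norm; this follows by
      monotonicity applied to \<open>r\<close> and \<open>- r\<close>.\<close>
    have b: "(\<integral>\<omega>. \<bar>cr i \<omega>\<bar> \<partial>M) \<le> (\<integral>\<omega>. \<bar>w i \<omega>\<bar> powr q \<partial>M)" for i
    proof -
      interpret s: sigma_finite_subalgebra M "G i" by (rule sigma_finite_subalgebra)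
      have icr: "integrable M (cr i)" unfolding cr_def by (rule s.real_cond_exp_int[OF intr])
      have ia: "integrable M (\<lambda>\<omega>. \<bar>r i \<omega>\<bar>)" using intr by simp
      have "AE \<omega> in M. cr i \<omega> \<le> real_cond_exp M (G i) (\<lambda>\<omega>. \<bar>r i \<omega>\<bar>) \<omega>"
        unfolding cr_def by (rule s.real_cond_exp_mono[OF _ intr ia]) simp
      moreover have "AE \<omega> in M. real_cond_exp M (G i) (\<lambda>\<omega>. - r i \<omega>) \<omega> \<le> real_cond_exp M (G i) (\<lambda>\<omega>. \<bar>r i \<omega>\<bar>) \<omega>"
        by (rule s.real_cond_exp_mono[OF _ _ ia]) (use intr in simp_all)
      moreover have "AE \<omega> in M. real_cond_exp M (G i) (\<lambda>\<omega>. - 1 * r i \<omega>) \<omega> = - 1 * cr i \<omega>"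
        unfolding cr_def by (rule s.real_cond_exp_cmult[OF intr])
      ultimately have "AE \<omega> in M. \<bar>cr i \<omega>\<bar> \<le> real_cond_exp M (G i) (\<lambda>\<omega>. \<bar>r i \<omega>\<bar>) \<omega>"
        by eventually_elim simp
      then have "(\<integral>\<omega>. \<bar>cr i \<omega>\<bar> \<partial>M) \<le> (\<integral>\<omega>. real_cond_exp M (G i) (\<lambda>\<omega>. \<bar>r i \<omega>\<bar>) \<omega> \<partial>M)"
        by (intro integral_mono_AE) (use icr s.real_cond_exp_int(1)[OF ia] in simp_all)
      also have "\<dots> = (\<integral>\<omega>. \<bar>r i \<omega>\<bar> \<partial>M)" by (rule s.real_cond_exp_int(2)[OF ia])
      also have "\<dots> \<le> (\<integral>\<omega>. \<bar>w i \<omega>\<bar> powr q \<partial>M)" by (rule integral_mono[OF ia int r2])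
      finally show ?thesis .
    qed
    show "summable (\<lambda>i. \<integral>\<omega>. \<bar>cr i \<omega>\<bar> \<partial>M)"
      by (rule summable_comparison_test'[OF sm, of 0]) (simp add: b)
  qed simp
  have "AE \<omega> in M. \<forall>i. real_cond_exp M (G i) (w i) \<omega> = cW i \<omega> + cr i \<omega>"
    unfolding AE_all_countable using cond by blast
  with c1 c2 c3 have "AE \<omega> in M. summable (\<lambda>i. w i \<omega> - real_cond_exp M (G i) (w i) \<omega>)"
  proof eventually_elim
    case (elim \<omega>)
    have "summable (\<lambda>i. r i \<omega>)"
      by (rule summable_comparison_test'[OF elim(2), of 0]) (simp add: r2)
    moreover have "summable (\<lambda>i. cr i \<omega>)" using elim(3) by (rule summable_rabs_cancel)
    ultimately have "summable (\<lambda>i. d i \<omega> + r i \<omega> - cr i \<omega>)"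
      using elim(1) by (intro summable_add summable_diff)
    moreover have "d i \<omega> + r i \<omega> - cr i \<omega> = w i \<omega> - real_cond_exp M (G i) (w i) \<omega>" for i
      using elim(4) by (simp add: d_def r_def)
    ultimately show ?case by simp
  qed
  then show ?thesis using intw by blast
qed

end

section \<open>Transforms of noise with constant conditional variance\<close>

locale mart_noise = filtered_space +
  fixes e :: "nat \<Rightarrow> 'a \<Rightarrow> real" and s2 :: real
  assumes e: "mart_diff e"
    and cond_var: "AE \<omega> in M. real_cond_exp M (G i) (\<lambda>\<omega>. (e i \<omega>)\<^sup>2) \<omega> = s2"
begin

lemma e_measurable: "e i \<in> borel_measurable (G (Suc i))"
  and e_square_integrable: "integrable M (\<lambda>\<omega>. (e i \<omega>)\<^sup>2)"
  using e by (simp_all add: mart_diff_def)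

lemma e_measurable_M [measurable]: "e i \<in> borel_measurable M"
  by (rule measurable_M[OF e_measurable])

lemma integral_predictable_square:
  assumes v: "v \<in> borel_measurable (G i)" and int: "integrable M (\<lambda>\<omega>. v \<omega> * (e i \<omega>)\<^sup>2)"
  shows "(\<integral>\<omega>. v \<omega> * (e i \<omega>)\<^sup>2 \<partial>M) = s2 * (\<integral>\<omega>. v \<omega> \<partial>M)"
proof -
  interpret s: sigma_finite_subalgebra M "G i" by (rule sigma_finite_subalgebra)
  have vM [measurable]: "v \<in> borel_measurable M" by (rule measurable_M[OF v])
  have "(\<integral>\<omega>. v \<omega> * (e i \<omega>)\<^sup>2 \<partial>M) = (\<integral>\<omega>. v \<omega> * real_cond_exp M (G i) (\<lambda>\<omega>. (e i \<omega>)\<^sup>2) \<omega> \<partial>M)"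
    by (rule s.real_cond_exp_intg(2)[OF int v, symmetric]) simp
  also have "\<dots> = (\<integral>\<omega>. s2 * v \<omega> \<partial>M)"
  proof (rule integral_cong_AE)
    show "AE \<omega> in M. v \<omega> * real_cond_exp M (G i) (\<lambda>\<omega>. (e i \<omega>)\<^sup>2) \<omega> = s2 * v \<omega>"
      using cond_var[of i] by eventually_elim simp
  qed simp_all
  finally show ?thesis by simp
qed

lemma e_square_integral: "(\<integral>\<omega>. (e i \<omega>)\<^sup>2 \<partial>M) = s2"
  using integral_predictable_square[of "\<lambda>_. 1" i] e_square_integrable by (simp add: prob_space)

lemma s2_nonneg: "0 \<le> s2"
  unfolding e_square_integral[of 0, symmetric] by simp

text \<open>Dividing \<open>u\<close> by \<open>1 + \<Sum> u\<^sup>2\<close> makes the transform bounded in \<open>L\<^sup>2\<close>, hence convergent; then apply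
  Kronecker's lemma.\<close>

lemma mart_transform_negl:
  assumes u: "\<And>i. u i \<in> borel_measurable (G i)"
  shows "AE \<omega> in M. negl (\<lambda>n. \<Sum>i<n. u i \<omega> * e i \<omega>) (\<lambda>n. \<Sum>i<n. (u i \<omega>)\<^sup>2)"
proof -
  \<comment> \<open>\<open>U (Suc i)\<close> already contains \<open>u i\<close>; it is still known
    at stage \<open>i\<close>, since \<open>u\<close> is predictable.\<close>
  define U where "U n \<omega> = 1 + (\<Sum>j<n. (u j \<omega>)\<^sup>2)" for n \<omega>
  have U1: "1 \<le> U n \<omega>" for n \<omega> unfolding U_def by (simp add: sum_nonneg)
  have UG: "U (Suc n) \<in> borel_measurable (G n)" for n
    unfolding U_def[abs_def]
  proof (intro borel_measurable_add borel_measurable_const borel_measurable_sum borel_measurable_power)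
    fix j assume "j \<in> {..<Suc n}"
    then show "u j \<in> borel_measurable (G n)" by (intro measurable_mono[OF u]) simp
  qed
  define v where "v i \<omega> = u i \<omega> / U (Suc i) \<omega>" for i \<omega>
  have v: "v i \<in> borel_measurable (G i)" for i
    unfolding v_def[abs_def] by (intro borel_measurable_divide u UG)
  have v1: "\<bar>v i \<omega>\<bar> \<le> 1" for i \<omega>
  proof -
    have "0 \<le> (\<bar>u i \<omega>\<bar> - 1)\<^sup>2" by simp
    then have "\<bar>u i \<omega>\<bar> \<le> 1 + (u i \<omega>)\<^sup>2" by (simp add: power2_diff)
    also have "\<dots> \<le> U (Suc i) \<omega>" unfolding U_def by (simp add: sum_nonneg)
    finally show ?thesis using U1[of "Suc i" \<omega>] by (simp add: v_def)
  qed
  have md: "mart_diff (\<lambda>i \<omega>. v i \<omega> * e i \<omega>)" by (rule mart_diff_mult[OF e v v1])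
  have int: "integrable M (\<lambda>\<omega>. (v i \<omega>)\<^sup>2 * (e i \<omega>)\<^sup>2)" for i
    using md by (simp add: mart_diff_def power_mult_distrib)
  have vM [measurable]: "v i \<in> borel_measurable M" for i by (rule measurable_M[OF v])
  have intv: "integrable M (\<lambda>\<omega>. (v i \<omega>)\<^sup>2)" for i
    by (rule Bochner_Integration.integrable_bound[of _ "\<lambda>_. 1 :: real"]) (use v1 in \<open>simp_all add: abs_square_le_1\<close>)
  have eq: "(\<integral>\<omega>. (v i \<omega> * e i \<omega>)\<^sup>2 \<partial>M) = s2 * (\<integral>\<omega>. (v i \<omega>)\<^sup>2 \<partial>M)" for i
    unfolding power_mult_distrib
    by (rule integral_predictable_square[OF borel_measurable_power[OF v] int])
  have "summable (\<lambda>i. \<integral>\<omega>. (v i \<omega> * e i \<omega>)\<^sup>2 \<partial>M)"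
  proof (rule summableI_nonneg_bounded)
    show "(\<Sum>i<n. \<integral>\<omega>. (v i \<omega> * e i \<omega>)\<^sup>2 \<partial>M) \<le> s2" for n
    proof -
      have "(\<Sum>i<n. \<integral>\<omega>. (v i \<omega> * e i \<omega>)\<^sup>2 \<partial>M) = s2 * (\<integral>\<omega>. (\<Sum>i<n. (v i \<omega>)\<^sup>2) \<partial>M)"
        by (simp add: eq sum_distrib_left Bochner_Integration.integral_sum[OF intv])
      also have "(\<integral>\<omega>. (\<Sum>i<n. (v i \<omega>)\<^sup>2) \<partial>M) \<le> (\<integral>\<omega>. 1 \<partial>M)"
      proof (rule integral_mono)
        show "(\<Sum>i<n. (v i \<omega>)\<^sup>2) \<le> 1" for \<omega>
          unfolding v_def U_def by (rule sum_square_normalized_le_1)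
      qed (simp_all add: intv)
      finally show ?thesis using s2_nonneg by (simp add: prob_space mult_left_mono)
    qed
  qed simp
  then have "AE \<omega> in M. summable (\<lambda>i. v i \<omega> * e i \<omega>)" by (rule mart_diff_convergent[OF md])
  then show ?thesis
  proof eventually_elim
    case (elim \<omega>)
    have "negl (\<lambda>n. \<Sum>i<n. U (Suc i) \<omega> * (v i \<omega> * e i \<omega>)) (\<lambda>n. U n \<omega>)"
      by (rule kronecker_negl[OF elim]) (auto simp: incseq_Suc_iff U_def)
    moreover have "U (Suc i) \<omega> * (v i \<omega> * e i \<omega>) = u i \<omega> * e i \<omega>" for i
      using U1[of "Suc i" \<omega>] by (simp add: v_def)
    ultimately have "negl (\<lambda>n. \<Sum>i<n. u i \<omega> * e i \<omega>) (\<lambda>n. U n \<omega>)" by simp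
    then show ?case by (rule negl_mono[of _ _ 1 _ 1]) (simp_all add: U_def)
  qed
qed

end

section \<open>Squared noise with predictable weights\<close>

lemma square_powr: "(x\<^sup>2) powr q = \<bar>x\<bar> powr (2 * q)" for x :: real
proof (cases "x = 0")
  case False
  then have "\<bar>x\<bar> powr 2 = x\<^sup>2" by simp
  then show ?thesis using powr_powr[of "\<bar>x\<bar>" 2 q] by simp
qed simp

text \<open>The moment order is \<open>2 * q\<close>, so that \<open>q\<close> is an order for the
  squared noise. The supremum is finite path by path, with no bound in expectation.\<close>

locale mart_noise_moment = mart_noise +
  fixes q :: real
  assumes q: "1 < q" "q \<le> 2"
    and moment: "AE \<omega> in M. (SUP i. nn_cond_exp M (G i) (\<lambda>\<omega>. ennreal (\<bar>e i \<omega>\<bar> powr (2 * q))) \<omega>) < \<infinity>"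
begin

text \<open>With only a random bound on the conditional moments, the weighted squares need not have
  finite moments. Cutting \<open>v\<close> off at level \<open>N\<close> by a rule known at stage
  \<open>i\<close> makes the moments of order \<open>q\<close> summable, and almost every path
  agrees with its truncation once \<open>N\<close> is large.\<close>

lemma predictable_square_convergent:
  assumes v: "\<And>i. v i \<in> borel_measurable (G i)"
    and sm: "AE \<omega> in M. summable (\<lambda>i. \<bar>v i \<omega>\<bar> powr q)"
  shows "AE \<omega> in M. summable (\<lambda>i. v i \<omega> * ((e i \<omega>)\<^sup>2 - s2))"
proof -
  define c where "c i = nn_cond_exp M (G i) (\<lambda>\<omega>. ennreal (\<bar>e i \<omega>\<bar> powr (2 * q)))" for i
  define S where "S i \<omega> = (\<Sum>j<Suc i. \<bar>v j \<omega>\<bar> powr q)" for i \<omega>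
  have SG [measurable]: "S i \<in> borel_measurable (G i)" for i
    unfolding S_def[abs_def]
  proof (intro borel_measurable_sum)
    fix j assume "j \<in> {..<Suc i}"
    then have [measurable]: "v j \<in> borel_measurable (G i)" by (intro measurable_mono[OF v]) simp
    show "(\<lambda>\<omega>. \<bar>v j \<omega>\<bar> powr q) \<in> borel_measurable (G i)" by measurable
  qed
  have cG [measurable]: "c i \<in> borel_measurable (G i)" for i unfolding c_def by simp
  \<comment> \<open>Two guards, both \<open>G i\<close>-measurable: one on the current conditional
    moment, one on the running sum of \<open>|v|^q\<close>.\<close>
  define V where "V N i \<omega> = (if c i \<omega> \<le> ennreal (real N) \<and> S i \<omega> \<le> real N then v i \<omega> else 0)" for N :: nat and i \<omega>
  have V: "V N i \<in> borel_measurable (G i)" for N i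
    using v[of i] unfolding V_def[abs_def] by measurable
  have VM [measurable]: "V N i \<in> borel_measurable M" for N i by (rule measurable_M[OF V])
  have Vsum: "(\<Sum>i<n. \<bar>V N i \<omega>\<bar> powr q) \<le> real N" for N n \<omega>
  proof -
    have "(\<Sum>i<n. \<bar>V N i \<omega>\<bar> powr q) \<le> (\<Sum>i<n. if S i \<omega> \<le> real N then \<bar>v i \<omega>\<bar> powr q else 0)"
      by (rule sum_mono) (simp add: V_def)
    also have "\<dots> \<le> real N" unfolding S_def by (rule sum_stopped_le) simp_all
    finally show ?thesis .
  qed
  have Vle: "\<bar>V N i \<omega>\<bar> powr q \<le> real N" for N i \<omega>
  proof -
    have "\<bar>V N i \<omega>\<bar> powr q \<le> (\<Sum>i<Suc i. \<bar>V N i \<omega>\<bar> powr q)" by (simp add: sum_nonneg)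
    then show ?thesis using Vsum[of N \<omega> "Suc i"] by simp
  qed
  have intV: "integrable M (\<lambda>\<omega>. \<bar>V N i \<omega>\<bar> powr q)" for N i
    by (rule Bochner_Integration.integrable_bound[of _ "\<lambda>_. real N"]) (use Vle in simp_all)
  define w where "w N i \<omega> = V N i \<omega> * (e i \<omega>)\<^sup>2" for N i \<omega>
  have wG: "w N i \<in> borel_measurable (G (Suc i))" for N i
    unfolding w_def[abs_def]
    by (intro borel_measurable_times borel_measurable_power e_measurable measurable_mono[OF V]) simp
  have wM [measurable]: "w N i \<in> borel_measurable M" for N i by (rule measurable_M[OF wG])
  have wq: "\<bar>w N i \<omega>\<bar> powr q = \<bar>V N i \<omega>\<bar> powr q * \<bar>e i \<omega>\<bar> powr (2 * q)" for N i \<omega>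
    by (simp add: w_def abs_mult powr_mult square_powr)
  \<comment> \<open>\<open>V\<close> vanishes where \<open>c i\<close> exceeds \<open>N\<close>, so
    conditioning on \<open>G i\<close> replaces the moment by the constant \<open>N\<close>.\<close>
  have nn: "(\<integral>\<^sup>+\<omega>. ennreal (\<bar>w N i \<omega>\<bar> powr q) \<partial>M) \<le> ennreal (real N * (\<integral>\<omega>. \<bar>V N i \<omega>\<bar> powr q \<partial>M))" for N i
  proof -
    interpret s: sigma_finite_subalgebra M "G i" by (rule sigma_finite_subalgebra)
    have "(\<integral>\<^sup>+\<omega>. ennreal (\<bar>w N i \<omega>\<bar> powr q) \<partial>M)
        = (\<integral>\<^sup>+\<omega>. ennreal (\<bar>V N i \<omega>\<bar> powr q) * ennreal (\<bar>e i \<omega>\<bar> powr (2 * q)) \<partial>M)"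
      by (simp add: wq ennreal_mult)
    also have "\<dots> = (\<integral>\<^sup>+\<omega>. ennreal (\<bar>V N i \<omega>\<bar> powr q) * c i \<omega> \<partial>M)"
      unfolding c_def by (rule s.nn_cond_exp_intg[symmetric]) (use V[of N i] in simp_all)
    also have "\<dots> \<le> (\<integral>\<^sup>+\<omega>. ennreal (real N) * ennreal (\<bar>V N i \<omega>\<bar> powr q) \<partial>M)"
    proof (rule nn_integral_mono)
      fix \<omega>
      show "ennreal (\<bar>V N i \<omega>\<bar> powr q) * c i \<omega> \<le> ennreal (real N) * ennreal (\<bar>V N i \<omega>\<bar> powr q)"
        by (cases "c i \<omega> \<le> ennreal (real N) \<and> S i \<omega> \<le> real N")
          (auto simp: V_def mult.commute[of "ennreal (real N)"] intro: mult_left_mono)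
    qed
    also have "\<dots> = ennreal (real N) * ennreal (\<integral>\<omega>. \<bar>V N i \<omega>\<bar> powr q \<partial>M)"
      by (subst nn_integral_cmult) (simp_all add: nn_integral_eq_integral[OF intV])
    also have "\<dots> = ennreal (real N * (\<integral>\<omega>. \<bar>V N i \<omega>\<bar> powr q \<partial>M))"
      by (rule ennreal_mult[symmetric]) simp_all
    finally show ?thesis .
  qed
  have intw: "integrable M (\<lambda>\<omega>. \<bar>w N i \<omega>\<bar> powr q)" for N i
  proof (rule integrableI_bounded)
    show "(\<integral>\<^sup>+\<omega>. ennreal (norm (\<bar>w N i \<omega>\<bar> powr q)) \<partial>M) < \<infinity>"
      using nn[of N i] by (simp add: le_less_trans[OF _ ennreal_less_top])
  qed simp
  have wle: "(\<integral>\<omega>. \<bar>w N i \<omega>\<bar> powr q \<partial>M) \<le> real N * (\<integral>\<omega>. \<bar>V N i \<omega>\<bar> powr q \<partial>M)" for N i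
    using nn[of N i] by (simp add: nn_integral_eq_integral[OF intw])
  have sumw: "summable (\<lambda>i. \<integral>\<omega>. \<bar>w N i \<omega>\<bar> powr q \<partial>M)" for N
  proof (rule summableI_nonneg_bounded)
    fix n
    have "(\<Sum>i<n. \<integral>\<omega>. \<bar>w N i \<omega>\<bar> powr q \<partial>M) \<le> (\<Sum>i<n. real N * (\<integral>\<omega>. \<bar>V N i \<omega>\<bar> powr q \<partial>M))"
      by (rule sum_mono[OF wle])
    also have "\<dots> = real N * (\<integral>\<omega>. (\<Sum>i<n. \<bar>V N i \<omega>\<bar> powr q) \<partial>M)"
      by (simp add: sum_distrib_left Bochner_Integration.integral_sum[OF intV])
    also have "\<dots> \<le> real N * (\<integral>\<omega>. real N \<partial>M)"
      by (intro mult_left_mono integral_mono) (simp_all add: intV Vsum)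
    finally show "(\<Sum>i<n. \<integral>\<omega>. \<bar>w N i \<omega>\<bar> powr q \<partial>M) \<le> real N * (\<integral>\<omega>. real N \<partial>M)" .
  qed simp
  have conv: "AE \<omega> in M. summable (\<lambda>i. V N i \<omega> * ((e i \<omega>)\<^sup>2 - s2))" for N
  proof -
    have C: "(\<forall>i. integrable M (w N i)) \<and>
        (AE \<omega> in M. summable (\<lambda>i. w N i \<omega> - real_cond_exp M (G i) (w N i) \<omega>))"
      by (rule centered_convergent[OF wG _ q(2) intw sumw]) (use q in simp)
    have "AE \<omega> in M. real_cond_exp M (G i) (w N i) \<omega> = V N i \<omega> * s2" for i
    proof -
      interpret s: sigma_finite_subalgebra M "G i" by (rule sigma_finite_subalgebra)
      have "integrable M (\<lambda>\<omega>. V N i \<omega> * (e i \<omega>)\<^sup>2)" using C unfolding w_def by blast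
      then have "AE \<omega> in M. real_cond_exp M (G i) (\<lambda>\<omega>. V N i \<omega> * (e i \<omega>)\<^sup>2) \<omega>
          = V N i \<omega> * real_cond_exp M (G i) (\<lambda>\<omega>. (e i \<omega>)\<^sup>2) \<omega>"
        by (intro s.real_cond_exp_mult[OF V]) simp_all
      with cond_var[of i] show ?thesis unfolding w_def by eventually_elim simp
    qed
    then have "AE \<omega> in M. \<forall>i. real_cond_exp M (G i) (w N i) \<omega> = V N i \<omega> * s2"
      unfolding AE_all_countable by blast
    with conjunct2[OF C] show ?thesis
      by eventually_elim (simp add: w_def algebra_simps)
  qed
  then have "AE \<omega> in M. \<forall>N. summable (\<lambda>i. V N i \<omega> * ((e i \<omega>)\<^sup>2 - s2))"
    unfolding AE_all_countable by blast
  with sm moment show ?thesis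
  proof eventually_elim
    case (elim \<omega>)
    obtain N1 :: nat where N1: "(SUP i. c i \<omega>) \<le> ennreal (real N1)"
    proof -
      define r where "r = enn2real (SUP i. c i \<omega>)"
      have "(SUP i. c i \<omega>) < \<infinity>" using elim(2) unfolding c_def by simp
      then have r: "(SUP i. c i \<omega>) = ennreal r" unfolding r_def by simp
      obtain N :: nat where "r \<le> real N" using real_arch_simple by blast
      then have "(SUP i. c i \<omega>) \<le> ennreal (real N)" unfolding r by (rule ennreal_leI)
      then show ?thesis by (rule that)
    qed
    obtain N2 :: nat where N2: "(\<Sum>i. \<bar>v i \<omega>\<bar> powr q) \<le> real N2" using real_arch_simple by blast
    define N where "N = max N1 N2"
    have "V N i \<omega> = v i \<omega>" for i
    proof -
      have "c i \<omega> \<le> (SUP i. c i \<omega>)" by (rule SUP_upper) simp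
      also have "\<dots> \<le> ennreal (real N)" by (rule order_trans[OF N1]) (simp add: N_def ennreal_leI)
      finally have "c i \<omega> \<le> ennreal (real N)" .
      moreover have "S i \<omega> \<le> (\<Sum>i. \<bar>v i \<omega>\<bar> powr q)" unfolding S_def
        by (rule sum_le_suminf[OF elim(1)]) simp_all
      then have "S i \<omega> \<le> real N" using N2 by (simp add: N_def)
      ultimately show ?thesis by (simp add: V_def)
    qed
    then show ?case using elim(3)[rule_format, of N] by simp
  qed
qed

text \<open>Self-normalization and the path bound \<open>K\<close> give
  \<open>|v / U|^q \<le> K^(q - 1) |v| / U^q\<close>, which is summable because
  \<open>q > 1\<close>; Kronecker's lemma then restores the factor \<open>U\<close>. A bound on
  \<open>v\<close> that varies with the path suffices.\<close>

lemma predictable_square_negl: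
  assumes v: "\<And>i. v i \<in> borel_measurable (G i)"
    and bd: "AE \<omega> in M. \<exists>K. \<forall>i. \<bar>v i \<omega>\<bar> \<le> K"
  shows "AE \<omega> in M. negl (\<lambda>n. \<Sum>i<n. v i \<omega> * ((e i \<omega>)\<^sup>2 - s2)) (\<lambda>n. \<Sum>i<n. \<bar>v i \<omega>\<bar>)"
proof -
  define U where "U n \<omega> = 1 + (\<Sum>j<n. \<bar>v j \<omega>\<bar>)" for n \<omega>
  have U1: "1 \<le> U n \<omega>" for n \<omega> unfolding U_def by (simp add: sum_nonneg)
  have UG: "U (Suc n) \<in> borel_measurable (G n)" for n
    unfolding U_def[abs_def]
  proof (intro borel_measurable_add borel_measurable_const borel_measurable_sum borel_measurable_abs)
    fix j assume "j \<in> {..<Suc n}"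
    then show "v j \<in> borel_measurable (G n)" by (intro measurable_mono[OF v]) simp
  qed
  have "AE \<omega> in M. summable (\<lambda>i. v i \<omega> / U (Suc i) \<omega> * ((e i \<omega>)\<^sup>2 - s2))"
  proof (rule predictable_square_convergent)
    show "(\<lambda>\<omega>. v i \<omega> / U (Suc i) \<omega>) \<in> borel_measurable (G i)" for i
      by (intro borel_measurable_divide v UG)
    from bd show "AE \<omega> in M. summable (\<lambda>i. \<bar>v i \<omega> / U (Suc i) \<omega>\<bar> powr q)"
    proof eventually_elim
      case (elim \<omega>)
      then obtain K where K: "\<And>i. \<bar>v i \<omega>\<bar> \<le> K" by blast
      have K0: "0 \<le> K" using K[of 0] by simp
      have "summable (\<lambda>i. K powr (q - 1) * (\<bar>v i \<omega>\<bar> / U (Suc i) \<omega> powr q))"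
        unfolding U_def by (intro summable_mult summable_self_normalized q) simp
      then show ?case
      proof (rule summable_comparison_test[rotated], intro exI allI impI)
        fix i
        have "\<bar>v i \<omega>\<bar> powr q = \<bar>v i \<omega>\<bar> powr (q - 1) * \<bar>v i \<omega>\<bar>"
          using powr_mult_base[of "\<bar>v i \<omega>\<bar>" "q - 1"] by (simp add: mult.commute)
        also have "\<dots> \<le> K powr (q - 1) * \<bar>v i \<omega>\<bar>"
          by (intro mult_right_mono powr_mono2) (use q K in simp_all)
        finally show "norm (\<bar>v i \<omega> / U (Suc i) \<omega>\<bar> powr q) \<le> K powr (q - 1) * (\<bar>v i \<omega>\<bar> / U (Suc i) \<omega> powr q)"
          using U1[of "Suc i" \<omega>] by (simp add: abs_divide powr_divide divide_right_mono)
      qed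
    qed
  qed
  then show ?thesis
  proof eventually_elim
    case (elim \<omega>)
    have "negl (\<lambda>n. \<Sum>i<n. U (Suc i) \<omega> * (v i \<omega> / U (Suc i) \<omega> * ((e i \<omega>)\<^sup>2 - s2))) (\<lambda>n. U n \<omega>)"
      by (rule kronecker_negl[OF elim]) (auto simp: incseq_Suc_iff U_def)
    moreover have "U (Suc i) \<omega> * (v i \<omega> / U (Suc i) \<omega> * ((e i \<omega>)\<^sup>2 - s2)) = v i \<omega> * ((e i \<omega>)\<^sup>2 - s2)" for i
      using U1[of "Suc i" \<omega>] by simp
    ultimately have "negl (\<lambda>n. \<Sum>i<n. v i \<omega> * ((e i \<omega>)\<^sup>2 - s2)) (\<lambda>n. U n \<omega>)" by simp
    then show ?case by (rule negl_mono[of _ _ 1 _ 1]) (simp_all add: U_def)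
  qed
qed

end

section \<open>Logarithmic averages along one sample path\<close>

text \<open>The harmonic number. It serves as the logarithmic scale because its increments are
  exactly the weights of the averages below.\<close>

definition hsum :: "nat \<Rightarrow> real" where
  "hsum n = (\<Sum>i<n. 1 / real (Suc i))"

lemma hsum_nonneg: "0 \<le> hsum n"
  unfolding hsum_def by (simp add: sum_nonneg)

lemma hsum_mono: "m \<le> n \<Longrightarrow> hsum m \<le> hsum n"
  unfolding hsum_def by (rule sum_mono2) auto

lemma tendsto_abs_bound:
  fixes f :: "nat \<Rightarrow> real"
  assumes "f \<longlonglongrightarrow> l"
  obtains K where "0 < K" "\<And>n. \<bar>f n\<bar> \<le> K" "\<And>n. f n \<le> K"
proof -
  have "Bseq f" using assms by (intro convergent_imp_Bseq) (auto simp: convergent_def)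
  then obtain K where K: "0 < K" "\<And>n. \<bar>f n\<bar> \<le> K" by (auto simp: Bseq_def)
  have "f n \<le> K" for n using K(2)[of n] by linarith
  with K show ?thesis by (rule that)
qed

text \<open>Summation by parts turns the logarithmic average of \<open>c - l\<close> into a boundary
  term \<open>C n / n\<close> plus a logarithmic average of the Cesaro errors
  \<open>C i / i\<close>, which tend to 0.\<close>

lemma cesaro_log_average:
  assumes c: "(\<lambda>n. (\<Sum>i<n. c i) / real n) \<longlonglongrightarrow> l"
  shows "negl (\<lambda>n. (\<Sum>i<n. c i / real (Suc i)) - l * hsum n) hsum"
proof -
  define C where "C n = (\<Sum>i<n. c i - l)" for n
  have C0: "(\<lambda>n. C n / real n) \<longlonglongrightarrow> 0"
  proof -
    have "(\<lambda>n. (\<Sum>i<n. c i) / real n - l) \<longlonglongrightarrow> l - l" by (intro tendsto_diff c tendsto_const)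
    moreover have "eventually (\<lambda>n. (\<Sum>i<n. c i) / real n - l = C n / real n) sequentially"
      using eventually_gt_at_top[of 0] by eventually_elim (simp add: C_def sum_subtractf field_simps)
    ultimately show ?thesis by (auto intro: Lim_transform_eventually)
  qed
  have eq: "(\<Sum>i<n. c i / real (Suc i)) - l * hsum n = C n / real n + (\<Sum>i<n. C i / real i * (1 / real (Suc i)))" for n
  proof (induction n)
    case (Suc n)
    have "C (Suc n) = C n + c n - l" by (simp add: C_def)
    moreover have "C n / real n = C n / real n * (1 / real (Suc n)) + C n / real (Suc n)"
      by (cases "n = 0") (simp_all add: C_def[of 0] divide_simps, simp add: algebra_simps)
    moreover have "C (Suc n) / real (Suc n) = C n / real (Suc n) + c n / real (Suc n) - l / real (Suc n)"
      by (simp add: C_def add_divide_distrib diff_divide_distrib)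
    moreover have "l * hsum (Suc n) = l * hsum n + l / real (Suc n)" by (simp add: hsum_def distrib_left)
    ultimately show ?case using Suc by (simp only: sum.lessThan_Suc)
  qed (simp add: C_def hsum_def)
  obtain B where B: "\<And>n. \<bar>C n / real n\<bar> \<le> B" using tendsto_abs_bound[OF C0] by blast
  have "negl (\<lambda>n. \<Sum>i<n. C i / real i * (1 / real (Suc i))) hsum"
    using negl_weighted[OF C0, of "\<lambda>i. 1 / real (Suc i)"] by (simp add: hsum_def[abs_def])
  then show ?thesis unfolding eq by (intro negl_add negl_bounded[OF B]) (simp_all add: hsum_nonneg)
qed

text \<open>\<open>hsum\<close> is increasing, so the bound on each \<open>f i\<close> with
  \<open>i < n\<close> may be replaced by the one at \<open>n\<close>.\<close>

lemma negl_cesaro: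
  assumes f: "negl f hsum"
  shows "negl (\<lambda>n. (\<Sum>i<n. f i) / real n) hsum"
proof (rule neglI)
  fix d :: real assume d: "d > 0"
  obtain C where C: "\<And>n. \<bar>f n\<bar> \<le> d * hsum n + C" using neglE[OF f d] by blast
  have C0: "0 \<le> C" using C[of 0] by (simp add: hsum_def)
  have "\<bar>(\<Sum>i<n. f i) / real n\<bar> \<le> d * hsum n + C" for n
  proof (cases "n = 0")
    case False
    have "\<bar>\<Sum>i<n. f i\<bar> \<le> (\<Sum>i<n. \<bar>f i\<bar>)" by (rule sum_abs)
    also have "\<dots> \<le> (\<Sum>i<n. d * hsum n + C)"
    proof (rule sum_mono)
      fix i assume "i \<in> {..<n}"
      then have "d * hsum i \<le> d * hsum n" using d by (intro mult_left_mono hsum_mono) auto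
      then show "\<bar>f i\<bar> \<le> d * hsum n + C" using C[of i] by simp
    qed
    also have "\<dots> = real n * (d * hsum n + C)" by simp
    finally show ?thesis using False by (simp add: divide_le_eq mult.commute)
  qed (simp add: C0 hsum_def)
  then show "\<exists>C. \<forall>n. \<bar>(\<Sum>i<n. f i) / real n\<bar> \<le> d * hsum n + C" by blast
qed

text \<open>A Cesaro mean lowers \<open>hsum n\<close> by exactly 1, so it preserves the coefficient
  of the logarithm.\<close>

lemma cesaro_hsum: "(\<Sum>i<n. hsum i) = real n * hsum n - real n"
proof (induction n)
  case (Suc n)
  have "real (Suc n) * hsum (Suc n) = real (Suc n) * hsum n + 1" by (simp add: hsum_def distrib_left del: of_nat_Suc)
  with Suc show ?case by (simp add: algebra_simps)
qed simp

text \<open>The almost sure facts about one sample path, isolated so that what follows is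
  deterministic. The noise terms are bounded by their own variations because the weights contain the
  score \<open>S\<close>, whose size is not yet known. \<open>D\<close> at \<open>Suc i\<close>
  involves regressors up to \<open>i\<close> only, so the weights in \<open>noise_2\<close> are
  predictable.\<close>

locale regression_path =
  fixes k :: nat and X :: "nat \<Rightarrow> nat \<Rightarrow> real" and e :: "nat \<Rightarrow> real"
    and \<Gamma> :: "nat \<Rightarrow> nat \<Rightarrow> real" and s2 :: real
    and S :: "nat \<Rightarrow> nat \<Rightarrow> real" 
    and D :: "nat \<Rightarrow> nat \<Rightarrow> nat \<Rightarrow> real"
  assumes S_def: "S r n = (\<Sum>i<n. X r i * e i)"
    and D_def: "D r s n = (\<Sum>i<n. X r i * X s i - \<Gamma> r s)"
    and second_moments: "r < k \<Longrightarrow> s < k \<Longrightarrow> (\<lambda>n. (\<Sum>i<n. X r i * X s i) / real n) \<longlonglongrightarrow> \<Gamma> r s"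
    and noise_square: "r < k \<Longrightarrow> s < k \<Longrightarrow>
      negl (\<lambda>n. \<Sum>i<n. X r i * X s i / real (Suc i) * ((e i)\<^sup>2 - s2)) (\<lambda>n. \<Sum>i<n. \<bar>X r i * X s i / real (Suc i)\<bar>)"
    and noise_1: "r < k \<Longrightarrow> s < k \<Longrightarrow>
      negl (\<lambda>n. \<Sum>i<n. S r i * X s i / real (Suc i) * e i) (\<lambda>n. \<Sum>i<n. (S r i * X s i / real (Suc i))\<^sup>2)"
    and noise_2: "r < k \<Longrightarrow> s < k \<Longrightarrow> a < k \<Longrightarrow> b < k \<Longrightarrow>
      negl (\<lambda>n. \<Sum>i<n. D r s (Suc i) * S a i * X b i / (real (Suc (Suc i)))\<^sup>2 * e i)
        (\<lambda>n. \<Sum>i<n. (D r s (Suc i) * S a i * X b i / (real (Suc (Suc i)))\<^sup>2)\<^sup>2)"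
begin

definition V where "V r s n = S r n * S s n / real n"
definition Q where "Q r s n = (\<Sum>i<n. V r s i / real (Suc i))"
text \<open>The increments of \<open>S r * S s\<close>, expanded into two transforms and the product
  of the increments, and divided by the new time.\<close>

definition Z where "Z r s n = (\<Sum>i<n. S r i * X s i / real (Suc i) * e i) + (\<Sum>i<n. S s i * X r i / real (Suc i) * e i)
  + (\<Sum>i<n. X r i * X s i * (e i)\<^sup>2 / real (Suc i))"
text \<open>All variations of the transforms in \<open>noise_1\<close> together; it is also the sum
  of the diagonal cases \<open>T r r s s\<close>.\<close>

definition P where "P n = (\<Sum>r<k. \<Sum>s<k. \<Sum>i<n. (S s i * X r i / real (Suc i))\<^sup>2)"
definition T where "T r r' s s' n = (\<Sum>i<n. X r i * X r' i * (S s i * S s' i) / (real (Suc i))\<^sup>2)"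
definition tV where "tV n = (\<Sum>s<k. V s s n)"
definition tQ where "tQ n = (\<Sum>s<k. Q s s n)"
text \<open>A single nonnegative majorant: \<open>tV\<close> for boundary terms, \<open>tQ\<close>
  for weighted score products, \<open>P\<close> for transforms, \<open>hsum\<close> for squared
  noise.\<close>

definition total where "total n = tV n + tQ n + P n + hsum n"

lemma S_0: "S r 0 = 0" and S_Suc: "S r (Suc n) = S r n + X r n * e n"
  by (simp_all add: S_def)

lemma D_0: "D r s 0 = 0" and D_Suc: "D r s (Suc n) = D r s n + (X r n * X s n - \<Gamma> r s)"
  by (simp_all add: D_def)

lemma V_mult: "V r s n * real n = S r n * S s n"
  by (cases "n = 0") (simp_all add: V_def S_0)

text \<open>At \<open>n = 0\<close> the quotient in \<open>V\<close> is 0, which is consistent because \<open>S\<close> vanishes there.\<close>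

lemma V_plus_Q: "V r s n + Q r s n = Z r s n"
proof (induction n)
  case (Suc n)
  have a: "V r s (Suc n) = (S r n * S s n + (S r n * X s n * e n + S s n * X r n * e n + X r n * X s n * (e n)\<^sup>2)) / real (Suc n)"
    by (simp add: V_def S_Suc power2_eq_square algebra_simps)
  have "V r s n * real (Suc n) = S r n * S s n + V r s n" using V_mult[of r s n] by (simp add: algebra_simps)
  then have b: "V r s n = (S r n * S s n) / real (Suc n) + V r s n / real (Suc n)"
    unfolding add_divide_distrib[symmetric] by (subst eq_divide_eq) simp
  show ?case using Suc a b by (simp add: Q_def Z_def add_divide_distrib)
qed (simp add: V_def Q_def Z_def)

text \<open>By \<open>V + Q = Z\<close>, passing from \<open>n\<close> to \<open>n + 1\<close>
  changes \<open>n Q\<close> by \<open>Q n + V n = Z n\<close>.\<close>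

lemma Q_cesaro: "Q r s n = (\<Sum>i<n. Z r s i) / real n"
proof -
  have "real n * Q r s n = (\<Sum>i<n. Z r s i)"
  proof (induction n)
    case (Suc n)
    have "real (Suc n) * Q r s (Suc n) = real (Suc n) * Q r s n + V r s n" by (simp add: Q_def distrib_left)
    then show ?case using Suc V_plus_Q[of r s n] by (simp add: algebra_simps)
  qed simp
  then show ?thesis by (cases "n = 0") (simp_all add: Q_def field_simps)
qed

lemma V_nonneg: "0 \<le> V s s n" by (simp add: V_def)
lemma Q_nonneg: "0 \<le> Q s s n" by (simp add: Q_def V_nonneg sum_nonneg)
lemma tV_nonneg: "0 \<le> tV n" by (simp add: tV_def V_nonneg sum_nonneg)
lemma tQ_nonneg: "0 \<le> tQ n" by (simp add: tQ_def Q_nonneg sum_nonneg)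
lemma P_nonneg: "0 \<le> P n" by (simp add: P_def sum_nonneg)
lemma total_nonneg: "0 \<le> total n"
  by (simp add: total_def tV_nonneg tQ_nonneg P_nonneg hsum_nonneg)

lemma tQ_eq: "tQ n = (\<Sum>i<n. tV i / real (Suc i))"
  unfolding tQ_def tV_def Q_def by (subst sum.swap) (simp add: sum_divide_distrib)

lemma abs_S_prod_le:
  assumes "s < k" "s' < k"
  shows "\<bar>S s n * S s' n / real (Suc n)\<bar> \<le> 2 * tV n"
proof -
  have le: "(S r n)\<^sup>2 / real (Suc n) \<le> tV n" if "r < k" for r
  proof -
    have "(S r n)\<^sup>2 / real (Suc n) \<le> V r r n"
      by (cases "n = 0") (simp_all add: V_def S_0 power2_eq_square divide_left_mono)
    also have "\<dots> \<le> tV n" unfolding tV_def using that V_nonneg by (intro member_le_sum) auto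
    finally show ?thesis .
  qed
  have "\<bar>S s n * S s' n / real (Suc n)\<bar> \<le> ((S s n)\<^sup>2 + (S s' n)\<^sup>2) / real (Suc n)"
    using abs_mult_le_sum_squares[of "S s n" "S s' n"] by (simp add: divide_right_mono)
  then show ?thesis using le[OF assms(1)] le[OF assms(2)] by (simp add: add_divide_distrib)
qed

lemma abs_V_le:
  assumes "s < k" "s' < k"
  shows "\<bar>V s s' n\<bar> \<le> 2 * tV n"
proof -
  have le: "(S r n)\<^sup>2 / real n \<le> tV n" if "r < k" for r
  proof -
    have "(S r n)\<^sup>2 / real n = V r r n" by (simp add: V_def power2_eq_square)
    also have "\<dots> \<le> tV n" unfolding tV_def using that V_nonneg by (intro member_le_sum) auto
    finally show ?thesis .
  qed
  have "\<bar>V s s' n\<bar> \<le> ((S s n)\<^sup>2 + (S s' n)\<^sup>2) / real n"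
    using abs_mult_le_sum_squares[of "S s n" "S s' n"] by (simp add: V_def divide_right_mono)
  then show ?thesis using le[OF assms(1)] le[OF assms(2)] by (simp add: add_divide_distrib)
qed

lemma P_member:
  assumes "r < k" "s < k"
  shows "(\<Sum>i<n. (S s i * X r i / real (Suc i))\<^sup>2) \<le> P n"
proof -
  have "(\<Sum>i<n. (S s i * X r i / real (Suc i))\<^sup>2) \<le> (\<Sum>s<k. \<Sum>i<n. (S s i * X r i / real (Suc i))\<^sup>2)"
    using assms by (intro member_le_sum[of s]) (auto intro: sum_nonneg)
  also have "\<dots> \<le> P n" unfolding P_def
    using assms by (intro member_le_sum[of r]) (auto intro!: sum_nonneg)
  finally show ?thesis .
qed

text \<open>Replacing \<open>(e i)^2\<close> by \<open>s2\<close> costs a term negligible against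
  the absolute weights, and these are \<open>O(hsum)\<close> since products are bounded by squares.
  What remains is a logarithmic average of second moments.\<close>

lemma square_log_average:
  assumes "r < k" "s < k"
  shows "negl (\<lambda>n. (\<Sum>i<n. X r i * X s i * (e i)\<^sup>2 / real (Suc i)) - s2 * \<Gamma> r s * hsum n) hsum"
proof -
  have A: "negl (\<lambda>n. (\<Sum>i<n. X r i * X s i / real (Suc i)) - \<Gamma> r s * hsum n) hsum" if "r < k" "s < k" for r s
    by (rule cesaro_log_average[OF second_moments[OF that]])
  have bd: "\<exists>K K'. 0 < K \<and> (\<forall>n. (\<Sum>i<n. (X r i)\<^sup>2 / real (Suc i)) \<le> K * hsum n + K')" if r: "r < k" for r
  proof -
    obtain C where C: "\<And>n. \<bar>(\<Sum>i<n. X r i * X r i / real (Suc i)) - \<Gamma> r r * hsum n\<bar> \<le> 1 * hsum n + C"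
      using neglE[OF A[OF r r], of 1] by auto
    have "(\<Sum>i<n. (X r i)\<^sup>2 / real (Suc i)) \<le> (\<bar>\<Gamma> r r\<bar> + 1) * hsum n + C" for n
      using C[of n] mult_right_mono[OF abs_ge_self hsum_nonneg, of "\<Gamma> r r" n]
      by (simp add: power2_eq_square distrib_right)
    then show ?thesis by (intro exI[of _ "\<bar>\<Gamma> r r\<bar> + 1"] exI[of _ C]) auto
  qed
  obtain K K' where K: "0 < K" "\<And>n. (\<Sum>i<n. (X r i)\<^sup>2 / real (Suc i)) \<le> K * hsum n + K'" using bd[OF assms(1)] by blast
  obtain J J' where J: "0 < J" "\<And>n. (\<Sum>i<n. (X s i)\<^sup>2 / real (Suc i)) \<le> J * hsum n + J'" using bd[OF assms(2)] by blast
  have "(\<Sum>i<n. \<bar>X r i * X s i / real (Suc i)\<bar>) \<le> (K + J) * hsum n + (K' + J')" for n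
  proof -
    have "(\<Sum>i<n. \<bar>X r i * X s i / real (Suc i)\<bar>) \<le> (\<Sum>i<n. (X r i)\<^sup>2 / real (Suc i) + (X s i)\<^sup>2 / real (Suc i))"
    proof (rule sum_mono)
      fix i show "\<bar>X r i * X s i / real (Suc i)\<bar> \<le> (X r i)\<^sup>2 / real (Suc i) + (X s i)\<^sup>2 / real (Suc i)"
        using abs_mult_le_sum_squares[of "X r i" "X s i"] by (simp add: add_divide_distrib[symmetric] divide_right_mono)
    qed
    then show ?thesis using K(2)[of n] J(2)[of n] by (simp add: sum.distrib algebra_simps)
  qed
  then have 1: "negl (\<lambda>n. \<Sum>i<n. X r i * X s i / real (Suc i) * ((e i)\<^sup>2 - s2)) hsum"
    by (rule negl_mono[OF noise_square[OF assms]]) (use K(1) J(1) in simp)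
  have 2: "negl (\<lambda>n. s2 * ((\<Sum>i<n. X r i * X s i / real (Suc i)) - \<Gamma> r s * hsum n)) hsum"
    by (rule negl_cmult[OF A[OF assms]])
  have "(\<Sum>i<n. X r i * X s i * (e i)\<^sup>2 / real (Suc i)) - s2 * \<Gamma> r s * hsum n =
      (\<Sum>i<n. X r i * X s i / real (Suc i) * ((e i)\<^sup>2 - s2)) + s2 * ((\<Sum>i<n. X r i * X s i / real (Suc i)) - \<Gamma> r s * hsum n)" for n
  proof -
    have "(\<Sum>i<n. X r i * X s i * (e i)\<^sup>2 / real (Suc i))
        = (\<Sum>i<n. X r i * X s i / real (Suc i) * ((e i)\<^sup>2 - s2) + s2 * (X r i * X s i / real (Suc i)))"
      by (rule sum.cong) (simp_all add: right_diff_distrib diff_divide_distrib)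
    then have "(\<Sum>i<n. X r i * X s i * (e i)\<^sup>2 / real (Suc i))
        = (\<Sum>i<n. X r i * X s i / real (Suc i) * ((e i)\<^sup>2 - s2)) + s2 * (\<Sum>i<n. X r i * X s i / real (Suc i))"
      by (simp only: sum.distrib sum_distrib_left)
    then show ?thesis by (simp only: right_diff_distrib)
  qed
  then show ?thesis using negl_add[OF 1 2] by (simp only:)
qed

lemma square_log_bound:
  assumes "r < k"
  shows "\<exists>K K'. 0 < K \<and> (\<forall>n. (\<Sum>i<n. (X r i)\<^sup>2 * (e i)\<^sup>2 / real (Suc i)) \<le> K * hsum n + K')"
proof -
  obtain C where C: "\<And>n. \<bar>(\<Sum>i<n. X r i * X r i * (e i)\<^sup>2 / real (Suc i)) - s2 * \<Gamma> r r * hsum n\<bar> \<le> 1 * hsum n + C"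
    using neglE[OF square_log_average[OF assms assms], of 1] by auto
  have "(\<Sum>i<n. (X r i)\<^sup>2 * (e i)\<^sup>2 / real (Suc i)) \<le> (\<bar>s2 * \<Gamma> r r\<bar> + 1) * hsum n + C" for n
    using C[of n] mult_right_mono[OF abs_ge_self hsum_nonneg, of "s2 * \<Gamma> r r" n]
    by (simp add: power2_eq_square distrib_right)
  then show ?thesis by (intro exI[of _ "\<bar>s2 * \<Gamma> r r\<bar> + 1"] exI[of _ C]) auto
qed

lemma negl_total:
  assumes "negl f g" "\<And>n. g n \<le> K * total n + K'" "0 < K"
  shows "negl f total"
  using assms by (rule negl_mono)

lemma total_ge: "hsum n \<le> total n" "P n \<le> total n" "tQ n \<le> total n" "tV n \<le> total n"
  using tV_nonneg[of n] tQ_nonneg[of n] P_nonneg[of n] hsum_nonneg[of n] by (simp_all add: total_def)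

text \<open>The variation of each transform in \<open>Z\<close> is one summand of \<open>P\<close>,
  hence at most \<open>total\<close>.\<close>

lemma Z_negl:
  assumes "r < k" "s < k"
  shows "negl (\<lambda>n. Z r s n - s2 * \<Gamma> r s * hsum n) total"
proof -
  have 1: "negl (\<lambda>n. \<Sum>i<n. S r i * X s i / real (Suc i) * e i) total" if "r < k" "s < k" for r s
    by (rule negl_total[OF noise_1[OF that], of 1 0])
      (use P_member[OF that(2,1)] total_ge(2) order_trans in \<open>auto intro: order_trans\<close>)
  have 2: "negl (\<lambda>n. (\<Sum>i<n. X r i * X s i * (e i)\<^sup>2 / real (Suc i)) - s2 * \<Gamma> r s * hsum n) total"
    by (rule negl_total[OF square_log_average[OF assms], of 1 0]) (simp_all add: total_ge)
  have "Z r s n - s2 * \<Gamma> r s * hsum n = (\<Sum>i<n. S r i * X s i / real (Suc i) * e i) + (\<Sum>i<n. S s i * X r i / real (Suc i) * e i)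
     + ((\<Sum>i<n. X r i * X s i * (e i)\<^sup>2 / real (Suc i)) - s2 * \<Gamma> r s * hsum n)" for n
    by (simp add: Z_def)
  then show ?thesis using negl_add[OF negl_add[OF 1[OF assms] 1[OF assms(2,1)]] 2] by (simp only:)
qed

lemma D_average:
  assumes "r < k" "s < k"
  shows "(\<lambda>n. D r s n / real (Suc n)) \<longlonglongrightarrow> 0"
proof -
  have "(\<lambda>n. (\<Sum>i<n. X r i * X s i) / real n - \<Gamma> r s) \<longlonglongrightarrow> \<Gamma> r s - \<Gamma> r s"
    by (intro tendsto_diff second_moments[OF assms] tendsto_const)
  moreover have "eventually (\<lambda>n. (\<Sum>i<n. X r i * X s i) / real n - \<Gamma> r s = D r s n / real n) sequentially"
    using eventually_gt_at_top[of 0] by eventually_elim (simp add: D_def sum_subtractf field_simps)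
  ultimately have "(\<lambda>n. D r s n / real n) \<longlonglongrightarrow> 0" by (auto intro: Lim_transform_eventually)
  then have "(\<lambda>n. D r s n / real n * (real n / real (Suc n))) \<longlonglongrightarrow> 0 * 1"
    by (intro tendsto_mult LIMSEQ_n_over_Suc_n)
  moreover have "D r s n / real n * (real n / real (Suc n)) = D r s n / real (Suc n)" for n
    by (cases "n = 0") (simp_all add: D_0)
  ultimately show ?thesis by simp
qed

text \<open>The discrete derivative of \<open>1 / i^2\<close> is of order \<open>1 / i^3\<close>;
  the extra factor is the one lost when \<open>D\<close> is turned into an average.\<close>

lemma inverse_square_diff:
  "\<bar>real (Suc (Suc i)) * (1 / (real (Suc (Suc i)))\<^sup>2 - 1 / (real (Suc i))\<^sup>2)\<bar> \<le> 2 / (real (Suc i))\<^sup>2"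
proof -
  define x where "x = real (Suc i)"
  have x: "x \<ge> 1" "real (Suc (Suc i)) = x + 1" by (simp_all add: x_def)
  have "(x + 1) * (1 / (x + 1)\<^sup>2 - 1 / x\<^sup>2) = - ((2 * x + 1) / ((x + 1) * x\<^sup>2))"
    using x by (simp add: divide_simps) (simp add: power2_eq_square algebra_simps)
  moreover have "(2 * x + 1) / ((x + 1) * x\<^sup>2) \<le> 2 / x\<^sup>2"
    using x by (simp add: divide_simps)
  moreover have "0 \<le> (2 * x + 1) / ((x + 1) * x\<^sup>2)" using x by simp
  ultimately show ?thesis unfolding x(2) x_def[symmetric] by (simp only: abs_minus_cancel abs_of_nonneg)
qed

text \<open>Summation by parts moves the fluctuation of \<open>X r * X r'\<close> around its mean onto the slowly
  varying \<open>S s * S s' / i\<^sup>2\<close>.\<close>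

lemma fluctuation_negl:
  assumes rs: "r < k" "r' < k" and ab: "s < k" "s' < k"
  shows "negl (\<lambda>n. \<Sum>i<n. (X r i * X r' i - \<Gamma> r r') * (S s i * S s' i) / (real (Suc i))\<^sup>2) total"
proof -
  define g where "g i = S s i * S s' i / (real (Suc i))\<^sup>2" for i
  define c where "c i = D r r' (Suc i) / real (Suc (Suc i))" for i
  have c: "c \<longlonglongrightarrow> 0" unfolding c_def using D_average[OF rs] by (rule LIMSEQ_Suc)
  have abel: "(\<Sum>i<n. (X r i * X r' i - \<Gamma> r r') * (S s i * S s' i) / (real (Suc i))\<^sup>2)
      = D r r' n * g n - (\<Sum>i<n. D r r' (Suc i) * (g (Suc i) - g i))" for n
  proof (induction n)
    case (Suc n)
    have "(X r n * X r' n - \<Gamma> r r') * (S s n * S s' n) / (real (Suc n))\<^sup>2 = (D r r' (Suc n) - D r r' n) * g n"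
      by (simp add: D_Suc g_def)
    then show ?case using Suc by (simp only: sum.lessThan_Suc) (simp add: algebra_simps)
  qed (simp add: D_0)
  define t1 where "t1 i = S s i * S s' i * (real (Suc (Suc i)) * (1 / (real (Suc (Suc i)))\<^sup>2 - 1 / (real (Suc i))\<^sup>2))" for i
  define t2 where "t2 i = X s i * X s' i * (e i)\<^sup>2 / real (Suc (Suc i))" for i
  \<comment> \<open>The increment of \<open>g\<close> splits into the change of its denominator
    (\<open>t1\<close>), two predictable transforms and the product of the increments of
    \<open>S\<close> (\<open>t2\<close>). Everywhere \<open>D\<close> is \<open>c i\<close> times
    \<open>Suc (Suc i)\<close>, with \<open>c\<close> tending to 0.\<close>
  have step: "D r r' (Suc i) * (g (Suc i) - g i) = c i * t1 i
      + D r r' (Suc i) * S s i * X s' i / (real (Suc (Suc i)))\<^sup>2 * e i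
      + D r r' (Suc i) * S s' i * X s i / (real (Suc (Suc i)))\<^sup>2 * e i + c i * t2 i" for i
  proof -
    define y where "y = real (Suc (Suc i))"
    define x where "x = real (Suc i)"
    have y: "y \<noteq> 0" by (simp add: y_def)
    have 1: "g (Suc i) - g i = S s i * S s' i * (1 / y\<^sup>2 - 1 / x\<^sup>2) + S s i * X s' i * e i / y\<^sup>2 + S s' i * X s i * e i / y\<^sup>2
        + X s i * X s' i * (e i)\<^sup>2 / y\<^sup>2"
      unfolding g_def S_Suc y_def[symmetric] x_def[symmetric]
      by (simp add: algebra_simps add_divide_distrib diff_divide_distrib power2_eq_square)
    have 2: "D r r' (Suc i) = c i * y" using y by (simp add: c_def y_def)
    show ?thesis unfolding t1_def t2_def y_def[symmetric] x_def[symmetric] 1 2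
      using y by (simp add: algebra_simps power2_eq_square)
  qed
  have n0: "negl (\<lambda>n. D r r' n * g n) total"
  proof -
    have "negl (\<lambda>n. D r r' n / real (Suc n) * (S s n * S s' n / real (Suc n))) total"
      by (rule negl_total[OF negl_mult[OF D_average[OF rs]], of _ 2 0])
        (use abs_S_prod_le[OF ab] total_ge(4) in \<open>smt (verit) mult_left_mono\<close>)+
    then show ?thesis by (simp add: g_def power2_eq_square)
  qed
  have n1: "negl (\<lambda>n. \<Sum>i<n. c i * t1 i) total"
  proof (rule negl_total[OF negl_weighted[OF c], of _ 4 0])
    fix n
    have "\<bar>t1 i\<bar> \<le> 4 * (tV i / real (Suc i))" for i
    proof -
      have "\<bar>t1 i\<bar> \<le> \<bar>S s i * S s' i\<bar> * (2 / (real (Suc i))\<^sup>2)"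
        unfolding t1_def abs_mult[of "S s i * S s' i"] by (intro mult_left_mono inverse_square_diff) simp
      also have "\<dots> = 2 * \<bar>S s i * S s' i / real (Suc i)\<bar> / real (Suc i)" by (simp add: power2_eq_square)
      also have "\<dots> \<le> 2 * (2 * tV i) / real (Suc i)"
        by (intro divide_right_mono mult_left_mono abs_S_prod_le ab) simp_all
      finally show ?thesis by simp
    qed
    then have "(\<Sum>i<n. \<bar>t1 i\<bar>) \<le> 4 * tQ n"
      unfolding tQ_eq sum_distrib_left by (rule sum_mono)
    then show "(\<Sum>i<n. \<bar>t1 i\<bar>) \<le> 4 * total n + 0" using total_ge(3)[of n] by simp
  qed simp
  \<comment> \<open>Here boundedness of \<open>c\<close> is enough: the variation is at most
    \<open>K^2\<close> times a summand of \<open>P\<close>.\<close>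
  have n2: "negl (\<lambda>n. \<Sum>i<n. D r r' (Suc i) * S a i * X b i / (real (Suc (Suc i)))\<^sup>2 * e i) total"
    if "a < k" "b < k" for a b
  proof -
    obtain K where K: "0 < K" "\<And>i. \<bar>c i\<bar> \<le> K" using tendsto_abs_bound[OF c] by blast
    have le: "(D r r' (Suc i) * S a i * X b i / (real (Suc (Suc i)))\<^sup>2)\<^sup>2 \<le> K\<^sup>2 * (S a i * X b i / real (Suc i))\<^sup>2" for i
    proof -
      have "D r r' (Suc i) * S a i * X b i / (real (Suc (Suc i)))\<^sup>2 = c i * (S a i * X b i / real (Suc (Suc i)))"
        by (simp add: c_def power2_eq_square)
      moreover have "(c i)\<^sup>2 \<le> K\<^sup>2" using K(2)[of i] K(1) by (simp add: abs_le_square_iff[symmetric])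
      moreover have "(S a i * X b i / real (Suc (Suc i)))\<^sup>2 \<le> (S a i * X b i / real (Suc i))\<^sup>2"
        unfolding power_divide by (intro divide_left_mono power_mono) auto
      ultimately show ?thesis by (simp only: power_mult_distrib[of "c i"]) (intro mult_mono, simp_all)
    qed
    show ?thesis
    proof (rule negl_total[OF noise_2[OF rs that], of "K\<^sup>2" 0])
      fix n
      have "(\<Sum>i<n. (D r r' (Suc i) * S a i * X b i / (real (Suc (Suc i)))\<^sup>2)\<^sup>2)
          \<le> K\<^sup>2 * (\<Sum>i<n. (S a i * X b i / real (Suc i))\<^sup>2)"
        unfolding sum_distrib_left by (rule sum_mono[OF le])
      also have "\<dots> \<le> K\<^sup>2 * total n"
        by (intro mult_left_mono order_trans[OF P_member[OF that(2,1)] total_ge(2)]) simp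
      finally show "(\<Sum>i<n. (D r r' (Suc i) * S a i * X b i / (real (Suc (Suc i)))\<^sup>2)\<^sup>2) \<le> K\<^sup>2 * total n + 0" by simp
    qed (use K in simp)
  qed
  have n3: "negl (\<lambda>n. \<Sum>i<n. c i * t2 i) total"
  proof -
    obtain K K' where K: "0 < K" "\<And>n. (\<Sum>i<n. (X s i)\<^sup>2 * (e i)\<^sup>2 / real (Suc i)) \<le> K * hsum n + K'"
      using square_log_bound[OF ab(1)] by blast
    obtain J J' where J: "0 < J" "\<And>n. (\<Sum>i<n. (X s' i)\<^sup>2 * (e i)\<^sup>2 / real (Suc i)) \<le> J * hsum n + J'"
      using square_log_bound[OF ab(2)] by blast
    show ?thesis
    proof (rule negl_total[OF negl_weighted[OF c], of _ "K + J" "K' + J'"])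
      fix n
      have "\<bar>t2 i\<bar> \<le> (X s i)\<^sup>2 * (e i)\<^sup>2 / real (Suc i) + (X s' i)\<^sup>2 * (e i)\<^sup>2 / real (Suc i)" for i
      proof -
        have "\<bar>t2 i\<bar> = \<bar>X s i * X s' i\<bar> * (e i)\<^sup>2 / real (Suc (Suc i))" by (simp add: t2_def abs_mult)
        also have "\<dots> \<le> ((X s i)\<^sup>2 + (X s' i)\<^sup>2) * (e i)\<^sup>2 / real (Suc i)"
          by (intro frac_le mult_right_mono abs_mult_le_sum_squares) auto
        finally show ?thesis by (simp add: distrib_right add_divide_distrib)
      qed
      then have "(\<Sum>i<n. \<bar>t2 i\<bar>) \<le> (\<Sum>i<n. (X s i)\<^sup>2 * (e i)\<^sup>2 / real (Suc i) + (X s' i)\<^sup>2 * (e i)\<^sup>2 / real (Suc i))"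
        by (rule sum_mono)
      also have "\<dots> \<le> (K + J) * hsum n + (K' + J')"
        using K(2)[of n] J(2)[of n] by (simp add: sum.distrib distrib_right)
      also have "\<dots> \<le> (K + J) * total n + (K' + J')"
        using mult_left_mono[OF total_ge(1)[of n], of "K + J"] K(1) J(1) by simp
      finally show "(\<Sum>i<n. \<bar>t2 i\<bar>) \<le> (K + J) * total n + (K' + J')" .
    qed (use K J in simp)
  qed
  show ?thesis unfolding abel step sum.distrib
    by (intro negl_diff negl_add n0 n1 n2 n3 ab)
qed

text \<open>Once \<open>X r * X r'\<close> is replaced by its mean, the sums of
  \<open>S S' / (i + 1)^2\<close> and of \<open>V / (i + 1)\<close> differ by terms with an extra
  factor \<open>1 / (i + 1)\<close>, which are negligible against \<open>tQ\<close>.\<close>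

lemma T_negl_Q:
  assumes rs: "r < k" "r' < k" and ab: "s < k" "s' < k"
  shows "negl (\<lambda>n. T r r' s s' n - \<Gamma> r r' * Q s s' n) total"
proof -
  have e: "S s i * S s' i / (real (Suc i))\<^sup>2 = V s s' i / real (Suc i) - 1 / real (Suc i) * (V s s' i / real (Suc i))" for i
  proof -
    have "V s s' i / real (Suc i) - 1 / real (Suc i) * (V s s' i / real (Suc i)) = V s s' i * real i / (real (Suc i))\<^sup>2"
      by (simp add: divide_simps power2_eq_square) (simp add: algebra_simps)
    then show ?thesis by (simp add: V_mult)
  qed
  have n: "negl (\<lambda>n. \<Sum>i<n. 1 / real (Suc i) * (V s s' i / real (Suc i))) total"
  proof (rule negl_total[OF negl_weighted, of _ _ 2 0])
    show "(\<lambda>i. 1 / real (Suc i)) \<longlonglongrightarrow> 0" using LIMSEQ_inverse_real_of_nat by (simp add: inverse_eq_divide)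
    fix n
    have "\<bar>V s s' i / real (Suc i)\<bar> \<le> 2 * (tV i / real (Suc i))" for i
      using abs_V_le[OF ab, of i] by (simp add: divide_right_mono)
    then have "(\<Sum>i<n. \<bar>V s s' i / real (Suc i)\<bar>) \<le> 2 * tQ n"
      unfolding tQ_eq sum_distrib_left by (rule sum_mono)
    then show "(\<Sum>i<n. \<bar>V s s' i / real (Suc i)\<bar>) \<le> 2 * total n + 0" using total_ge(3)[of n] by simp
  qed simp
  have "T r r' s s' n - \<Gamma> r r' * Q s s' n
      = (\<Sum>i<n. (X r i * X r' i - \<Gamma> r r') * (S s i * S s' i) / (real (Suc i))\<^sup>2)
        - \<Gamma> r r' * (\<Sum>i<n. 1 / real (Suc i) * (V s s' i / real (Suc i)))" for n
  proof -
    have "T r r' s s' n = (\<Sum>i<n. (X r i * X r' i - \<Gamma> r r') * (S s i * S s' i) / (real (Suc i))\<^sup>2)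
        + \<Gamma> r r' * (\<Sum>i<n. S s i * S s' i / (real (Suc i))\<^sup>2)"
      unfolding T_def sum_distrib_left sum.distrib[symmetric]
      by (rule sum.cong) (simp_all add: left_diff_distrib diff_divide_distrib)
    also have "(\<Sum>i<n. S s i * S s' i / (real (Suc i))\<^sup>2) = Q s s' n - (\<Sum>i<n. 1 / real (Suc i) * (V s s' i / real (Suc i)))"
      unfolding e Q_def sum_subtractf ..
    finally show ?thesis by (simp add: algebra_simps)
  qed
  then show ?thesis using negl_diff[OF fluctuation_negl[OF assms] negl_cmult[OF n, of "\<Gamma> r r'"]] by simp
qed

text \<open>\<open>total\<close> is bounded by \<open>hsum\<close> plus something negligible with respect to \<open>total\<close> itself.\<close>

lemma total_log_bound: "\<exists>K K'. 0 < K \<and> (\<forall>n. total n \<le> K * hsum n + K')"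
proof -
  define c where "c = (\<Sum>r<k. \<Gamma> r r)"
  define f1 where "f1 n = (\<Sum>s<k. Z s s n - s2 * \<Gamma> s s * hsum n)" for n
  define f2 where "f2 n = (\<Sum>r<k. \<Sum>s<k. T r r s s n - \<Gamma> r r * Q s s n)" for n
  have f1: "negl f1 total" unfolding f1_def by (intro negl_sum) (auto intro: Z_negl total_nonneg)
  have f2: "negl f2 total" unfolding f2_def by (intro negl_sum) (auto intro: T_negl_Q total_nonneg)
  have "(S s i * X r i / real (Suc i))\<^sup>2 = X r i * X r i * (S s i * S s i) / (real (Suc i))\<^sup>2" for r s i
    by (simp add: power2_eq_square mult_ac)
  \<comment> \<open>This closes the circle: \<open>P\<close>, which controls the transforms, is a
    diagonal case of \<open>T\<close>, hence \<open>c * tQ\<close> up to a negligible error.\<close>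
  then have "P n = (\<Sum>r<k. \<Sum>s<k. T r r s s n)" for n unfolding P_def T_def by simp
  moreover have "(\<Sum>r<k. \<Sum>s<k. \<Gamma> r r * Q s s n) = c * tQ n" for n
    by (simp add: c_def tQ_def sum_product)
  ultimately have P: "P n = c * tQ n + f2 n" for n unfolding f2_def sum_subtractf by simp
  have VQ: "tV n + tQ n = s2 * c * hsum n + f1 n" for n
  proof -
    have "f1 n = (\<Sum>s<k. Z s s n) - s2 * c * hsum n"
      by (simp add: f1_def sum_subtractf c_def sum_distrib_left sum_distrib_right)
    moreover have "(\<Sum>s<k. Z s s n) = tV n + tQ n"
      by (simp add: V_plus_Q[symmetric] sum.distrib tV_def tQ_def)
    ultimately show ?thesis by simp
  qed
  \<comment> \<open>\<open>c * tQ\<close> is at most \<open>|c|\<close> times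
    \<open>tV + tQ\<close>, so the error \<open>f1\<close> of the latter enters with the factor
    \<open>1 + |c|\<close>.\<close>
  define f where "f n = (1 + \<bar>c\<bar>) * f1 n + f2 n" for n
  have f: "negl f total" unfolding f_def by (intro negl_add negl_cmult f1 f2)
  define K where "K = (1 + \<bar>c\<bar>) * (s2 * c) + 1"
  have "\<exists>C. \<forall>n. total n \<le> 2 * K * hsum n + C"
  proof (rule negl_absorb[OF f])
    fix n
    have "c * tQ n \<le> \<bar>c\<bar> * (tV n + tQ n)"
      using mult_right_mono[OF abs_ge_self tQ_nonneg, of c n] mult_nonneg_nonneg[OF abs_ge_zero tV_nonneg, of c n]
      by (simp add: distrib_left)
    then have "total n \<le> (1 + \<bar>c\<bar>) * (tV n + tQ n) + hsum n + f2 n"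
      unfolding total_def P by (simp add: distrib_right)
    then show "total n \<le> K * hsum n + 0 + f n" unfolding VQ f_def K_def by (simp add: algebra_simps)
  qed
  then obtain C where C: "\<And>n. total n \<le> 2 * K * hsum n + C" by blast
  \<comment> \<open>The coefficient \<open>2 * K\<close> may be negative; its absolute value plus 1
    is positive, as \<open>negl_mono\<close> demands.\<close>
  have "total n \<le> (\<bar>2 * K\<bar> + 1) * hsum n + C" for n
    using C[of n] mult_right_mono[OF abs_ge_self hsum_nonneg, of "2 * K" n] hsum_nonneg[of n]
    by (simp add: distrib_right)
  then show ?thesis by (intro exI[of _ "\<bar>2 * K\<bar> + 1"] exI[of _ C]) auto
qed

lemma negl_total_hsum: "negl f total \<Longrightarrow> negl f hsum"
  using total_log_bound negl_mono by blast

text \<open>The expansion of \<open>Z\<close> now holds against \<open>hsum\<close>, and both its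
  main term and its error survive the Cesaro mean.\<close>

lemma Q_log:
  assumes "s < k" "s' < k"
  shows "negl (\<lambda>n. Q s s' n - s2 * \<Gamma> s s' * hsum n) hsum"
proof -
  define c where "c = s2 * \<Gamma> s s'"
  have 1: "negl (\<lambda>n. (\<Sum>i<n. Z s s' i - c * hsum i) / real n) hsum"
    unfolding c_def by (intro negl_cesaro negl_total_hsum Z_negl assms)
  define f where "f n = c * ((\<Sum>i<n. hsum i) / real n) - c * hsum n" for n
  have f: "negl f hsum"
  proof (rule negl_bounded[OF _ hsum_nonneg])
    show "\<bar>f n\<bar> \<le> \<bar>c\<bar>" for n
    proof (cases "n = 0")
      case False
      then have "(\<Sum>i<n. hsum i) / real n = hsum n - 1" by (simp add: cesaro_hsum field_simps)
      then show ?thesis unfolding f_def by (simp only:) (simp add: right_diff_distrib)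
    qed (simp add: f_def hsum_def)
  qed
  have "Q s s' n - c * hsum n = (\<Sum>i<n. Z s s' i - c * hsum i) / real n + f n" for n
    by (simp add: Q_cesaro f_def sum_subtractf sum_distrib_left diff_divide_distrib)
  then show ?thesis using negl_add[OF 1 f] by (simp add: c_def)
qed

theorem T_log:
  assumes rs: "r < k" "r' < k" and ab: "s < k" "s' < k"
  shows "negl (\<lambda>n. T r r' s s' n - s2 * \<Gamma> r r' * \<Gamma> s s' * hsum n) hsum"
proof -
  have "negl (\<lambda>n. (T r r' s s' n - \<Gamma> r r' * Q s s' n) + \<Gamma> r r' * (Q s s' n - s2 * \<Gamma> s s' * hsum n)) hsum"
    by (intro negl_add negl_cmult Q_log negl_total_hsum T_negl_Q assms)
  then show ?thesis by (simp add: algebra_simps)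
qed

text \<open>Convergent weights may be replaced by their limit because the absolute values of the
  terms sum to at most \<open>2 * P\<close>.\<close>

lemma weighted_T_log:
  assumes rs: "r < k" "r' < k" and ab: "s < k" "s' < k" and c: "c \<longlonglongrightarrow> l"
  shows "negl (\<lambda>n. (\<Sum>i<n. c i * (X r i * X r' i * (S s i * S s' i) / (real (Suc i))\<^sup>2))
     - l * (s2 * \<Gamma> r r' * \<Gamma> s s') * hsum n) hsum"
proof -
  define t where "t i = X r i * X r' i * (S s i * S s' i) / (real (Suc i))\<^sup>2" for i
  have c0: "(\<lambda>i. c i - l) \<longlonglongrightarrow> 0" using c by (simp add: LIM_zero_iff)
  have 1: "negl (\<lambda>n. \<Sum>i<n. (c i - l) * t i) total"
  proof (rule negl_total[OF negl_weighted[OF c0], of _ 2 0])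
    fix n
    have "\<bar>t i\<bar> \<le> (S s i * X r i / real (Suc i))\<^sup>2 + (S s' i * X r' i / real (Suc i))\<^sup>2" for i
      using abs_mult_le_sum_squares[of "S s i * X r i / real (Suc i)" "S s' i * X r' i / real (Suc i)"]
      by (simp add: t_def power2_eq_square mult_ac)
    then have "(\<Sum>i<n. \<bar>t i\<bar>) \<le> (\<Sum>i<n. (S s i * X r i / real (Suc i))\<^sup>2 + (S s' i * X r' i / real (Suc i))\<^sup>2)"
      by (rule sum_mono)
    also have "\<dots> \<le> P n + P n"
      unfolding sum.distrib by (intro add_mono P_member rs ab)
    finally show "(\<Sum>i<n. \<bar>t i\<bar>) \<le> 2 * total n + 0" using total_ge(2)[of n] by simp
  qed simp
  have 2: "negl (\<lambda>n. l * (T r r' s s' n - s2 * \<Gamma> r r' * \<Gamma> s s' * hsum n)) hsum"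
    by (intro negl_cmult T_log assms)
  have "(\<Sum>i<n. c i * t i) - l * (s2 * \<Gamma> r r' * \<Gamma> s s') * hsum n
      = (\<Sum>i<n. (c i - l) * t i) + l * (T r r' s s' n - s2 * \<Gamma> r r' * \<Gamma> s s' * hsum n)" for n
    unfolding T_def t_def[symmetric] by (simp add: left_diff_distrib sum_subtractf sum_distrib_left algebra_simps)
  then show ?thesis using negl_add[OF negl_total_hsum[OF 1] 2] by (simp add: t_def)
qed

end

section \<open>Linear processes\<close>

lemma coeff_ar_poly: "coeff (ar_poly p a) i = (if i = 0 then 1 else if i \<le> p then - a i else 0)"
proof -
  have "coeff (\<Sum>j=1..p. monom (a j) j) i = (\<Sum>j=1..p. if i = j then a j else 0)"
    unfolding coeff_sum by (rule sum.cong) (auto simp: coeff_monom)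
  also have "\<dots> = (if i \<in> {1..p} then a i else 0)" by (simp add: sum.delta')
  finally show ?thesis by (auto simp: ar_poly_def coeff_diff)
qed

lemma ma_coeff_mult: "fps_of_poly (ar_poly p a) * Abs_fps (ma_coeff p a) = 1"
proof -
  have nz: "fps_nth (fps_of_poly (ar_poly p a)) 0 \<noteq> 0" by (simp add: coeff_ar_poly)
  have "Abs_fps (ma_coeff p a) = inverse (fps_of_poly (ar_poly p a))"
    unfolding ma_coeff_def using nz by (simp add: fps_divide_unit fps_nth_inverse)
  then show ?thesis using inverse_mult_eq_1'[OF nz] by simp
qed

text \<open>Formal power series act on sequences started at 0, so applying the polynomial and then
  its inverse returns any \<open>y\<close>. A path on nonnegative times thus becomes a finite moving
  average, without reference to its past.\<close>

lemma ma_coeff_inverse_filter: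
  fixes y :: "nat \<Rightarrow> real"
  shows "y n = (\<Sum>i\<le>n. ma_coeff p a i * (\<Sum>j\<le>n - i. coeff (ar_poly p a) j * y (n - i - j)))"
proof -
  have "Abs_fps y = Abs_fps (ma_coeff p a) * (fps_of_poly (ar_poly p a) * Abs_fps y)"
    using ma_coeff_mult[of p a] by (simp add: mult.assoc[symmetric] mult.commute[of "Abs_fps (ma_coeff p a)"])
  from arg_cong[OF this, of "\<lambda>f. fps_nth f n"] show ?thesis by (simp add: fps_mult_nth atLeast0AtMost)
qed

text \<open>For \<open>n \<ge> p\<close> the filter does not reach behind the starting time
  \<open>m\<close>, so it returns the noise itself.\<close>

lemma ar_poly_filter:
  fixes y e :: "int \<Rightarrow> real"
  assumes y: "\<And>t. y (t + 1) = (\<Sum>i=1..p. a i * y (t + 1 - int i)) + e (t + 1)" and n: "p \<le> n"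
  shows "(\<Sum>j\<le>n. coeff (ar_poly p a) j * y (m + int (n - j))) = e (m + int n)"
proof -
  have "(\<Sum>j\<le>n. coeff (ar_poly p a) j * y (m + int (n - j))) = (\<Sum>j\<in>{0..p}. coeff (ar_poly p a) j * y (m + int (n - j)))"
    using n by (intro sum.mono_neutral_right) (auto simp: coeff_ar_poly)
  also have "\<dots> = y (m + int n) + (\<Sum>j=1..p. coeff (ar_poly p a) j * y (m + int (n - j)))"
    by (simp add: sum.atLeast_Suc_atMost[of 0 p] coeff_ar_poly)
  also have "(\<Sum>j=1..p. coeff (ar_poly p a) j * y (m + int (n - j))) = - (\<Sum>j=1..p. a j * y (m + int n - int j))"
    unfolding sum_negf[symmetric] using n
    by (intro sum.cong) (auto simp: coeff_ar_poly of_nat_diff add_diff_eq)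
  finally show ?thesis using y[of "m + int n - 1"] by simp
qed

text \<open>The finitely many zeros avoid the closed unit disc, hence an open disc of some radius
  \<open>R > 1\<close>. The reciprocal series converges there, and absolutely at
  \<open>z = 1\<close>.\<close>

lemma ma_coeff_summable:
  assumes roots: "\<forall>z::complex. norm z \<le> 1 \<longrightarrow> poly (map_poly of_real (ar_poly p a)) z \<noteq> 0"
  shows "summable (\<lambda>i. \<bar>ma_coeff p a i\<bar>)"
proof -
  define A :: "complex poly" where "A = map_poly of_real (ar_poly p a)"
  define f :: "complex fps" where "f = fps_of_poly A"
  have cA: "coeff A i = of_real (coeff (ar_poly p a) i)" for i
    unfolding A_def by (simp add: coeff_map_poly)
  have nz: "fps_nth f 0 \<noteq> 0" by (simp add: f_def cA coeff_ar_poly)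
  have "A \<noteq> 0" using roots unfolding A_def by (metis norm_zero poly_0 zero_le_one)
  then have fin: "finite {z. poly A z = 0}" by (rule poly_roots_finite)
  obtain R where R: "1 < R" "\<And>z. norm z < R \<Longrightarrow> poly A z \<noteq> 0"
  proof (cases "{z. poly A z = 0} = {}")
    case True
    then show ?thesis using that[of 2] by auto
  next
    case False
    define R where "R = Min (norm ` {z. poly A z = 0})"
    have "R \<in> norm ` {z. poly A z = 0}" unfolding R_def by (rule Min_in) (use fin False in auto)
    then have "1 < R" using roots unfolding A_def by (auto simp: not_le[symmetric])
    moreover have "poly A z \<noteq> 0" if "norm z < R" for z
    proof
      assume "poly A z = 0"
      then have "R \<le> norm z" unfolding R_def by (intro Min_le) (use fin in auto)
      with that show False by simp
    qed
    ultimately show ?thesis by (rule that)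
  qed
  have "min (ereal R) (fps_conv_radius f) \<le> fps_conv_radius (inverse f)"
    by (rule fps_conv_radius_inverse) (use R in \<open>simp add: f_def\<close>)
  then have "ereal R \<le> fps_conv_radius (inverse f)" by (simp add: f_def)
  moreover have "ereal (norm (1 :: complex)) < ereal R" using R(1) by simp
  ultimately have "ereal (norm (1 :: complex)) < fps_conv_radius (inverse f)" by (rule less_le_trans[rotated])
  then have "summable (\<lambda>n. norm (fps_nth (inverse f) n * 1 ^ n))" by (rule norm_summable_fps)
  moreover have "inverse f = Abs_fps (\<lambda>n. of_real (ma_coeff p a n))"
  proof -
    have "f * Abs_fps (\<lambda>n. of_real (ma_coeff p a n)) = 1"
    proof (rule fps_ext)
      fix n
      have "fps_nth (fps_of_poly (ar_poly p a) * Abs_fps (ma_coeff p a)) n = fps_nth 1 n" by (simp only: ma_coeff_mult)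
      then have "of_real (\<Sum>i=0..n. coeff (ar_poly p a) i * ma_coeff p a (n - i)) = (of_real (fps_nth 1 n) :: complex)"
        by (simp add: fps_mult_nth)
      then show "fps_nth (f * Abs_fps (\<lambda>n. of_real (ma_coeff p a n))) n = fps_nth 1 n"
        by (simp add: fps_mult_nth f_def cA)
    qed
    then show ?thesis using nz by (metis fps_inverse_unique mult.commute)
  qed
  ultimately show ?thesis by simp
qed

section \<open>Averages under shifts, and termwise limits of series\<close>

lemma average_cong_eventually:
  fixes f g :: "nat \<Rightarrow> real"
  assumes eq: "\<And>t. N \<le> t \<Longrightarrow> f t = g t" and g: "(\<lambda>n. (\<Sum>t<n. g t) / real n) \<longlonglongrightarrow> l"
  shows "(\<lambda>n. (\<Sum>t<n. f t) / real n) \<longlonglongrightarrow> l"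
proof -
  define c where "c = (\<Sum>t<N. f t - g t)"
  have "(\<lambda>n. (\<Sum>t<n. g t) / real n + c / real n) \<longlonglongrightarrow> l + 0"
    by (intro tendsto_add g lim_const_over_n)
  moreover have "eventually (\<lambda>n. (\<Sum>t<n. g t) / real n + c / real n = (\<Sum>t<n. f t) / real n) sequentially"
    using eventually_ge_at_top[of N]
  proof eventually_elim
    case (elim n)
    have "(\<Sum>t<n. f t - g t) = c" unfolding c_def
      by (rule sum.mono_neutral_right) (use elim eq in auto)
    then show ?case by (simp add: add_divide_distrib[symmetric] sum_subtractf)
  qed
  ultimately show ?thesis by (auto intro: Lim_transform_eventually)
qed

lemma average_delay:
  fixes f :: "nat \<Rightarrow> real"
  assumes f: "(\<lambda>n. (\<Sum>t<n. f t) / real n) \<longlonglongrightarrow> l"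
  shows "(\<lambda>n. (\<Sum>t<n. if m \<le> t then f (t - m) else 0) / real n) \<longlonglongrightarrow> l"
proof (rule LIMSEQ_offset[of _ m])
  have eq: "(\<Sum>t<n + m. if m \<le> t then f (t - m) else 0) = (\<Sum>t<n. f t)" for n
    by (induction n) (auto intro!: sum.neutral)
  have "(\<lambda>n. (\<Sum>t<n. f t) / real n * (real n / real (n + m))) \<longlonglongrightarrow> l * 1"
    by (intro tendsto_mult f) real_asymp
  moreover have "eventually (\<lambda>n. (\<Sum>t<n. f t) / real n * (real n / real (n + m)) = (\<Sum>t<n. f t) / real (n + m)) sequentially"
    using eventually_gt_at_top[of 0] by eventually_elim simp
  ultimately show "(\<lambda>n. (\<Sum>t<n + m. if m \<le> t then f (t - m) else 0) / real (n + m)) \<longlonglongrightarrow> l"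
    unfolding eq by (auto intro: Lim_transform_eventually)
qed

lemma average_advance:
  fixes f :: "nat \<Rightarrow> real"
  assumes f: "(\<lambda>n. (\<Sum>t<n. f t) / real n) \<longlonglongrightarrow> l"
  shows "(\<lambda>n. (\<Sum>t<n. f (t + m)) / real n) \<longlonglongrightarrow> l"
proof -
  define c where "c = (\<Sum>t<m. f t)"
  have eq: "(\<Sum>t<n. f (t + m)) = (\<Sum>t<n + m. f t) - c" for n
    by (induction n) (simp_all add: c_def)
  have "(\<lambda>n. (\<Sum>t<n + m. f t) / real (n + m) * (real (n + m) / real n) - c / real n) \<longlonglongrightarrow> l * 1 - 0"
  proof (intro tendsto_mult tendsto_diff lim_const_over_n)
    show "(\<lambda>n. (\<Sum>t<n + m. f t) / real (n + m)) \<longlonglongrightarrow> l" using f by (rule LIMSEQ_ignore_initial_segment)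
    show "(\<lambda>n. real (n + m) / real n) \<longlonglongrightarrow> 1" by real_asymp
  qed
  moreover have "eventually (\<lambda>n. (\<Sum>t<n + m. f t) / real (n + m) * (real (n + m) / real n) - c / real n
      = (\<Sum>t<n. f (t + m)) / real n) sequentially"
    using eventually_gt_at_top[of 0] by eventually_elim (simp add: eq diff_divide_distrib)
  ultimately show ?thesis by (auto intro: Lim_transform_eventually)
qed

lemma summable_shifted_product:
  fixes b :: "nat \<Rightarrow> real"
  assumes b: "summable (\<lambda>i. \<bar>b i\<bar>)"
  shows "summable (\<lambda>i. b i * b (i + r))"
proof -
  obtain B where B: "\<And>i. \<bar>b i\<bar> \<le> B"
    using summable_imp_Bseq[OF b] by (auto simp: Bseq_def)
  have "summable (\<lambda>i. \<bar>b i\<bar> * B)" using b by (rule summable_mult2)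
  then show ?thesis
    by (rule summable_comparison_test'[of _ 0]) (use B in \<open>simp add: abs_mult mult_left_mono\<close>)
qed

lemma tannery_weighted:
  fixes b :: "nat \<Rightarrow> real" and C :: "nat \<Rightarrow> nat \<Rightarrow> real"
  assumes b: "summable (\<lambda>i. \<bar>b i\<bar>)" and C: "\<And>i. (\<lambda>n. C i n) \<longlonglongrightarrow> c i" and K: "\<And>i n. \<bar>C i n\<bar> \<le> K"
  shows "(\<lambda>n. \<Sum>i. b i * C i n) \<longlonglongrightarrow> (\<Sum>i. b i * c i)"
proof -
  have "eventually (\<lambda>n. summable (\<lambda>k. norm (b k * C k n))) sequentially \<and>
      summable (\<lambda>n. norm (b n * c n)) \<and> (\<lambda>n. \<Sum>k. b k * C k n) \<longlonglongrightarrow> (\<Sum>k. b k * c k)"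
  proof (rule tannerys_theorem)
    show "(\<lambda>n. b k * C k n) \<longlonglongrightarrow> b k * c k" for k by (intro tendsto_mult tendsto_const C)
    show "summable (\<lambda>k. \<bar>b k\<bar> * K)" using b by (rule summable_mult2)
    show "\<forall>\<^sub>F (k, n) in sequentially \<times>\<^sub>F sequentially. norm (b k * C k n) \<le> \<bar>b k\<bar> * K"
      using K by (intro always_eventually) (auto simp: abs_mult intro!: mult_left_mono)
  qed simp
  then show ?thesis by blast
qed

text \<open>Dominated convergence for series, once in each index of the double sum, reduces the sample
  covariances of the linear process to those of the noise.\<close>

lemma linear_process_covariance:
  fixes b e y :: "nat \<Rightarrow> real"
  assumes b: "summable (\<lambda>i. \<bar>b i\<bar>)"
    and e: "\<And>l. (\<lambda>n. (\<Sum>t<n. e t * e (t + l)) / real n) \<longlonglongrightarrow> (if l = 0 then s2 else 0)"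
    and y: "\<And>t. y t = (\<Sum>i\<le>t. b i * e (t - i))"
  shows "(\<lambda>n. (\<Sum>t<n. y t * y (t + r)) / real n) \<longlonglongrightarrow> s2 * (\<Sum>i. b i * b (i + r))"
proof -
  \<comment> \<open>\<open>E i\<close> is the noise delayed by \<open>i\<close> and set to 0 before
    its start, so that \<open>y\<close> is a combination with the same coefficients at every
    time.\<close>
  define E where "E i t = (if i \<le> t then e (t - i) else 0)" for i t
  define C where "C i j n = (\<Sum>t<n. E i t * E j (t + r)) / real n" for i j n
  have yE: "y t = (\<Sum>i<N. b i * E i t)" if "t < N" for t N
  proof -
    have "(\<Sum>i<N. b i * E i t) = (\<Sum>i\<le>t. b i * E i t)"
      by (rule sum.mono_neutral_right) (use that in \<open>auto simp: E_def\<close>)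
    also have "\<dots> = y t" unfolding y by (rule sum.cong) (auto simp: E_def)
    finally show ?thesis ..
  qed
  have Cl: "(\<lambda>n. C i j n) \<longlonglongrightarrow> (if j = i + r then s2 else 0)" for i j
  proof (cases "j \<le> i + r")
    case True
    define l where "l = i + r - j"
    have "E i t * E j (t + r) = (if i \<le> t then e (t - i) * e (t - i + l) else 0)" for t
      using True by (auto simp: E_def l_def intro!: arg_cong[of _ _ e])
    then show ?thesis
      using average_delay[OF e[of l], of i] True by (auto simp: C_def l_def)
  next
    case False
    define l where "l = j - (i + r)"
    have "E i t * E j (t + r) = (if j - r \<le> t then e (t - (j - r)) * e (t - (j - r) + l) else 0)" for t
      using False by (auto simp: E_def l_def mult.commute intro!: arg_cong[of _ _ e] arg_cong2[of _ _ _ _ "(*)"])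
    then show ?thesis
      using average_delay[OF e[of l], of "j - r"] False by (auto simp: C_def l_def)
  qed
  define Z where "Z n = (\<Sum>t<n + r. (e t)\<^sup>2)" for n
  \<comment> \<open>A delayed window reindexes injectively into the first \<open>n + r\<close>
    squares. The resulting bound is uniform in \<open>i\<close> and \<open>j\<close>, as the
    exchange of limit and sum requires.\<close>
  have Esum: "(\<Sum>t<n. (E i (t + m))\<^sup>2) \<le> Z n" if "m \<le> r" for i m n
  proof -
    have "(\<Sum>t<n. (E i (t + m))\<^sup>2) = (\<Sum>t\<in>{..<n} \<inter> {t. i \<le> t + m}. (e (t + m - i))\<^sup>2)"
      by (subst sum.inter_restrict) (auto simp: E_def intro!: sum.cong)
    also have "\<dots> = (\<Sum>s\<in>(\<lambda>t. t + m - i) ` ({..<n} \<inter> {t. i \<le> t + m}). (e s)\<^sup>2)"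
      by (subst sum.reindex) (auto simp: inj_on_def)
    also have "\<dots> \<le> Z n" unfolding Z_def by (rule sum_mono2) (use that in auto)
    finally show ?thesis .
  qed
  obtain K where K: "\<And>n. Z n / real n \<le> K" "0 \<le> K"
  proof -
    have "(\<lambda>n. (\<Sum>t<n. e t * e t) / real n) \<longlonglongrightarrow> s2" using e[of 0] by simp
    then have "(\<lambda>n. (\<Sum>t<n + r. e t * e t) / real (n + r)) \<longlonglongrightarrow> s2"
      by (rule LIMSEQ_ignore_initial_segment)
    moreover have "(\<lambda>n. real (n + r) / real n) \<longlonglongrightarrow> 1" by real_asymp
    ultimately have "(\<lambda>n. (\<Sum>t<n + r. e t * e t) / real (n + r) * (real (n + r) / real n)) \<longlonglongrightarrow> s2 * 1"
      by (rule tendsto_mult)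
    moreover have "eventually (\<lambda>n. (\<Sum>t<n + r. e t * e t) / real (n + r) * (real (n + r) / real n) = Z n / real n) sequentially"
      using eventually_gt_at_top[of 0] by eventually_elim (simp add: Z_def power2_eq_square)
    ultimately have "(\<lambda>n. Z n / real n) \<longlonglongrightarrow> s2" by (auto intro: Lim_transform_eventually)
    then obtain K where "0 < K" "\<And>n. Z n / real n \<le> K" using tendsto_abs_bound by blast
    then show ?thesis using that[of K] by simp
  qed
  have CK: "\<bar>C i j n\<bar> \<le> K" for i j n
  proof -
    have "\<bar>\<Sum>t<n. E i t * E j (t + r)\<bar> \<le> (\<Sum>t<n. ((E i t)\<^sup>2 + (E j (t + r))\<^sup>2) / 2)"
    proof (rule order_trans[OF sum_abs], rule sum_mono)
      fix t
      show "\<bar>E i t * E j (t + r)\<bar> \<le> ((E i t)\<^sup>2 + (E j (t + r))\<^sup>2) / 2"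
        using sum_squares_bound[of "\<bar>E i t\<bar>" "\<bar>E j (t + r)\<bar>"] by (simp add: abs_mult)
    qed
    also have "\<dots> \<le> Z n"
      using Esum[of 0 i n] Esum[of r j n] by (simp add: sum_divide_distrib[symmetric] sum.distrib)
    finally have "\<bar>C i j n\<bar> \<le> Z n / real n" by (simp add: C_def divide_right_mono)
    then show ?thesis using K(1)[of n] by simp
  qed
  have inner: "(\<lambda>n. \<Sum>j. b j * C i j n) \<longlonglongrightarrow> b (i + r) * s2" for i
  proof -
    have "(\<lambda>n. \<Sum>j. b j * C i j n) \<longlonglongrightarrow> (\<Sum>j. b j * (if j = i + r then s2 else 0))"
      by (rule tannery_weighted[OF b Cl CK])
    also have "(\<Sum>j. b j * (if j = i + r then s2 else 0)) = (\<Sum>j\<in>{i + r}. b j * (if j = i + r then s2 else 0))"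
      by (rule suminf_finite) auto
    finally show ?thesis by simp
  qed
  have bound: "\<bar>\<Sum>j. b j * C i j n\<bar> \<le> (\<Sum>j. \<bar>b j\<bar>) * K" for i n
  proof -
    have s: "summable (\<lambda>j. \<bar>b j\<bar> * K)" using b by (rule summable_mult2)
    have le: "norm (b j * C i j n) \<le> \<bar>b j\<bar> * K" for j
      using CK by (simp add: abs_mult mult_left_mono)
    have "norm (\<Sum>j. b j * C i j n) \<le> (\<Sum>j. \<bar>b j\<bar> * K)" by (rule norm_suminf_le[OF le s])
    then show ?thesis by (simp add: suminf_mult2[OF b])
  qed
  have "(\<lambda>n. \<Sum>i. b i * (\<Sum>j. b j * C i j n)) \<longlonglongrightarrow> (\<Sum>i. b i * (b (i + r) * s2))"
    by (rule tannery_weighted[OF b inner bound])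
  moreover have "(\<Sum>i. b i * (\<Sum>j. b j * C i j n)) = (\<Sum>t<n. y t * y (t + r)) / real n" for n
  proof -
    \<comment> \<open>Noise delayed by \<open>N\<close> or more vanishes on the window, so both
      series are finite sums and may be rearranged.\<close>
    define N where "N = n + r"
    have C0: "C i j n = 0" if "N \<le> i \<or> N \<le> j" for i j
      using that by (auto simp: C_def N_def E_def intro!: sum.neutral)
    have "(\<Sum>j. b j * C i j n) = (\<Sum>j<N. b j * C i j n)" for i
      by (rule suminf_finite) (auto simp: C0)
    then have "(\<Sum>i. b i * (\<Sum>j. b j * C i j n)) = (\<Sum>i<N. b i * (\<Sum>j<N. b j * C i j n))"
      by (simp only:) (rule suminf_finite, auto simp: C0)
    also have "\<dots> = (\<Sum>i<N. \<Sum>j<N. \<Sum>t<n. (b i * E i t) * (b j * E j (t + r)) / real n)"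
      by (simp add: C_def sum_distrib_left sum_divide_distrib mult_ac)
    also have "\<dots> = (\<Sum>i<N. \<Sum>t<n. \<Sum>j<N. (b i * E i t) * (b j * E j (t + r)) / real n)"
      by (rule sum.cong[OF refl], rule sum.swap)
    also have "\<dots> = (\<Sum>t<n. \<Sum>i<N. \<Sum>j<N. (b i * E i t) * (b j * E j (t + r)) / real n)"
      by (rule sum.swap)
    also have "\<dots> = (\<Sum>t<n. (\<Sum>i<N. b i * E i t) * (\<Sum>j<N. b j * E j (t + r)) / real n)"
      by (simp add: sum_product sum_divide_distrib)
    also have "\<dots> = (\<Sum>t<n. y t * y (t + r) / real n)"
      by (rule sum.cong) (auto simp: yE[of _ N] N_def)
    finally show ?thesis by (simp add: sum_divide_distrib)
  qed
  moreover have "(\<Sum>i. b i * (b (i + r) * s2)) = s2 * (\<Sum>i. b i * b (i + r))"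
    using suminf_mult[OF summable_shifted_product[OF b], of s2] by (simp add: mult_ac)
  ultimately show ?thesis by simp
qed

section \<open>The autoregressive process\<close>

lemma negl_imp_tendsto_zero:
  assumes f: "negl f g" and g: "filterlim g at_top sequentially"
  shows "(\<lambda>n. f n / g n) \<longlonglongrightarrow> 0"
proof (rule LIMSEQ_I)
  fix r :: real assume r: "0 < r"
  obtain C where C: "\<And>n. \<bar>f n\<bar> \<le> r / 2 * g n + C" using neglE[OF f, of "r / 2"] r by auto
  have "eventually (\<lambda>n. max 1 (2 * \<bar>C\<bar> / r + 1) \<le> g n) sequentially"
    using g unfolding filterlim_at_top by blast
  then obtain N where N: "\<And>n. n \<ge> N \<Longrightarrow> max 1 (2 * \<bar>C\<bar> / r + 1) \<le> g n"
    unfolding eventually_sequentially by blast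
  have "norm (f n / g n - 0) < r" if "n \<ge> N" for n
  proof -
    have g: "1 \<le> g n" "2 * \<bar>C\<bar> / r < g n" using N[OF that] by auto
    have "\<bar>C\<bar> < r / 2 * g n" using g(2) r by (simp add: field_simps)
    then have "\<bar>f n\<bar> < r * g n" using C[of n] by linarith
    then show ?thesis using g(1) by (simp add: abs_divide divide_less_eq)
  qed
  then show "\<exists>N. \<forall>n\<ge>N. norm (f n / g n - 0) < r" by blast
qed

text \<open>Splitting \<open>|b|\<close> evenly between the factors leaves one power of
  \<open>|b|\<close> on the squares, so summable coefficients and bounded second moments give an
  integrable majorant.\<close>

lemma weighted_cauchy_schwarz:
  fixes b z :: "nat \<Rightarrow> real"
  shows "(\<Sum>i\<in>I. b i * z i)\<^sup>2 \<le> (\<Sum>i\<in>I. \<bar>b i\<bar>) * (\<Sum>i\<in>I. \<bar>b i\<bar> * (z i)\<^sup>2)"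
proof -
  have "b i * z i = sqrt \<bar>b i\<bar> * (sgn (b i) * sqrt \<bar>b i\<bar> * z i)" for i
  proof -
    have "sqrt \<bar>b i\<bar> * (sgn (b i) * sqrt \<bar>b i\<bar> * z i) = sgn (b i) * (sqrt \<bar>b i\<bar> * sqrt \<bar>b i\<bar>) * z i" by (simp only: mult_ac)
    also have "\<dots> = b i * z i" by (simp add: sgn_mult_abs)
    finally show ?thesis ..
  qed
  then have "(\<Sum>i\<in>I. b i * z i)\<^sup>2 = (\<Sum>i\<in>I. sqrt \<bar>b i\<bar> * (sgn (b i) * sqrt \<bar>b i\<bar> * z i))\<^sup>2" by (simp only:)
  also have "\<dots> \<le> (\<Sum>i\<in>I. (sqrt \<bar>b i\<bar>)\<^sup>2) * (\<Sum>i\<in>I. (sgn (b i) * sqrt \<bar>b i\<bar> * z i)\<^sup>2)"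
    by (rule Cauchy_Schwarz_ineq_sum)
  also have "\<dots> = (\<Sum>i\<in>I. \<bar>b i\<bar>) * (\<Sum>i\<in>I. \<bar>b i\<bar> * (z i)\<^sup>2)"
  proof -
    have "(sgn (b i) * sqrt \<bar>b i\<bar> * z i)\<^sup>2 = \<bar>b i\<bar> * (z i)\<^sup>2" for i
      by (simp add: power_mult_distrib sgn_if)
    then show ?thesis by simp
  qed
  finally show ?thesis .
qed

section \<open>The noise: integrability, transforms and averages\<close>

locale ar_process = prob_space M for M :: "'a measure" +
  fixes F :: "int \<Rightarrow> 'a measure" and \<epsilon> x :: "int \<Rightarrow> 'a \<Rightarrow> real" and a :: "nat \<Rightarrow> real"
    and \<sigma> \<alpha> :: real and p :: nat
  assumes roots: "\<forall>z::complex. norm z \<le> 1 \<longrightarrow> poly (map_poly of_real (ar_poly p a)) z \<noteq> 0"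
    and stat: "stationary_AR M p a \<epsilon> x"
    and noise: "martingale_diff_seq M F \<epsilon>"
    and sigma: "0 < \<sigma>\<^sup>2" and alpha: "2 < \<alpha>"
    and cond_var: "\<forall>t. AE \<omega> in M. real_cond_exp M (F (t - 1)) (\<lambda>\<omega>. (\<epsilon> t \<omega>)\<^sup>2) \<omega> = \<sigma>\<^sup>2"
    and cond_moment: "AE \<omega> in M. (SUP t. cond_abs_moment M F \<epsilon> \<alpha> t \<omega>) < \<infinity>"
begin

lemma F_subalgebra: "subalgebra M (F t)"
  and F_mono: "s \<le> t \<Longrightarrow> sets (F s) \<subseteq> sets (F t)"
  and eps_measurable: "\<epsilon> t \<in> borel_measurable (F t)"
  and eps_cond_mean: "AE \<omega> in M. real_cond_exp M (F (t - 1)) (\<epsilon> t) \<omega> = 0"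
  using noise unfolding martingale_diff_seq_def by blast+

lemma F_measurable_mono:
  assumes "f \<in> borel_measurable (F s)" "s \<le> t" shows "f \<in> borel_measurable (F t)"
proof -
  have "subalgebra (F t) (F s)"
    using F_subalgebra[of s] F_subalgebra[of t] F_mono[OF assms(2)] by (simp add: subalgebra_def)
  then show ?thesis using assms(1) by (rule measurable_from_subalg)
qed

lemma F_measurable_M: "f \<in> borel_measurable (F t) \<Longrightarrow> f \<in> borel_measurable M"
  by (rule measurable_from_subalg[OF F_subalgebra])

lemma eps_measurable_M [measurable]: "\<epsilon> t \<in> borel_measurable M"
  by (rule F_measurable_M[OF eps_measurable])

lemma filtered: "filtered_space M (\<lambda>i. F (t + int i))"
  by (unfold_locales) (rule F_subalgebra, rule F_mono, simp)

lemma sigma_finite_F: "sigma_finite_subalgebra M (F t)"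
  using filtered_space.sigma_finite_subalgebra[OF filtered[of t], of 0] by simp

text \<open>\<open>real_cond_exp\<close> is built from \<open>enn2real\<close>, which sends infinity
  to 0. Since its value is the positive number \<open>\<sigma>^2\<close>, the extended conditional
  second moment is finite and equal to it, and integrates to a finite moment.\<close>

lemma eps_square_integrable: "integrable M (\<lambda>\<omega>. (\<epsilon> t \<omega>)\<^sup>2)"
proof -
  interpret s: sigma_finite_subalgebra M "F (t - 1)" by (rule sigma_finite_F)
  define N where "N = nn_cond_exp M (F (t - 1)) (\<lambda>\<omega>. ennreal ((\<epsilon> t \<omega>)\<^sup>2))"
  have neg: "(\<lambda>\<omega>. ennreal (- (\<epsilon> t \<omega>)\<^sup>2)) = (\<lambda>\<omega>. 0)" by (simp add: ennreal_neg)
  have "AE \<omega> in M. 0 = nn_cond_exp M (F (t - 1)) (\<lambda>\<omega>. 0) \<omega>"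
    by (rule s.nn_cond_exp_F_meas) simp
  with cond_var[rule_format, of t] have N: "AE \<omega> in M. N \<omega> = ennreal (\<sigma>\<^sup>2)"
  proof eventually_elim
    case (elim \<omega>)
    have e: "enn2real (N \<omega>) = \<sigma>\<^sup>2"
      using elim unfolding real_cond_exp_def neg N_def by (metis diff_zero enn2real_0)
    then have "N \<omega> \<noteq> \<infinity>" using sigma by auto
    then have "N \<omega> = ennreal (enn2real (N \<omega>))" by (simp add: less_top)
    then show ?case using e by simp
  qed
  have "(\<integral>\<^sup>+\<omega>. ennreal ((\<epsilon> t \<omega>)\<^sup>2) \<partial>M) = (\<integral>\<^sup>+\<omega>. 1 * ennreal ((\<epsilon> t \<omega>)\<^sup>2) \<partial>M)" by simp
  also have "\<dots> = (\<integral>\<^sup>+\<omega>. 1 * N \<omega> \<partial>M)"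
    unfolding N_def by (rule s.nn_cond_exp_intg[symmetric]) simp_all
  also have "\<dots> = (\<integral>\<^sup>+\<omega>. ennreal (\<sigma>\<^sup>2) \<partial>M)"
    by (rule nn_integral_cong_AE) (use N in simp)
  also have "\<dots> = ennreal (\<sigma>\<^sup>2)" by (simp add: emeasure_space_1)
  finally have "(\<integral>\<^sup>+\<omega>. ennreal ((\<epsilon> t \<omega>)\<^sup>2) \<partial>M) < \<infinity>" by simp
  then show ?thesis by (intro integrableI_bounded) simp_all
qed

text \<open>Half the moment order, for use with squared noise, capped at 2 so that truncation at 1
  applies; \<open>\<alpha> > 2\<close> makes it exceed 1.\<close>

definition q :: real where "q = min (\<alpha> / 2) 2"

lemma noise_moment:
  "AE \<omega> in M. (SUP i. nn_cond_exp M (F (t + int i)) (\<lambda>\<omega>. ennreal (\<bar>\<epsilon> (t + int i + 1) \<omega>\<bar> powr (2 * q))) \<omega>) < \<infinity>"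
proof -
  have le: "ennreal (\<bar>y\<bar> powr (2 * q)) \<le> 1 + ennreal (\<bar>y\<bar> powr \<alpha>)" for y :: real
  proof -
    have "\<bar>y\<bar> powr (2 * q) \<le> 1 + \<bar>y\<bar> powr \<alpha>"
    proof (cases "\<bar>y\<bar> \<le> 1")
      case True
      then have "\<bar>y\<bar> powr (2 * q) \<le> 1" using alpha by (intro powr_le1) (auto simp: q_def)
      moreover have "0 \<le> \<bar>y\<bar> powr \<alpha>" by simp
      ultimately show ?thesis by linarith
    next
      case False
      then have "\<bar>y\<bar> powr (2 * q) \<le> \<bar>y\<bar> powr \<alpha>" by (intro powr_mono) (auto simp: q_def)
      then show ?thesis by linarith
    qed
    then have "ennreal (\<bar>y\<bar> powr (2 * q)) \<le> ennreal (1 + \<bar>y\<bar> powr \<alpha>)" by (rule ennreal_leI)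
    then show ?thesis by (simp add: ennreal_plus)
  qed
  have "AE \<omega> in M. nn_cond_exp M (F (t + int i)) (\<lambda>\<omega>. ennreal (\<bar>\<epsilon> (t + int i + 1) \<omega>\<bar> powr (2 * q))) \<omega>
      \<le> 1 + cond_abs_moment M F \<epsilon> \<alpha> (t + int i + 1) \<omega>" for i
  proof -
    interpret s: sigma_finite_subalgebra M "F (t + int i)" by (rule sigma_finite_F)
    have "AE \<omega> in M. nn_cond_exp M (F (t + int i)) (\<lambda>\<omega>. ennreal (\<bar>\<epsilon> (t + int i + 1) \<omega>\<bar> powr (2 * q))) \<omega>
        \<le> nn_cond_exp M (F (t + int i)) (\<lambda>\<omega>. 1 + ennreal (\<bar>\<epsilon> (t + int i + 1) \<omega>\<bar> powr \<alpha>)) \<omega>"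
      by (rule s.nn_cond_exp_mono) (simp_all add: le)
    moreover have "AE \<omega> in M. nn_cond_exp M (F (t + int i)) (\<lambda>\<omega>. 1) \<omega>
        + nn_cond_exp M (F (t + int i)) (\<lambda>\<omega>. ennreal (\<bar>\<epsilon> (t + int i + 1) \<omega>\<bar> powr \<alpha>)) \<omega>
        = nn_cond_exp M (F (t + int i)) (\<lambda>\<omega>. 1 + ennreal (\<bar>\<epsilon> (t + int i + 1) \<omega>\<bar> powr \<alpha>)) \<omega>"
      by (rule s.nn_cond_exp_sum) simp_all
    moreover have "AE \<omega> in M. 1 = nn_cond_exp M (F (t + int i)) (\<lambda>\<omega>. 1) \<omega>"
      by (rule s.nn_cond_exp_F_meas) simp
    ultimately show ?thesis
      by eventually_elim (simp add: cond_abs_moment_def)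
  qed
  then have "AE \<omega> in M. \<forall>i. nn_cond_exp M (F (t + int i)) (\<lambda>\<omega>. ennreal (\<bar>\<epsilon> (t + int i + 1) \<omega>\<bar> powr (2 * q))) \<omega>
      \<le> 1 + cond_abs_moment M F \<epsilon> \<alpha> (t + int i + 1) \<omega>"
    unfolding AE_all_countable by blast
  with cond_moment show ?thesis
  proof eventually_elim
    case (elim \<omega>)
    have "(SUP i. nn_cond_exp M (F (t + int i)) (\<lambda>\<omega>. ennreal (\<bar>\<epsilon> (t + int i + 1) \<omega>\<bar> powr (2 * q))) \<omega>)
        \<le> 1 + (SUP t. cond_abs_moment M F \<epsilon> \<alpha> t \<omega>)"
    proof (rule SUP_least)
      fix i
      have "cond_abs_moment M F \<epsilon> \<alpha> (t + int i + 1) \<omega> \<le> (SUP t. cond_abs_moment M F \<epsilon> \<alpha> t \<omega>)"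
        by (rule SUP_upper) simp
      then show "nn_cond_exp M (F (t + int i)) (\<lambda>\<omega>. ennreal (\<bar>\<epsilon> (t + int i + 1) \<omega>\<bar> powr (2 * q))) \<omega>
          \<le> 1 + (SUP t. cond_abs_moment M F \<epsilon> \<alpha> t \<omega>)"
        using elim(2)[rule_format, of i] by (meson add_left_mono order_trans)
    qed
    also have "\<dots> < \<infinity>" using elim(1) by simp
    finally show ?case .
  qed
qed

text \<open>The filtration may start at any integer time, which lets each term of the
  \<open>h\<close>-step noise be treated with its own start.\<close>

lemma noise_from: "mart_noise_moment M (\<lambda>i. F (t + int i)) (\<lambda>i. \<epsilon> (t + int i + 1)) (\<sigma>\<^sup>2) q"
proof -
  interpret f: filtered_space M "\<lambda>i. F (t + int i)" by (rule filtered)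
  show ?thesis
  proof
    show "f.mart_diff (\<lambda>i. \<epsilon> (t + int i + 1))"
      unfolding f.mart_diff_def
    proof (intro allI conjI)
      fix i
      show "\<epsilon> (t + int i + 1) \<in> borel_measurable (F (t + int (Suc i)))"
        by (rule F_measurable_mono[OF eps_measurable]) simp
      show "AE \<omega> in M. real_cond_exp M (F (t + int i)) (\<epsilon> (t + int i + 1)) \<omega> = 0"
        using eps_cond_mean[of "t + int i + 1"] by simp
    qed (rule eps_square_integrable)
    show "AE \<omega> in M. real_cond_exp M (F (t + int i)) (\<lambda>\<omega>. (\<epsilon> (t + int i + 1) \<omega>)\<^sup>2) \<omega> = \<sigma>\<^sup>2" for i
      using cond_var[rule_format, of "t + int i + 1"] by simp
    show "1 < q" "q \<le> 2" using alpha by (auto simp: q_def)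
  qed (rule noise_moment)
qed

lemma noise_transform_negl:
  assumes u: "\<And>i. u i \<in> borel_measurable (F (t + int i))"
  shows "AE \<omega> in M. negl (\<lambda>n. \<Sum>i<n. u i \<omega> * \<epsilon> (t + int i + 1) \<omega>) (\<lambda>n. \<Sum>i<n. (u i \<omega>)\<^sup>2)"
proof -
  interpret m: mart_noise_moment M "\<lambda>i. F (t + int i)" "\<lambda>i. \<epsilon> (t + int i + 1)" "\<sigma>\<^sup>2" q by (rule noise_from)
  show ?thesis by (rule m.mart_transform_negl[OF u])
qed

lemma noise_square_negl:
  assumes v: "\<And>i. v i \<in> borel_measurable (F (t + int i))"
    and bd: "AE \<omega> in M. \<exists>K. \<forall>i. \<bar>v i \<omega>\<bar> \<le> K"
  shows "AE \<omega> in M. negl (\<lambda>n. \<Sum>i<n. v i \<omega> * ((\<epsilon> (t + int i + 1) \<omega>)\<^sup>2 - \<sigma>\<^sup>2)) (\<lambda>n. \<Sum>i<n. \<bar>v i \<omega>\<bar>)"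
proof -
  interpret m: mart_noise_moment M "\<lambda>i. F (t + int i)" "\<lambda>i. \<epsilon> (t + int i + 1)" "\<sigma>\<^sup>2" q by (rule noise_from)
  show ?thesis by (rule m.predictable_square_negl[OF v bd])
qed

lemma noise_variance_average:
  "AE \<omega> in M. (\<lambda>n. (\<Sum>t<n. \<epsilon> (int t) \<omega> * \<epsilon> (int t) \<omega>) / real n) \<longlonglongrightarrow> \<sigma>\<^sup>2"
proof -
  have "AE \<omega> in M. negl (\<lambda>n. \<Sum>i<n. 1 * ((\<epsilon> (- 1 + int i + 1) \<omega>)\<^sup>2 - \<sigma>\<^sup>2)) (\<lambda>n. \<Sum>i<n. \<bar>1 :: real\<bar>)"
    by (rule noise_square_negl) auto
  then show ?thesis
  proof eventually_elim
    case (elim \<omega>)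
    then have "negl (\<lambda>n. \<Sum>i<n. (\<epsilon> (int i) \<omega>)\<^sup>2 - \<sigma>\<^sup>2) real" by simp
    then have "(\<lambda>n. (\<Sum>i<n. (\<epsilon> (int i) \<omega>)\<^sup>2 - \<sigma>\<^sup>2) / real n) \<longlonglongrightarrow> 0"
      by (rule negl_imp_tendsto_zero) (rule filterlim_real_sequentially)
    then have "(\<lambda>n. (\<Sum>i<n. (\<epsilon> (int i) \<omega>)\<^sup>2 - \<sigma>\<^sup>2) / real n + \<sigma>\<^sup>2) \<longlonglongrightarrow> 0 + \<sigma>\<^sup>2"
      by (rule tendsto_add) simp
    moreover have "eventually (\<lambda>n. (\<Sum>i<n. (\<epsilon> (int i) \<omega>)\<^sup>2 - \<sigma>\<^sup>2) / real n + \<sigma>\<^sup>2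
        = (\<Sum>t<n. \<epsilon> (int t) \<omega> * \<epsilon> (int t) \<omega>) / real n) sequentially"
      using eventually_gt_at_top[of 0]
      by eventually_elim (simp add: sum_subtractf diff_divide_distrib power2_eq_square)
    ultimately show ?case by (auto intro: Lim_transform_eventually)
  qed
qed

text \<open>At lag \<open>l > 0\<close> the earlier noise is a predictable weight, and the transform
  is negligible against its sum of squares, which is of order \<open>n\<close> by the case
  \<open>l = 0\<close>.\<close>

lemma noise_covariance_average:
  "AE \<omega> in M. \<forall>l. (\<lambda>n. (\<Sum>t<n. \<epsilon> (int t) \<omega> * \<epsilon> (int (t + l)) \<omega>) / real n) \<longlonglongrightarrow> (if l = 0 then \<sigma>\<^sup>2 else 0)"
  unfolding AE_all_countable
proof
  fix l
  show "AE \<omega> in M. (\<lambda>n. (\<Sum>t<n. \<epsilon> (int t) \<omega> * \<epsilon> (int (t + l)) \<omega>) / real n) \<longlonglongrightarrow> (if l = 0 then \<sigma>\<^sup>2 else 0)"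
  proof (cases "l = 0")
    case True
    then show ?thesis using noise_variance_average by simp
  next
    case False
    have "AE \<omega> in M. negl (\<lambda>n. \<Sum>i<n. \<epsilon> (int i - int l) \<omega> * \<epsilon> (- 1 + int i + 1) \<omega>) (\<lambda>n. \<Sum>i<n. (\<epsilon> (int i - int l) \<omega>)\<^sup>2)"
      by (rule noise_transform_negl, rule F_measurable_mono[OF eps_measurable]) (use False in simp)
    with noise_variance_average show ?thesis
    proof eventually_elim
      case (elim \<omega>)
      define f where "f i = (\<epsilon> (int i - int l) \<omega>)\<^sup>2" for i
      obtain K where K: "0 < K" "\<And>n. (\<Sum>t<n. \<epsilon> (int t) \<omega> * \<epsilon> (int t) \<omega>) / real n \<le> K"
        using tendsto_abs_bound[OF elim(1)] by blast
      have "(\<Sum>i<n. f i) \<le> K * real n + (\<Sum>i<l. f i)" for n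
      proof -
        have "(\<Sum>i<n. f i) \<le> (\<Sum>i<n + l. f i)" by (rule sum_mono2) (auto simp: f_def)
        also have "\<dots> = (\<Sum>i<l. f i) + (\<Sum>i<n. f (i + l))" by (induction n) simp_all
        also have "(\<Sum>i<n. f (i + l)) = (\<Sum>t<n. \<epsilon> (int t) \<omega> * \<epsilon> (int t) \<omega>)"
          by (simp add: f_def power2_eq_square)
        also have "\<dots> \<le> K * real n"
          using K(2)[of n] by (cases "n = 0") (simp_all add: divide_le_eq)
        finally show ?thesis by simp
      qed
      then have "negl (\<lambda>n. \<Sum>i<n. \<epsilon> (int i - int l) \<omega> * \<epsilon> (- 1 + int i + 1) \<omega>) real"
        by (rule negl_mono[OF elim(2)[folded f_def]]) (rule K(1))
      then have "(\<lambda>n. (\<Sum>i<n. \<epsilon> (int i - int l) \<omega> * \<epsilon> (- 1 + int i + 1) \<omega>) / real n) \<longlonglongrightarrow> 0"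
        by (rule negl_imp_tendsto_zero) (rule filterlim_real_sequentially)
      from average_advance[OF this, of l] show ?case using False by simp
    qed
  qed
qed

section \<open>Sample and population autocovariances\<close>

definition b :: "nat \<Rightarrow> real" where "b = ma_coeff p a"
text \<open>The autocovariance of the moving average as a series. Sample averages and expectations
  are each shown to equal it, and so are linked to one another.\<close>

definition gam :: "nat \<Rightarrow> real" where "gam r = \<sigma>\<^sup>2 * (\<Sum>i. b i * b (i + r))"
definition gmat :: "nat \<Rightarrow> nat \<Rightarrow> real" where "gmat r s = gam (nat \<bar>int r - int s\<bar>)"

lemma b_summable: "summable (\<lambda>i. \<bar>b i\<bar>)"
  unfolding b_def by (rule ma_coeff_summable[OF roots])

lemma x_measurable [measurable]: "x t \<in> borel_measurable M"
  and x_recursion: "AE \<omega> in M. x (t + 1) \<omega> = (\<Sum>i=1..p. a i * x (t + 1 - int i) \<omega>) + \<epsilon> (t + 1) \<omega>"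
  and x_sums: "AE \<omega> in M. (\<lambda>i. b i * \<epsilon> (t - int i) \<omega>) sums x t \<omega>"
  using stat unfolding stationary_AR_def b_def by blast+

lemma x_recursion_all: "AE \<omega> in M. \<forall>t. x (t + 1) \<omega> = (\<Sum>i=1..p. a i * x (t + 1 - int i) \<omega>) + \<epsilon> (t + 1) \<omega>"
  unfolding AE_all_countable using x_recursion by blast

text \<open>\<open>x t\<close> agrees with an \<open>F t\<close>-measurable variable only almost everywhere, since \<open>F t\<close> need not be complete.\<close>

definition xF :: "int \<Rightarrow> 'a \<Rightarrow> real" where "xF t \<omega> = (\<Sum>i. b i * \<epsilon> (t - int i) \<omega>)"

lemma xF_measurable: "xF t \<in> borel_measurable (F t)"
proof -
  have [measurable]: "\<epsilon> (t - int i) \<in> borel_measurable (F t)" for i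
    by (rule F_measurable_mono[OF eps_measurable]) simp
  show ?thesis unfolding xF_def[abs_def] by measurable
qed

lemma x_eq_xF: "AE \<omega> in M. \<forall>t. x t \<omega> = xF t \<omega>"
proof -
  have "AE \<omega> in M. \<forall>t. (\<lambda>i. b i * \<epsilon> (t - int i) \<omega>) sums x t \<omega>"
    unfolding AE_all_countable using x_sums by blast
  then show ?thesis by eventually_elim (simp add: xF_def sums_unique)
qed

lemma sample_covariance:
  "AE \<omega> in M. \<forall>r. (\<lambda>n. (\<Sum>t<n. x (int t) \<omega> * x (int (t + r)) \<omega>) / real n) \<longlonglongrightarrow> gam r"
  using noise_covariance_average x_recursion_all
proof eventually_elim
  case (elim \<omega>)
  \<comment> \<open>Filtering the path from time 0 gives the true noise from \<open>p\<close> on;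
    the finitely many earlier values do not affect averages.\<close>
  define e where "e n = (\<Sum>j\<le>n. coeff (ar_poly p a) j * x (int (n - j)) \<omega>)" for n
  have e: "e n = \<epsilon> (int n) \<omega>" if "p \<le> n" for n
    using ar_poly_filter[of "\<lambda>t. x t \<omega>" a p "\<lambda>t. \<epsilon> t \<omega>" n 0] elim(2) that by (simp add: e_def)
  show ?case unfolding gam_def
  proof (intro allI linear_process_covariance)
    show "summable (\<lambda>i. \<bar>b i\<bar>)" by (rule b_summable)
    show "(\<lambda>n. (\<Sum>t<n. e t * e (t + l)) / real n) \<longlonglongrightarrow> (if l = 0 then \<sigma>\<^sup>2 else 0)" for l
      by (rule average_cong_eventually[of p _ "\<lambda>t. \<epsilon> (int t) \<omega> * \<epsilon> (int (t + l)) \<omega>"])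
        (use e elim(1) in simp_all)
    show "x (int t) \<omega> = (\<Sum>i\<le>t. b i * e (t - i))" for t
      unfolding b_def e_def by (rule ma_coeff_inverse_filter)
  qed
qed

lemma eps_product_integrable: "integrable M (\<lambda>\<omega>. \<epsilon> s \<omega> * \<epsilon> t \<omega>)"
proof -
  interpret f: filtered_space M "\<lambda>i. F (0 + int i)" by (rule filtered)
  show ?thesis by (rule f.integrable_prod_squares) (simp_all add: eps_square_integrable)
qed

lemma predictable_eps_integral:
  assumes f: "f \<in> borel_measurable (F u)" and "u < t" and int: "integrable M (\<lambda>\<omega>. f \<omega> * \<epsilon> t \<omega>)"
  shows "(\<integral>\<omega>. f \<omega> * \<epsilon> t \<omega> \<partial>M) = 0"
proof -
  interpret f: filtered_space M "\<lambda>i. F (t - 1 + int i)" by (rule filtered)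
  show ?thesis
  proof (rule f.integral_predictable_mult[of f 0])
    show "f \<in> borel_measurable (F (t - 1 + int 0))"
      by (rule F_measurable_mono[OF f]) (use assms(2) in simp)
    show "AE \<omega> in M. real_cond_exp M (F (t - 1 + int 0)) (\<epsilon> t) \<omega> = 0"
      using eps_cond_mean[of t] by simp
  qed (simp_all add: int)
qed

lemma eps_variance: "(\<integral>\<omega>. (\<epsilon> t \<omega>)\<^sup>2 \<partial>M) = \<sigma>\<^sup>2"
proof -
  interpret m: mart_noise_moment M "\<lambda>i. F (t - 1 + int i)" "\<lambda>i. \<epsilon> (t - 1 + int i + 1)" "\<sigma>\<^sup>2" q by (rule noise_from)
  show ?thesis using m.e_square_integral[of 0] by simp
qed

lemma eps_product_integral: "(\<integral>\<omega>. \<epsilon> s \<omega> * \<epsilon> t \<omega> \<partial>M) = (if s = t then \<sigma>\<^sup>2 else 0)"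
proof -
  have *: "(\<integral>\<omega>. \<epsilon> s \<omega> * \<epsilon> t \<omega> \<partial>M) = 0" if "s < t" for s t
    by (rule predictable_eps_integral[OF eps_measurable that eps_product_integrable])
  consider "s = t" | "s < t" | "t < s" by linarith
  then show ?thesis
  proof cases
    case 1
    then show ?thesis using eps_variance[of t] by (simp add: power2_eq_square)
  next
    case 2
    then show ?thesis using *[OF 2] by simp
  next
    case 3
    then show ?thesis using *[OF 3] by (simp add: mult.commute)
  qed
qed

text \<open>By Cauchy-Schwarz with weights \<open>|b i|\<close> this dominates the squares of all
  partial sums; it is the majorant for dominated convergence.\<close>

definition H :: "int \<Rightarrow> 'a \<Rightarrow> real" where
  "H t \<omega> = (\<Sum>i. \<bar>b i\<bar>) * (\<Sum>i. \<bar>b i\<bar> * (\<epsilon> (t - int i) \<omega>)\<^sup>2)"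

lemma H_summable: "AE \<omega> in M. summable (\<lambda>i. \<bar>b i\<bar> * (\<epsilon> (t - int i) \<omega>)\<^sup>2)"
  by (rule AE_summable_of_integral)
    (use b_summable in \<open>simp_all add: eps_square_integrable eps_variance summable_mult2\<close>)

lemma H_integrable: "integrable M (H t)"
  unfolding H_def[abs_def]
proof (intro integrable_mult_right integrable_suminf)
  show "AE \<omega> in M. summable (\<lambda>i. norm (\<bar>b i\<bar> * (\<epsilon> (t - int i) \<omega>)\<^sup>2))"
    using H_summable[of t] by (simp add: abs_mult)
  show "summable (\<lambda>i. \<integral>\<omega>. norm (\<bar>b i\<bar> * (\<epsilon> (t - int i) \<omega>)\<^sup>2) \<partial>M)"
    using b_summable by (simp add: abs_mult eps_variance summable_mult2)
qed (simp add: eps_square_integrable)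

lemma partial_sum_le_H: "AE \<omega> in M. \<forall>N. (\<Sum>i<N. b i * \<epsilon> (t - int i) \<omega>)\<^sup>2 \<le> H t \<omega>"
  using H_summable[of t]
proof eventually_elim
  case (elim \<omega>)
  show ?case
  proof
    fix N
    have "(\<Sum>i<N. b i * \<epsilon> (t - int i) \<omega>)\<^sup>2 \<le> (\<Sum>i<N. \<bar>b i\<bar>) * (\<Sum>i<N. \<bar>b i\<bar> * (\<epsilon> (t - int i) \<omega>)\<^sup>2)"
      by (rule weighted_cauchy_schwarz)
    also have "\<dots> \<le> H t \<omega>" unfolding H_def
      by (intro mult_mono sum_le_suminf b_summable elim suminf_nonneg) (auto intro: sum_nonneg)
    finally show "(\<Sum>i<N. b i * \<epsilon> (t - int i) \<omega>)\<^sup>2 \<le> H t \<omega>" .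
  qed
qed

lemma x_lag_product:
  "integrable M (\<lambda>\<omega>. x s \<omega> * x (s - int r) \<omega>) \<and> (\<integral>\<omega>. x s \<omega> * x (s - int r) \<omega> \<partial>M) = gam r"
proof -
  define S where "S t N \<omega> = (\<Sum>i<N. b i * \<epsilon> (t - int i) \<omega>)" for t N \<omega>
  \<comment> \<open>The lengths \<open>N + r\<close> and \<open>N\<close> make both partial sums end
    at the same oldest noise, so every \<open>j < N\<close> finds its partner
    \<open>i = j + r\<close>.\<close>
  define g where "g N \<omega> = S s (N + r) \<omega> * S (s - int r) N \<omega>" for N \<omega>
  have [measurable]: "S t N \<in> borel_measurable M" for t N unfolding S_def[abs_def] by measurable
  have gm: "g N \<in> borel_measurable M" for N unfolding g_def[abs_def] by measurable
  have lim: "AE \<omega> in M. (\<lambda>N. g N \<omega>) \<longlonglongrightarrow> x s \<omega> * x (s - int r) \<omega>"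
    using x_sums[of s] x_sums[of "s - int r"]
  proof eventually_elim
    case (elim \<omega>)
    then have "(\<lambda>N. S s N \<omega>) \<longlonglongrightarrow> x s \<omega>" "(\<lambda>N. S (s - int r) N \<omega>) \<longlonglongrightarrow> x (s - int r) \<omega>"
      unfolding sums_def S_def by auto
    then show ?case unfolding g_def by (intro tendsto_mult LIMSEQ_ignore_initial_segment)
  qed
  have intw: "integrable M (\<lambda>\<omega>. H s \<omega> + H (s - int r) \<omega>)"
    by (intro Bochner_Integration.integrable_add H_integrable)
  have bound: "AE \<omega> in M. norm (g N \<omega>) \<le> H s \<omega> + H (s - int r) \<omega>" for N
    using partial_sum_le_H[of s] partial_sum_le_H[of "s - int r"]
  proof eventually_elim
    case (elim \<omega>)
    have "\<bar>g N \<omega>\<bar> \<le> (S s (N + r) \<omega>)\<^sup>2 + (S (s - int r) N \<omega>)\<^sup>2"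
      unfolding g_def by (rule abs_mult_le_sum_squares)
    also have "\<dots> \<le> H s \<omega> + H (s - int r) \<omega>"
      unfolding S_def using elim by (intro add_mono) auto
    finally show ?case by simp
  qed
  have xm: "(\<lambda>\<omega>. x s \<omega> * x (s - int r) \<omega>) \<in> borel_measurable M" by measurable
  have int: "integrable M (\<lambda>\<omega>. x s \<omega> * x (s - int r) \<omega>)"
    by (rule integrable_dominated_convergence[OF xm gm intw lim bound])
  have L: "(\<lambda>N. \<integral>\<omega>. g N \<omega> \<partial>M) \<longlonglongrightarrow> (\<integral>\<omega>. x s \<omega> * x (s - int r) \<omega> \<partial>M)"
    by (rule integral_dominated_convergence[OF xm gm intw lim bound])
  have g_int: "(\<integral>\<omega>. g N \<omega> \<partial>M) = \<sigma>\<^sup>2 * (\<Sum>j<N. b j * b (j + r))" for N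
  proof -
    have "(\<integral>\<omega>. g N \<omega> \<partial>M)
        = (\<integral>\<omega>. (\<Sum>i<N + r. \<Sum>j<N. b i * b j * (\<epsilon> (s - int i) \<omega> * \<epsilon> (s - int r - int j) \<omega>)) \<partial>M)"
      by (simp add: g_def S_def sum_product mult_ac)
    also have "\<dots> = (\<Sum>i<N + r. \<Sum>j<N. b i * b j * (\<integral>\<omega>. \<epsilon> (s - int i) \<omega> * \<epsilon> (s - int r - int j) \<omega> \<partial>M))"
      by (simp add: Bochner_Integration.integral_sum eps_product_integrable)
    also have "\<dots> = (\<Sum>j<N. \<Sum>i<N + r. if i = j + r then b i * b j * \<sigma>\<^sup>2 else 0)"
      by (subst sum.swap) (auto simp: eps_product_integral intro!: sum.cong)
    also have "\<dots> = (\<Sum>j<N. b (j + r) * b j * \<sigma>\<^sup>2)"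
      by (rule sum.cong) (auto simp: sum.delta)
    finally show ?thesis by (simp add: sum_distrib_left mult_ac)
  qed
  have "(\<lambda>N. \<Sum>j<N. b j * b (j + r)) \<longlonglongrightarrow> (\<Sum>i. b i * b (i + r))"
    by (rule summable_LIMSEQ[OF summable_shifted_product[OF b_summable]])
  then have "(\<lambda>N. \<integral>\<omega>. g N \<omega> \<partial>M) \<longlonglongrightarrow> gam r"
    unfolding g_int gam_def by (rule tendsto_mult[OF tendsto_const])
  with L int show ?thesis by (blast intro: LIMSEQ_unique)
qed

lemma x_product:
  "integrable M (\<lambda>\<omega>. x s \<omega> * x t \<omega>) \<and> (\<integral>\<omega>. x s \<omega> * x t \<omega> \<partial>M) = gam (nat \<bar>s - t\<bar>)"
proof (cases "t \<le> s")
  case True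
  then have "s - int (nat \<bar>s - t\<bar>) = t" by simp
  then show ?thesis using x_lag_product[of s "nat \<bar>s - t\<bar>"] by (simp only:)
next
  case False
  then have "t - int (nat \<bar>s - t\<bar>) = s" by simp
  then show ?thesis using x_lag_product[of t "nat \<bar>s - t\<bar>"] by (simp only: mult.commute)
qed

lemma x_eps_integrable: "integrable M (\<lambda>\<omega>. x s \<omega> * \<epsilon> t \<omega>)"
proof -
  interpret f: filtered_space M "\<lambda>i. F (0 + int i)" by (rule filtered)
  show ?thesis
    by (rule f.integrable_prod_squares)
      (use x_product[of s s] in \<open>simp_all add: eps_square_integrable power2_eq_square[of "x s _"]\<close>)
qed

text \<open>\<open>x u\<close> is exchanged for \<open>xF u\<close>, which is
  \<open>F u\<close>-measurable and almost everywhere equal to it, so that conditioning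
  applies.\<close>

lemma x_eps_past: assumes "u < t" shows "(\<integral>\<omega>. x u \<omega> * \<epsilon> t \<omega> \<partial>M) = 0"
proof -
  have xm: "xF u \<in> borel_measurable M" by (rule F_measurable_M[OF xF_measurable])
  have eq: "AE \<omega> in M. x u \<omega> * \<epsilon> t \<omega> = xF u \<omega> * \<epsilon> t \<omega>" using x_eq_xF by eventually_elim simp
  have "integrable M (\<lambda>\<omega>. xF u \<omega> * \<epsilon> t \<omega>)"
    by (rule integrable_cong_AE_imp[OF x_eps_integrable _ eq]) (use xm in simp)
  then have "(\<integral>\<omega>. xF u \<omega> * \<epsilon> t \<omega> \<partial>M) = 0" by (rule predictable_eps_integral[OF xF_measurable assms])
  moreover have "(\<integral>\<omega>. x u \<omega> * \<epsilon> t \<omega> \<partial>M) = (\<integral>\<omega>. xF u \<omega> * \<epsilon> t \<omega> \<partial>M)"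
    by (rule integral_cong_AE) (use xm eq in simp_all)
  ultimately show ?thesis by simp
qed

lemma x_eps_present: "(\<integral>\<omega>. x t \<omega> * \<epsilon> t \<omega> \<partial>M) = \<sigma>\<^sup>2"
proof -
  have "(\<integral>\<omega>. x t \<omega> * \<epsilon> t \<omega> \<partial>M) = (\<integral>\<omega>. (\<Sum>i=1..p. a i * (x (t - int i) \<omega> * \<epsilon> t \<omega>)) + (\<epsilon> t \<omega>)\<^sup>2 \<partial>M)"
  proof (rule integral_cong_AE)
    show "AE \<omega> in M. x t \<omega> * \<epsilon> t \<omega> = (\<Sum>i=1..p. a i * (x (t - int i) \<omega> * \<epsilon> t \<omega>)) + (\<epsilon> t \<omega>)\<^sup>2"
      using x_recursion[of "t - 1"]
      by eventually_elim (simp add: distrib_right sum_distrib_right power2_eq_square mult.assoc)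
  qed measurable
  also have "\<dots> = (\<Sum>i=1..p. a i * (\<integral>\<omega>. x (t - int i) \<omega> * \<epsilon> t \<omega> \<partial>M)) + (\<integral>\<omega>. (\<epsilon> t \<omega>)\<^sup>2 \<partial>M)"
    by (simp add: x_eps_integrable eps_square_integrable)
  also have "\<dots> = \<sigma>\<^sup>2" by (simp add: x_eps_past eps_variance)
  finally show ?thesis .
qed

lemma autocov_mat_index: "r < k \<Longrightarrow> s < k \<Longrightarrow> autocov_mat M x k $$ (r, s) = gmat r s"
  using x_product[of "1 - int r" "1 - int s"]
  by (simp add: autocov_mat_def lag_vec_def gmat_def abs_minus_commute)

lemma autocov_eq: "autocov M x j = gam j"
  using x_product[of 0 "0 - int j"] by (simp add: autocov_def)

text \<open>A null combination of the lags would be uncorrelated with the most recent innovation it contains.\<close>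

lemma gmat_nonsingular:
  assumes c: "\<And>r. r < k \<Longrightarrow> (\<Sum>s<k. gmat r s * c s) = 0" and s: "s < k"
  shows "c s = 0"
proof (rule ccontr)
  assume cs: "c s \<noteq> 0"
  define s0 where "s0 = (LEAST s. c s \<noteq> 0)"
  have s0: "c s0 \<noteq> 0" unfolding s0_def by (rule LeastI, rule cs)
  have "s0 \<le> s" unfolding s0_def by (rule Least_le, rule cs)
  then have s0k: "s0 < k" using s by simp
  have below: "c r = 0" if "r < s0" for r using not_less_Least[of r "\<lambda>s. c s \<noteq> 0"] that unfolding s0_def by blast
  define u where "u \<omega> = (\<Sum>s<k. c s * x (- int s) \<omega>)" for \<omega>
  have um [measurable]: "u \<in> borel_measurable M" unfolding u_def[abs_def] by measurable
  have usq: "(u \<omega>)\<^sup>2 = (\<Sum>r<k. \<Sum>s<k. c r * c s * (x (- int r) \<omega> * x (- int s) \<omega>))" for \<omega>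
    by (simp add: u_def power2_eq_square sum_product mult_ac)
  have intu: "integrable M (\<lambda>\<omega>. (u \<omega>)\<^sup>2)"
    unfolding usq using x_product by (intro Bochner_Integration.integrable_sum integrable_mult_right) blast
  have xp: "(\<integral>\<omega>. x (- int r) \<omega> * x (- int s) \<omega> \<partial>M) = gmat r s" for r s
    using x_product[of "- int r" "- int s"] by (simp add: gmat_def abs_minus_commute)
  have ip: "integrable M (\<lambda>\<omega>. x (- int r) \<omega> * x (- int s) \<omega>)" for r s using x_product by blast
  \<comment> \<open>The second moment of \<open>u\<close> is the quadratic form of \<open>c\<close>,
    which vanishes by assumption.\<close>
  have "(\<integral>\<omega>. (u \<omega>)\<^sup>2 \<partial>M) = (\<Sum>r<k. \<Sum>s<k. c r * c s * gmat r s)"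
    unfolding usq by (simp add: ip xp)
  also have "\<dots> = (\<Sum>r<k. c r * (\<Sum>s<k. gmat r s * c s))" by (simp add: sum_distrib_left mult_ac)
  also have "\<dots> = 0" using c by simp
  finally have "(\<integral>\<omega>. (u \<omega>)\<^sup>2 \<partial>M) = 0" .
  then have u0: "AE \<omega> in M. (u \<omega>)\<^sup>2 = 0"
    using integral_nonneg_eq_0_iff_AE[OF intu] by simp
  have "(\<integral>\<omega>. u \<omega> * \<epsilon> (- int s0) \<omega> \<partial>M) = (\<integral>\<omega>. 0 \<partial>M)"
  proof (rule integral_cong_AE)
    show "AE \<omega> in M. u \<omega> * \<epsilon> (- int s0) \<omega> = 0" using u0 by eventually_elim simp
  qed simp_all
  moreover have "(\<integral>\<omega>. u \<omega> * \<epsilon> (- int s0) \<omega> \<partial>M) = (\<Sum>s<k. c s * (\<integral>\<omega>. x (- int s) \<omega> * \<epsilon> (- int s0) \<omega> \<partial>M))"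
    by (simp add: u_def sum_distrib_right mult.assoc x_eps_integrable)
  \<comment> \<open>Lags before \<open>s0\<close> have coefficient 0 and lags after it are older
    than this innovation, so only \<open>s0\<close> contributes.\<close>
  moreover have "\<dots> = (\<Sum>s\<in>{s0}. c s * (\<integral>\<omega>. x (- int s) \<omega> * \<epsilon> (- int s0) \<omega> \<partial>M))"
  proof (rule sum.mono_neutral_right)
    show "\<forall>i\<in>{..<k} - {s0}. c i * (\<integral>\<omega>. x (- int i) \<omega> * \<epsilon> (- int s0) \<omega> \<partial>M) = 0"
    proof
      fix i assume "i \<in> {..<k} - {s0}"
      then consider "i < s0" | "s0 < i" by force
      then show "c i * (\<integral>\<omega>. x (- int i) \<omega> * \<epsilon> (- int s0) \<omega> \<partial>M) = 0"
        by cases (simp_all add: below x_eps_past)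
    qed
  qed (use s0k in auto)
  ultimately show False using s0 sigma by (simp add: x_eps_present)
qed

text \<open>Multiply the recursion at time 0 by \<open>x\<close> at time \<open>- 1 - r\<close> and
  integrate; the noise drops out. The coefficients are padded with zeros from \<open>p\<close> to
  \<open>k\<close>.\<close>

lemma yule_walker:
  assumes "p \<le> k"
  shows "(\<Sum>s<k. gmat r s * (if s < p then a (Suc s) else 0)) = gam (Suc r)"
proof -
  define t where "t = - 1 - int r"
  have "gam (Suc r) = (\<integral>\<omega>. x 0 \<omega> * x t \<omega> \<partial>M)"
    using x_product[of 0 t] by (simp add: t_def nat_add_distrib)
  also have "\<dots> = (\<integral>\<omega>. (\<Sum>i=1..p. a i * (x (- int i) \<omega> * x t \<omega>)) + x t \<omega> * \<epsilon> 0 \<omega> \<partial>M)"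
  proof (rule integral_cong_AE)
    show "AE \<omega> in M. x 0 \<omega> * x t \<omega> = (\<Sum>i=1..p. a i * (x (- int i) \<omega> * x t \<omega>)) + x t \<omega> * \<epsilon> 0 \<omega>"
      using x_recursion[of "- 1"]
    proof eventually_elim
      case (elim \<omega>)
      have "x 0 \<omega> = (\<Sum>i=1..p. a i * x (- int i) \<omega>) + \<epsilon> 0 \<omega>" using elim by simp
      then have "x 0 \<omega> * x t \<omega> = (\<Sum>i=1..p. a i * x (- int i) \<omega>) * x t \<omega> + \<epsilon> 0 \<omega> * x t \<omega>"
        by (simp only: distrib_right)
      then show ?case by (simp only: sum_distrib_right mult.assoc mult.commute[of "\<epsilon> 0 \<omega>"])
    qed
  qed measurable
  also have "\<dots> = (\<Sum>i=1..p. a i * (\<integral>\<omega>. x (- int i) \<omega> * x t \<omega> \<partial>M)) + (\<integral>\<omega>. x t \<omega> * \<epsilon> 0 \<omega> \<partial>M)"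
    using x_product by (simp add: x_eps_integrable)
  also have "(\<integral>\<omega>. x t \<omega> * \<epsilon> 0 \<omega> \<partial>M) = 0" by (rule x_eps_past) (simp add: t_def)
  also have "(\<Sum>i=1..p. a i * (\<integral>\<omega>. x (- int i) \<omega> * x t \<omega> \<partial>M)) = (\<Sum>i=1..p. a i * gmat r (i - 1))"
  proof (rule sum.cong)
    fix i assume i: "i \<in> {1..p}"
    have "\<bar>- int i - t\<bar> = \<bar>int r - int (i - 1)\<bar>" using i by (simp add: t_def of_nat_diff)
    then show "a i * (\<integral>\<omega>. x (- int i) \<omega> * x t \<omega> \<partial>M) = a i * gmat r (i - 1)"
      using x_product[of "- int i" t] by (simp add: gmat_def)
  qed simp
  also have "\<dots> = (\<Sum>s<p. a (Suc s) * gmat r s)"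
    by (rule sum.reindex_bij_witness[of _ Suc "\<lambda>i. i - 1"]) auto
  also have "\<dots> = (\<Sum>s<k. gmat r s * (if s < p then a (Suc s) else 0))"
    by (rule sum.mono_neutral_cong_left) (use assms in auto)
  finally show ?thesis by simp
qed

end

section \<open>Powers of companion matrices and inverses\<close>

text \<open>Powers as functions of the entries, so that measurability and limits follow entry by
  entry, with no carrier conditions.\<close>

primrec mpow :: "nat \<Rightarrow> (nat \<Rightarrow> nat \<Rightarrow> real) \<Rightarrow> nat \<Rightarrow> nat \<Rightarrow> nat \<Rightarrow> real" where
  "mpow k A 0 r s = (if r = s then 1 else 0)"
| "mpow k A (Suc m) r s = (\<Sum>t<k. mpow k A m r t * A t s)"

lemma mpow_Suc_left:
  assumes "r < k" "s < k"
  shows "mpow k A (Suc m) r s = (\<Sum>t<k. A r t * mpow k A m t s)"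
  using assms(2)
proof (induction m arbitrary: s)
  case 0
  have "(\<Sum>t<k. (if r = t then 1 else 0) * A t s) = (\<Sum>t<k. if r = t then A r s else 0)"
    by (rule sum.cong) auto
  moreover have "(\<Sum>t<k. A r t * (if t = s then 1 else 0)) = (\<Sum>t<k. if s = t then A r s else 0)"
    by (rule sum.cong) auto
  ultimately show ?case using assms 0 by (simp add: sum.delta)
next
  case (Suc m)
  have "mpow k A (Suc (Suc m)) r s = (\<Sum>t<k. (\<Sum>u<k. A r u * mpow k A m u t) * A t s)"
    using Suc.IH by (subst mpow.simps) (intro sum.cong, simp_all del: mpow.simps)
  also have "\<dots> = (\<Sum>t<k. \<Sum>u<k. A r u * (mpow k A m u t * A t s))"
    by (simp add: sum_distrib_right mult.assoc)
  also have "\<dots> = (\<Sum>u<k. \<Sum>t<k. A r u * (mpow k A m u t * A t s))" by (rule sum.swap)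
  finally show ?case by (simp add: sum_distrib_left)
qed

lemma pow_mat_index:
  assumes M: "M \<in> carrier_mat k k" and "r < k" "s < k"
  shows "(M ^\<^sub>m m) $$ (r, s) = mpow k (\<lambda>r s. M $$ (r, s)) m r s"
  using assms(2,3)
proof (induction m arbitrary: s)
  case (Suc m)
  have d: "dim_row (M ^\<^sub>m m) = k" "dim_col (M ^\<^sub>m m) = k" "dim_row M = k" "dim_col M = k"
    using M by auto
  have "(M ^\<^sub>m Suc m) $$ (r, s) = (\<Sum>t = 0..<k. (M ^\<^sub>m m) $$ (r, t) * M $$ (t, s))"
    using Suc.prems d by (simp add: scalar_prod_def)
  also have "\<dots> = (\<Sum>t<k. mpow k (\<lambda>r s. M $$ (r, s)) m r t * M $$ (t, s))"
    unfolding atLeast0LessThan by (rule sum.cong) (use Suc in auto)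
  finally show ?case by simp
qed (use M in auto)

lemma mpow_cong:
  assumes A: "\<And>r s. r < k \<Longrightarrow> s < k \<Longrightarrow> A r s = B r s" and "r < k" "s < k"
  shows "mpow k A m r s = mpow k B m r s"
  using assms(3)
proof (induction m arbitrary: s)
  case (Suc m)
  then show ?case by (auto simp: A intro!: sum.cong)
qed simp

definition companion_fun :: "(nat \<Rightarrow> real) \<Rightarrow> nat \<Rightarrow> nat \<Rightarrow> real" where
  "companion_fun v r c = (if c = 0 then v r else if r = c - 1 then 1 else 0)"

lemma companion_carrier: "companion k v \<in> carrier_mat k k"
  by (simp add: companion_def)

lemma companion_pow_index:
  assumes "r < k" "s < k"
  shows "(companion k v ^\<^sub>m m) $$ (r, s) = mpow k (companion_fun (vec_index v)) m r s"
  unfolding pow_mat_index[OF companion_carrier assms]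
  by (rule mpow_cong) (use assms in \<open>auto simp: companion_def companion_fun_def\<close>)

text \<open>The vector is the first column of its companion matrix, so a power applied to it is the
  first column of the next power.\<close>

lemma companion_pow_coeff:
  assumes r: "r < k" and v: "v \<in> carrier_vec k"
  shows "vec_index ((companion k v ^\<^sub>m m) *\<^sub>v v) r = mpow k (companion_fun (vec_index v)) (Suc m) r 0"
proof -
  have d: "dim_row (companion k v ^\<^sub>m m) = k" "dim_col (companion k v ^\<^sub>m m) = k" "dim_vec v = k"
    using companion_carrier[of k v] v by auto
  have "vec_index ((companion k v ^\<^sub>m m) *\<^sub>v v) r = (\<Sum>t = 0..<k. (companion k v ^\<^sub>m m) $$ (r, t) * vec_index v t)"
    using r d by (simp add: scalar_prod_def)
  also have "\<dots> = (\<Sum>t<k. mpow k (companion_fun (vec_index v)) m r t * companion_fun (vec_index v) t 0)"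
    unfolding atLeast0LessThan by (rule sum.cong) (use r in \<open>auto simp: companion_pow_index companion_fun_def\<close>)
  finally show ?thesis by simp
qed

text \<open>First column of \<open>B^h - A^h = (\<Sum>j<h. A^(h - 1 - j) (B - A) B^j)\<close>, where \<open>B - A\<close> has only its first column nonzero.\<close>

lemma mpow_companion_diff:
  assumes k: "0 < k" and r: "r < k"
  shows "mpow k (companion_fun w) h r 0 = mpow k (companion_fun v) h r 0 +
    (\<Sum>j<h. mpow k (companion_fun w) j 0 0 * (\<Sum>s<k. mpow k (companion_fun v) (h - 1 - j) r s * (w s - v s)))"
  using r
proof (induction h arbitrary: r)
  case (Suc h)
  have companion_fun: "companion_fun w r t = companion_fun v r t + (if t = 0 then w r - v r else 0)" for t
    by (simp add: companion_fun_def)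
  have e: "(\<Sum>t<k. companion_fun v r t * (\<Sum>s<k. mpow k (companion_fun v) (h - 1 - j) t s * (w s - v s)))
      = (\<Sum>s<k. mpow k (companion_fun v) (Suc h - 1 - j) r s * (w s - v s))" if "j < h" for j
  proof -
    have "(\<Sum>t<k. companion_fun v r t * (\<Sum>s<k. mpow k (companion_fun v) (h - 1 - j) t s * (w s - v s)))
        = (\<Sum>t<k. \<Sum>s<k. companion_fun v r t * mpow k (companion_fun v) (h - 1 - j) t s * (w s - v s))"
      by (simp add: sum_distrib_left mult.assoc)
    also have "\<dots> = (\<Sum>s<k. \<Sum>t<k. companion_fun v r t * mpow k (companion_fun v) (h - 1 - j) t s * (w s - v s))" by (rule sum.swap)
    also have "\<dots> = (\<Sum>s<k. mpow k (companion_fun v) (Suc (h - 1 - j)) r s * (w s - v s))"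
      by (rule sum.cong) (use Suc.prems in \<open>simp_all add: mpow_Suc_left sum_distrib_right del: mpow.simps\<close>)
    also have "Suc (h - 1 - j) = Suc h - 1 - j" using that by simp
    finally show ?thesis .
  qed
  have last: "(\<Sum>s<k. mpow k (companion_fun v) 0 r s * (w s - v s)) = w r - v r"
  proof -
    have "(\<Sum>s<k. mpow k (companion_fun v) 0 r s * (w s - v s)) = (\<Sum>s<k. if r = s then w r - v r else 0)"
      by (rule sum.cong) auto
    then show ?thesis using Suc.prems by (simp add: sum.delta)
  qed
  have "mpow k (companion_fun w) (Suc h) r 0 = (\<Sum>t<k. companion_fun w r t * mpow k (companion_fun w) h t 0)"
    using Suc.prems k by (rule mpow_Suc_left)
  also have "\<dots> = (\<Sum>t<k. companion_fun v r t * mpow k (companion_fun w) h t 0 + (if 0 = t then (w r - v r) * mpow k (companion_fun w) h t 0 else 0))"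
    by (rule sum.cong) (simp_all add: companion_fun distrib_right)
  also have "\<dots> = (\<Sum>t<k. companion_fun v r t * mpow k (companion_fun w) h t 0) + (w r - v r) * mpow k (companion_fun w) h 0 0"
    using k by (simp add: sum.distrib sum.delta)
  also have "(\<Sum>t<k. companion_fun v r t * mpow k (companion_fun w) h t 0)
      = (\<Sum>t<k. companion_fun v r t * (mpow k (companion_fun v) h t 0 +
        (\<Sum>j<h. mpow k (companion_fun w) j 0 0 * (\<Sum>s<k. mpow k (companion_fun v) (h - 1 - j) t s * (w s - v s)))))"
    using Suc.IH by (intro sum.cong) simp_all
  also have "\<dots> = (\<Sum>t<k. companion_fun v r t * mpow k (companion_fun v) h t 0)
      + (\<Sum>t<k. \<Sum>j<h. mpow k (companion_fun w) j 0 0 * (companion_fun v r t * (\<Sum>s<k. mpow k (companion_fun v) (h - 1 - j) t s * (w s - v s))))"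
    by (simp only: distrib_left sum.distrib sum_distrib_left mult_ac)
  also have "(\<Sum>t<k. companion_fun v r t * mpow k (companion_fun v) h t 0) = mpow k (companion_fun v) (Suc h) r 0"
    by (rule mpow_Suc_left[OF Suc.prems k, symmetric])
  also have "(\<Sum>t<k. \<Sum>j<h. mpow k (companion_fun w) j 0 0 * (companion_fun v r t * (\<Sum>s<k. mpow k (companion_fun v) (h - 1 - j) t s * (w s - v s))))
      = (\<Sum>j<h. mpow k (companion_fun w) j 0 0 * (\<Sum>s<k. mpow k (companion_fun v) (Suc h - 1 - j) r s * (w s - v s)))"
  proof -
    have "(\<Sum>t<k. \<Sum>j<h. mpow k (companion_fun w) j 0 0 * (companion_fun v r t * (\<Sum>s<k. mpow k (companion_fun v) (h - 1 - j) t s * (w s - v s))))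
       = (\<Sum>j<h. \<Sum>t<k. mpow k (companion_fun w) j 0 0 * (companion_fun v r t * (\<Sum>s<k. mpow k (companion_fun v) (h - 1 - j) t s * (w s - v s))))"
      by (rule sum.swap)
    also have "\<dots> = (\<Sum>j<h. mpow k (companion_fun w) j 0 0 * (\<Sum>s<k. mpow k (companion_fun v) (Suc h - 1 - j) r s * (w s - v s)))"
    proof (rule sum.cong)
      fix j assume j: "j \<in> {..<h}"
      show "(\<Sum>t<k. mpow k (companion_fun w) j 0 0 * (companion_fun v r t * (\<Sum>s<k. mpow k (companion_fun v) (h - 1 - j) t s * (w s - v s))))
        = mpow k (companion_fun w) j 0 0 * (\<Sum>s<k. mpow k (companion_fun v) (Suc h - 1 - j) r s * (w s - v s))"
        unfolding sum_distrib_left[symmetric] using e[of j] j by simp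
    qed simp
    finally show ?thesis .
  qed
  finally show ?case using last by (simp del: mpow.simps add: mult.commute)
qed simp

section \<open>Iterating the autoregression\<close>

definition ar_coeff :: "nat \<Rightarrow> (nat \<Rightarrow> real) \<Rightarrow> nat \<Rightarrow> real" where
  "ar_coeff p a s = (if s < p then a (Suc s) else 0)"

lemma ar_coeff_sum:
  assumes "p \<le> k"
  shows "(\<Sum>i=1..p. a i * y (t + 1 - int i)) = (\<Sum>s<k. ar_coeff p a s * y (t - int s))"
proof -
  have "(\<Sum>i=1..p. a i * y (t + 1 - int i)) = (\<Sum>s<p. a (Suc s) * y (t - int s))"
    by (rule sum.reindex_bij_witness[of _ Suc "\<lambda>i. i - 1"]) (auto intro!: arg_cong[of _ _ y])
  also have "\<dots> = (\<Sum>s<k. ar_coeff p a s * y (t - int s))"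
    by (rule sum.mono_neutral_cong_left) (use assms in \<open>auto simp: ar_coeff_def\<close>)
  finally show ?thesis .
qed

text \<open>The state moves by the companion matrix plus new noise in its first component; each step
  back from the target exposes one noise, weighted by the corner entry of a power.\<close>

lemma ar_iterate:
  fixes y e :: "int \<Rightarrow> real"
  assumes y: "\<And>t. y (t + 1) = (\<Sum>i=1..p. a i * y (t + 1 - int i)) + e (t + 1)" and pk: "p \<le> k" and k: "0 < k"
  shows "y (t + int h) = (\<Sum>r<k. y (t - int r) * mpow k (companion_fun (ar_coeff p a)) h r 0)
    + (\<Sum>j<h. e (t + int h - int j) * mpow k (companion_fun (ar_coeff p a)) j 0 0)"
proof -
  define A where "A = companion_fun (ar_coeff p a)"
  \<comment> \<open>The noise-free forecast \<open>m\<close> steps ahead from time \<open>t\<close>;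
    moving its origin back from \<open>t + 1\<close> to \<open>t\<close> costs one multiple of
    \<open>e (t + 1)\<close>.\<close>
  define f where "f m t = (\<Sum>r<k. y (t - int r) * mpow k A m r 0)" for m t
  have step: "f m (t + 1) = f (Suc m) t + e (t + 1) * mpow k A m 0 0" for m t
  proof -
    have "f (Suc m) t = (\<Sum>r<k. y (t - int r) * (\<Sum>s<k. A r s * mpow k A m s 0))"
      unfolding f_def using k by (intro sum.cong refl) (simp add: mpow_Suc_left del: mpow.simps)
    also have "\<dots> = (\<Sum>r<k. \<Sum>s<k. (y (t - int r) * A r s) * mpow k A m s 0)"
      by (simp add: sum_distrib_left mult.assoc)
    also have "\<dots> = (\<Sum>s<k. \<Sum>r<k. (y (t - int r) * A r s) * mpow k A m s 0)" by (rule sum.swap)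
    also have "\<dots> = (\<Sum>s<k. (\<Sum>r<k. y (t - int r) * A r s) * mpow k A m s 0)"
      by (simp add: sum_distrib_right)
    also have "\<dots> = (\<Sum>s<k. (y (t + 1 - int s) - (if s = 0 then e (t + 1) else 0)) * mpow k A m s 0)"
    proof (rule sum.cong)
      fix s assume s: "s \<in> {..<k}"
      have "(\<Sum>r<k. y (t - int r) * A r s) = y (t + 1 - int s) - (if s = 0 then e (t + 1) else 0)"
      proof (cases "s = 0")
        case True
        then show ?thesis using y[of t] ar_coeff_sum[OF pk, of a y t] by (simp add: A_def companion_fun_def mult.commute)
      next
        case False
        have "(\<Sum>r<k. y (t - int r) * A r s) = (\<Sum>r<k. if s - 1 = r then y (t - int r) else 0)"
          by (rule sum.cong) (use False in \<open>auto simp: A_def companion_fun_def\<close>)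
        also have "\<dots> = y (t - int (s - 1))" using s False by (simp add: sum.delta)
        finally show ?thesis using False by (simp add: of_nat_diff algebra_simps)
      qed
      then show "(\<Sum>r<k. y (t - int r) * A r s) * mpow k A m s 0
          = (y (t + 1 - int s) - (if s = 0 then e (t + 1) else 0)) * mpow k A m s 0" by simp
    qed simp
    also have "\<dots> = (\<Sum>s<k. y (t + 1 - int s) * mpow k A m s 0 - (if 0 = s then e (t + 1) * mpow k A m s 0 else 0))"
      by (rule sum.cong) (simp_all add: left_diff_distrib)
    also have "\<dots> = f m (t + 1) - e (t + 1) * mpow k A m 0 0"
      using k by (simp add: sum_subtractf sum.delta f_def)
    finally show ?thesis by simp
  qed
  have "f 0 (t + int h) = f i (t + int h - int i) + (\<Sum>j<i. e (t + int h - int j) * mpow k A j 0 0)" for i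
  proof (induction i)
    case (Suc i)
    then show ?case using step[of i "t + int h - int i - 1"] by (simp add: algebra_simps del: mpow.simps)
  qed simp
  from this[of h] have "f 0 (t + int h) = f h t + (\<Sum>j<h. e (t + int h - int j) * mpow k A j 0 0)" by simp
  moreover have "f 0 (t + int h) = y (t + int h)"
  proof -
    have "f 0 (t + int h) = (\<Sum>r<k. if 0 = r then y (t + int h - int r) else 0)"
      unfolding f_def by (rule sum.cong) auto
    then show ?thesis using k by (simp add: sum.delta)
  qed
  ultimately show ?thesis by (simp add: f_def A_def)
qed

text \<open>Apply the previous lemma to the impulse response.\<close>

lemma mpow_ar_coeff:
  assumes pk: "p \<le> k" and k: "0 < k"
  shows "mpow k (companion_fun (ar_coeff p a)) j 0 0 = ma_coeff p a j"
proof -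
  define y where "y t = (if t < 0 then 0 else ma_coeff p a (nat t))" for t
  define e where "e t = (if t = 0 then 1 else 0 :: real)" for t :: int
  have y: "y (t + 1) = (\<Sum>i=1..p. a i * y (t + 1 - int i)) + e (t + 1)" for t
  proof (cases "t + 1 < 0")
    case False
    define n where "n = nat (t + 1)"
    have n: "t + 1 = int n" using False by (simp add: n_def)
    have "fps_nth (fps_of_poly (ar_poly p a) * Abs_fps (ma_coeff p a)) n = fps_nth 1 n" by (simp only: ma_coeff_mult)
    then have "(\<Sum>i\<le>n. coeff (ar_poly p a) i * ma_coeff p a (n - i)) = e (int n)"
      by (simp add: fps_mult_nth atLeast0AtMost e_def)
    moreover have "(\<Sum>i\<le>n. coeff (ar_poly p a) i * ma_coeff p a (n - i)) = (\<Sum>i\<le>n + p. coeff (ar_poly p a) i * y (int n - int i))"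
      by (rule sum.mono_neutral_cong_left) (auto simp: y_def nat_diff_distrib')
    moreover have "\<dots> = (\<Sum>i\<in>{0..p}. coeff (ar_poly p a) i * y (int n - int i))"
      by (rule sum.mono_neutral_right) (auto simp: coeff_ar_poly)
    moreover have "\<dots> = y (int n) + (\<Sum>i=1..p. coeff (ar_poly p a) i * y (int n - int i))"
      by (simp add: sum.atLeast_Suc_atMost[of 0 p] coeff_ar_poly)
    moreover have "(\<Sum>i=1..p. coeff (ar_poly p a) i * y (int n - int i)) = - (\<Sum>i=1..p. a i * y (int n - int i))"
      unfolding sum_negf[symmetric] by (intro sum.cong) (auto simp: coeff_ar_poly)
    ultimately show ?thesis unfolding n by simp
  qed (auto simp: y_def e_def intro!: sum.neutral)
  \<comment> \<open>Seen from the origin \<open>- 1\<close> the whole past is zero, and the only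
    nonzero noise sits at time 0, which picks \<open>i = j\<close>.\<close>
  have "y (- 1 + int (Suc j)) = (\<Sum>r<k. y (- 1 - int r) * mpow k (companion_fun (ar_coeff p a)) (Suc j) r 0)
    + (\<Sum>i<Suc j. e (- 1 + int (Suc j) - int i) * mpow k (companion_fun (ar_coeff p a)) i 0 0)"
    by (rule ar_iterate[OF y pk k])
  also have "(\<Sum>r<k. y (- 1 - int r) * mpow k (companion_fun (ar_coeff p a)) (Suc j) r 0) = 0"
    by (rule sum.neutral) (simp add: y_def)
  also have "(\<Sum>i<Suc j. e (- 1 + int (Suc j) - int i) * mpow k (companion_fun (ar_coeff p a)) i 0 0)
      = (\<Sum>i<Suc j. if j = i then mpow k (companion_fun (ar_coeff p a)) i 0 0 else 0)"
    by (rule sum.cong) (auto simp: e_def)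
  finally show ?thesis by (simp add: y_def sum.delta del: mpow.simps sum.lessThan_Suc)
qed

section \<open>Measurability and continuity of determinants and inverses\<close>

lemma det_measurable:
  assumes "\<And>\<omega>. A \<omega> \<in> carrier_mat n n" and "\<And>i j. i < n \<Longrightarrow> j < n \<Longrightarrow> (\<lambda>\<omega>. A \<omega> $$ (i, j)) \<in> borel_measurable N"
  shows "(\<lambda>\<omega>. Determinant.det (A \<omega>) :: real) \<in> borel_measurable N"
  unfolding det_def'[OF assms(1)]
proof (intro borel_measurable_sum borel_measurable_times borel_measurable_const borel_measurable_prod)
  fix q i assume "q \<in> {q. q permutes {0..<n}}" "i \<in> {0..<n}"
  then have "q i < n" using permutes_in_image[of q "{0..<n}" i] by auto
  then show "(\<lambda>\<omega>. A \<omega> $$ (i, q i)) \<in> borel_measurable N" using assms(2) \<open>i \<in> {0..<n}\<close> by auto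
qed

lemma det_tendsto:
  assumes "\<And>m. A m \<in> carrier_mat n n" "B \<in> carrier_mat n n"
    and "\<And>i j. i < n \<Longrightarrow> j < n \<Longrightarrow> (\<lambda>m. A m $$ (i, j)) \<longlonglongrightarrow> B $$ (i, j)"
  shows "(\<lambda>m. Determinant.det (A m) :: real) \<longlonglongrightarrow> Determinant.det B"
  unfolding det_def'[OF assms(1)] det_def'[OF assms(2)]
proof (intro tendsto_sum tendsto_mult tendsto_const tendsto_prod)
  fix q i assume "q \<in> {q. q permutes {0..<n}}" "i \<in> {0..<n}"
  then have "q i < n" using permutes_in_image[of q "{0..<n}" i] by auto
  then show "(\<lambda>m. A m $$ (i, q i)) \<longlonglongrightarrow> B $$ (i, q i)" using assms(3) \<open>i \<in> {0..<n}\<close> by auto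
qed

lemma mat_delete_entry:
  assumes "A \<in> carrier_mat n n" "i' < n - 1" "j' < n - 1"
  shows "mat_delete A i j $$ (i', j') = A $$ (if i' < i then i' else Suc i', if j' < j then j' else Suc j')"
  using assms by (simp add: mat_delete_def)

lemma adj_mat_index:
  assumes "A \<in> carrier_mat n n" "i < n" "j < n"
  shows "adj_mat A $$ (i, j) = (- 1) ^ (j + i) * Determinant.det (mat_delete A j i)"
  using assms by (simp add: adj_mat_def Determinant.cofactor_def)

lemma adj_mat_measurable:
  assumes A: "\<And>\<omega>. A \<omega> \<in> carrier_mat n n" and m: "\<And>i j. i < n \<Longrightarrow> j < n \<Longrightarrow> (\<lambda>\<omega>. A \<omega> $$ (i, j)) \<in> borel_measurable N"
    and ij: "i < n" "j < n"
  shows "(\<lambda>\<omega>. adj_mat (A \<omega>) $$ (i, j) :: real) \<in> borel_measurable N"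
  unfolding adj_mat_index[OF A ij]
proof (intro borel_measurable_times borel_measurable_const)
  show "(\<lambda>\<omega>. Determinant.det (mat_delete (A \<omega>) j i)) \<in> borel_measurable N"
  proof (rule det_measurable[of _ "n - 1"])
    show "mat_delete (A \<omega>) j i \<in> carrier_mat (n - 1) (n - 1)" for \<omega> by (rule mat_delete_carrier[OF A])
    show "(\<lambda>\<omega>. mat_delete (A \<omega>) j i $$ (i', j')) \<in> borel_measurable N" if "i' < n - 1" "j' < n - 1" for i' j'
      unfolding mat_delete_entry[OF A that] by (rule m) (use that in auto)
  qed
qed

lemma adj_mat_tendsto:
  assumes A: "\<And>m. A m \<in> carrier_mat n n" and B: "B \<in> carrier_mat n n"
    and lim: "\<And>i j. i < n \<Longrightarrow> j < n \<Longrightarrow> (\<lambda>m. A m $$ (i, j)) \<longlonglongrightarrow> B $$ (i, j)"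
    and ij: "i < n" "j < n"
  shows "(\<lambda>m. adj_mat (A m) $$ (i, j) :: real) \<longlonglongrightarrow> adj_mat B $$ (i, j)"
  unfolding adj_mat_index[OF A ij] adj_mat_index[OF B ij]
proof (intro tendsto_mult tendsto_const)
  show "(\<lambda>m. Determinant.det (mat_delete (A m) j i)) \<longlonglongrightarrow> Determinant.det (mat_delete B j i)"
  proof (rule det_tendsto[of _ "n - 1"])
    show "mat_delete (A m) j i \<in> carrier_mat (n - 1) (n - 1)" for m by (rule mat_delete_carrier[OF A])
    show "mat_delete B j i \<in> carrier_mat (n - 1) (n - 1)" by (rule mat_delete_carrier[OF B])
    show "(\<lambda>m. mat_delete (A m) j i $$ (i', j')) \<longlonglongrightarrow> mat_delete B j i $$ (i', j')" if "i' < n - 1" "j' < n - 1" for i' j'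
      unfolding mat_delete_entry[OF A that] mat_delete_entry[OF B that] by (rule lim) (use that in auto)
  qed
qed

lemma mpow_measurable:
  assumes A: "\<And>r s. r < k \<Longrightarrow> s < k \<Longrightarrow> (\<lambda>\<omega>. A \<omega> r s) \<in> borel_measurable N" and "r < k" "s < k"
  shows "(\<lambda>\<omega>. mpow k (A \<omega>) m r s) \<in> borel_measurable N"
  using assms(3)
proof (induction m arbitrary: s)
  case (Suc m)
  then show ?case by (auto intro!: borel_measurable_sum borel_measurable_times A)
qed simp

lemma mpow_tendsto:
  assumes A: "\<And>r s. r < k \<Longrightarrow> s < k \<Longrightarrow> (\<lambda>n. A n r s) \<longlonglongrightarrow> B r s" and "r < k" "s < k"
  shows "(\<lambda>n. mpow k (A n) m r s) \<longlonglongrightarrow> mpow k B m r s"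
  using assms(3)
proof (induction m arbitrary: s)
  case (Suc m)
  then show ?case by (auto intro!: tendsto_sum tendsto_mult A)
qed simp

text \<open>The inverse as adjugate over determinant, which is a total and measurable function of the entries.\<close>

definition minv :: "real Matrix.mat \<Rightarrow> nat \<Rightarrow> nat \<Rightarrow> real" where
  "minv A r s = adj_mat A $$ (r, s) / Determinant.det A"

lemma minv_left:
  assumes A: "A \<in> carrier_mat n n" and d: "Determinant.det A \<noteq> 0" and rs: "r < n" "s < n"
  shows "(\<Sum>t<n. minv A r t * A $$ (t, s)) = (if r = s then 1 else 0)"
proof -
  have "(adj_mat A * A) $$ (r, s) = (Determinant.det A \<cdot>\<^sub>m 1\<^sub>m n) $$ (r, s)" by (simp only: adj_mat(3)[OF A])
  moreover have "(adj_mat A * A) $$ (r, s) = (\<Sum>t<n. adj_mat A $$ (r, t) * A $$ (t, s))"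
    using A adj_mat(1)[OF A] rs by (simp add: scalar_prod_def atLeast0LessThan)
  ultimately have "(\<Sum>t<n. adj_mat A $$ (r, t) * A $$ (t, s)) = (if r = s then Determinant.det A else 0)"
    using rs by simp
  then show ?thesis using d by (simp add: minv_def sum_divide_distrib[symmetric])
qed

lemma minv_right:
  assumes A: "A \<in> carrier_mat n n" and d: "Determinant.det A \<noteq> 0" and rs: "r < n" "s < n"
  shows "(\<Sum>t<n. A $$ (r, t) * minv A t s) = (if r = s then 1 else 0)"
proof -
  have "(A * adj_mat A) $$ (r, s) = (Determinant.det A \<cdot>\<^sub>m 1\<^sub>m n) $$ (r, s)" by (simp only: adj_mat(2)[OF A])
  moreover have "(A * adj_mat A) $$ (r, s) = (\<Sum>t<n. A $$ (r, t) * adj_mat A $$ (t, s))"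
    using A adj_mat(1)[OF A] rs by (simp add: scalar_prod_def atLeast0LessThan)
  ultimately have "(\<Sum>t<n. A $$ (r, t) * adj_mat A $$ (t, s)) = (if r = s then Determinant.det A else 0)"
    using rs by simp
  then show ?thesis using d by (simp add: minv_def sum_divide_distrib[symmetric])
qed

lemma minv_solve:
  assumes A: "A \<in> carrier_mat n n" and d: "Determinant.det A \<noteq> 0" and r: "r < n"
    and v: "\<And>t. t < n \<Longrightarrow> (\<Sum>s<n. A $$ (t, s) * v s) = g t"
  shows "v r = (\<Sum>t<n. minv A r t * g t)"
proof -
  have "(\<Sum>t<n. minv A r t * g t) = (\<Sum>t<n. \<Sum>s<n. minv A r t * A $$ (t, s) * v s)"
    by (rule sum.cong) (simp_all add: v[symmetric] sum_distrib_left mult.assoc)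
  also have "\<dots> = (\<Sum>s<n. \<Sum>t<n. minv A r t * A $$ (t, s) * v s)" by (rule sum.swap)
  also have "\<dots> = (\<Sum>s<n. if r = s then v s else 0)"
    by (rule sum.cong) (use r in \<open>simp_all add: sum_distrib_right[symmetric] minv_left[OF A d]\<close>)
  also have "\<dots> = v r" using r by (simp add: sum.delta)
  finally show ?thesis ..
qed

text \<open>A two-sided inverse makes the matrix a unit, so the Gauss-Jordan inverse succeeds;
  uniqueness of inverses identifies the two.\<close>

lemma mat_inverse_index:
  assumes A: "A \<in> carrier_mat n n" and d: "Determinant.det A \<noteq> 0"
  shows "the (mat_inverse A) \<in> carrier_mat n n \<and>
    (\<forall>r<n. \<forall>s<n. the (mat_inverse A) $$ (r, s) = minv A r s)"
proof -
  define C where "C = Matrix.mat n n (\<lambda>(r, s). minv A r s)"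
  have C: "C \<in> carrier_mat n n" by (simp add: C_def)
  have AC: "A * C = 1\<^sub>m n"
    by (rule eq_matI) (use A in \<open>simp_all add: C_def scalar_prod_def atLeast0LessThan minv_right[OF A d]\<close>)
  have CA: "C * A = 1\<^sub>m n"
    by (rule eq_matI) (use A in \<open>simp_all add: C_def scalar_prod_def atLeast0LessThan minv_left[OF A d]\<close>)
  have "A \<in> Units (ring_mat TYPE(real) n ())"
    unfolding Units_def ring_mat_def using A C AC CA by auto
  then obtain B where B: "mat_inverse A = Some B"
    using mat_inverse(1)[OF A] by fastforce
  then have B': "A * B = 1\<^sub>m n" "B * A = 1\<^sub>m n" "B \<in> carrier_mat n n" using mat_inverse(2)[OF A] by auto
  have "B = B * (A * C)" using B'(3) by (simp add: AC)
  also have "\<dots> = (B * A) * C" using A B'(3) C by (simp add: assoc_mult_mat[of _ n n _ n _ n])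
  also have "\<dots> = C" using C by (simp add: B')
  finally have "B = C" .
  then show ?thesis using B C by (simp add: C_def)
qed

section \<open>Plug-in prediction\<close>

lemma mult_mat_index:
  assumes "A \<in> carrier_mat k k" "B \<in> carrier_mat k k" "i < k" "j < k"
  shows "(A * B) $$ (i, j) = (\<Sum>t<k. A $$ (i, t) * B $$ (t, j))"
  using assms by (simp add: scalar_prod_def atLeast0LessThan)

lemma sum_int_shift: "(\<Sum>j\<in>{int k..int (k + N) - 1}. f j) = (\<Sum>i<N. f (int k + int i))"
  by (rule sum.reindex_bij_witness[of _ "\<lambda>i. int k + int i" "\<lambda>j. nat (j - int k)"]) auto

section \<open>Harmonic numbers and the logarithm\<close>

lemma hsum_eq_harm: "hsum n = harm n"
proof -
  have "(\<Sum>i<n. 1 / real (Suc i)) = (\<Sum>i=1..n. inverse (real i))"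
    by (rule sum.reindex_bij_witness[of _ "\<lambda>i. i - 1" Suc]) (auto simp: inverse_eq_divide)
  then show ?thesis by (simp add: hsum_def harm_def)
qed

lemma hsum_over_ln: "(\<lambda>n. hsum n / ln (real n)) \<longlonglongrightarrow> 1"
proof -
  have "filterlim (\<lambda>n. ln (real n)) at_top sequentially" by real_asymp
  then have "(\<lambda>n. (harm n - ln (real n)) / ln (real n)) \<longlonglongrightarrow> 0"
    by (rule real_tendsto_divide_at_top[OF euler_mascheroni_LIMSEQ])
  then have "(\<lambda>n. (harm n - ln (real n)) / ln (real n) + 1) \<longlonglongrightarrow> 0 + 1" by (intro tendsto_add tendsto_const)
  moreover have "eventually (\<lambda>n. (harm n - ln (real n)) / ln (real n) + 1 = hsum n / ln (real n)) sequentially"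
    using eventually_ge_at_top[of 2] by eventually_elim (simp add: hsum_eq_harm diff_divide_distrib)
  ultimately show ?thesis by (auto intro: Lim_transform_eventually)
qed

lemma hsum_at_top: "filterlim hsum at_top sequentially"
proof -
  have "filterlim (\<lambda>n. hsum n / ln (real n) * ln (real n)) at_top sequentially"
    by (rule filterlim_tendsto_pos_mult_at_top[OF hsum_over_ln]) (simp, real_asymp)
  moreover have "eventually (\<lambda>n. hsum n / ln (real n) * ln (real n) = hsum n) sequentially"
    using eventually_ge_at_top[of 2] by eventually_elim simp
  ultimately show ?thesis by (rule filterlim_cong[THEN iffD1, OF refl refl, rotated])
qed

text \<open>Passes from the regression index \<open>N\<close> and the scale \<open>hsum\<close> to
  the prediction index \<open>i = k + N\<close> and \<open>ln n\<close>. The lower limit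
  \<open>m\<close> and the terms before \<open>N0\<close> change the sum by a constant only.\<close>

lemma log_asymptotics:
  fixes g w :: "nat \<Rightarrow> real"
  assumes gw: "\<And>N. N0 \<le> N \<Longrightarrow> g (k + N) = w N" and k: "0 < k" and h: "0 < h"
    and w: "negl (\<lambda>n. (\<Sum>N<n. w N) - f * hsum n) hsum"
  shows "(\<lambda>n. (\<Sum>i\<in>{m..n - h}. g i) - f * ln (real n)) \<in> o(\<lambda>n. ln (real n))"
proof (rule smalloI_tendsto)
  \<comment> \<open>With \<open>n = M + c\<close> the upper limit \<open>n - h\<close> is
    \<open>k + (M - 1)\<close>, the image of the last index below \<open>M\<close>.\<close>
  define c where "c = h + k - 1"
  define R where "R n = (\<Sum>N<n. w N) - f * hsum n" for n
  \<comment> \<open>Past \<open>M0\<close> both sums gain the same term at each step, so their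
    difference is constant.\<close>
  define u where "u M = (\<Sum>i\<in>{m..M + (k - 1)}. g i) - (\<Sum>N<M. w N)" for M
  define M0 where "M0 = N0 + m"
  have step: "u (Suc M) = u M" if "M0 \<le> M" for M
  proof -
    have "m \<le> Suc (M + (k - 1))" using that by (simp add: M0_def)
    then have "(\<Sum>i\<in>{m..Suc M + (k - 1)}. g i) = (\<Sum>i\<in>{m..M + (k - 1)}. g i) + g (Suc M + (k - 1))"
      by simp
    moreover have "g (Suc M + (k - 1)) = w M" using gw[of M] that k by (simp add: M0_def add.commute)
    ultimately show ?thesis by (simp add: u_def)
  qed
  have const: "u M = u M0" if "M0 \<le> M" for M
    using that by (induction M rule: dec_induct) (simp_all add: step)
  have R0: "(\<lambda>n. R n / hsum n) \<longlonglongrightarrow> 0"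
    unfolding R_def by (rule negl_imp_tendsto_zero[OF w hsum_at_top])
  have l1: "(\<lambda>M. ln (real M + real c) / ln (real M)) \<longlonglongrightarrow> 1" by real_asymp
  have l2: "(\<lambda>M. ln (real M) / ln (real M + real c)) \<longlonglongrightarrow> 1" by real_asymp
  have l3: "(\<lambda>M. u M0 / ln (real M)) \<longlonglongrightarrow> 0" by real_asymp
  have "(\<lambda>M. (u M0 / ln (real M) + R M / hsum M * (hsum M / ln (real M)) + f * (hsum M / ln (real M))
      - f * (ln (real M + real c) / ln (real M))) * (ln (real M) / ln (real M + real c))) \<longlonglongrightarrow> (0 + 0 * 1 + f * 1 - f * 1) * 1"
    by (intro tendsto_mult tendsto_add tendsto_diff tendsto_const l1 l2 l3 R0 hsum_over_ln)
  moreover have "eventually (\<lambda>M. (u M0 / ln (real M) + R M / hsum M * (hsum M / ln (real M)) + f * (hsum M / ln (real M))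
      - f * (ln (real M + real c) / ln (real M))) * (ln (real M) / ln (real M + real c))
      = ((\<Sum>i\<in>{m..M + c - h}. g i) - f * ln (real (M + c))) / ln (real (M + c))) sequentially"
    using eventually_ge_at_top[of "M0 + 2"]
  proof eventually_elim
    case (elim M)
    have l: "ln (real M) > 0" using elim by simp
    have "hsum 1 \<le> hsum M" by (rule hsum_mono) (use elim in simp)
    then have hs: "hsum M > 0" by (simp add: hsum_def)
    have "M + c - h = M + (k - 1)" using k h by (simp add: c_def)
    then have "(\<Sum>i\<in>{m..M + c - h}. g i) = u M0 + R M + f * hsum M"
      using const[of M] elim by (simp add: u_def[of M] R_def)
    moreover have "R M / hsum M * (hsum M / ln (real M)) = R M / ln (real M)" using hs by simp
    ultimately show ?case using l by (simp add: add_divide_distrib[symmetric] diff_divide_distrib[symmetric])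
  qed
  ultimately have "(\<lambda>M. ((\<Sum>i\<in>{m..M + c - h}. g i) - f * ln (real (M + c))) / ln (real (M + c))) \<longlonglongrightarrow> 0"
    by (auto intro: Lim_transform_eventually)
  then show "(\<lambda>n. ((\<Sum>i\<in>{m..n - h}. g i) - f * ln (real n)) / ln (real n)) \<longlonglongrightarrow> 0"
    by (rule LIMSEQ_offset)
  show "eventually (\<lambda>n. ln (real n) \<noteq> 0) sequentially"
    using eventually_ge_at_top[of 2] by eventually_elim simp
qed

section \<open>The fitted model on samples of size \<open>k + N\<close>\<close>

locale ar_fit = ar_process +
  fixes k :: nat
  assumes pk: "p \<le> k" and k0: "0 < k"
begin

text \<open>The sample of size \<open>k + n\<close> provides \<open>n\<close> regressor vectors, so the time index is shifted by \<open>k\<close>.\<close>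

text \<open>For all but finitely many \<open>n\<close>, \<open>dl\<close> is the error of the least squares coefficients, \<open>bh\<close> the impulse
  response of the fitted model, and \<open>U\<close> the amount by which the predictor misses the best predictor.
  They are defined by total formulas so as to be measurable.\<close>

definition X where "X r i \<omega> = xF (int k + int i - int r) \<omega>"
definition E where "E i \<omega> = \<epsilon> (int k + int i + 1) \<omega>"
definition S where "S r n \<omega> = (\<Sum>i<n. X r i \<omega> * E i \<omega>)"
definition D where "D r s n \<omega> = (\<Sum>i<n. X r i \<omega> * X s i \<omega> - gmat r s)"
definition Gm where "Gm n \<omega> = Matrix.mat k k (\<lambda>(r, s). (\<Sum>i<n. X r i \<omega> * X s i \<omega>) / real n)"
definition dl where "dl n \<omega> s = (\<Sum>t<k. minv (Gm n \<omega>) s t * (S t n \<omega> / real n))"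
definition ac where "ac = ar_coeff p a"
definition bh where "bh j n \<omega> = mpow k (companion_fun (\<lambda>s. ac s + dl n \<omega> s)) j 0 0"
text \<open>The random counterpart of \<open>L Gamma^-1\<close>. Pairing the fitted impulse response
  \<open>bh\<close> with powers of the true companion matrix makes the decomposition of the error
  exact.\<close>

definition Hc where "Hc h r t n \<omega> = (\<Sum>j<h. bh j n \<omega> * (\<Sum>s<k. mpow k (companion_fun ac) (h - 1 - j) r s * minv (Gm n \<omega>) s t))"
definition U where "U h n \<omega> = (\<Sum>r<k. \<Sum>t<k. Hc h r t n \<omega> * X r n \<omega> * S t n \<omega> / real n)"

lemma X_measurable: "i \<le> n \<Longrightarrow> X r i \<in> borel_measurable (F (int k + int n))"
  unfolding X_def[abs_def] by (rule F_measurable_mono[OF xF_measurable]) simp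

lemma S_measurable: "S r n \<in> borel_measurable (F (int k + int n))"
  unfolding S_def[abs_def]
proof (intro borel_measurable_sum borel_measurable_times)
  fix i assume i: "i \<in> {..<n}"
  then show "X r i \<in> borel_measurable (F (int k + int n))" by (intro X_measurable) simp
  show "E i \<in> borel_measurable (F (int k + int n))"
    unfolding E_def[abs_def] by (rule F_measurable_mono[OF eps_measurable]) (use i in simp)
qed

lemma D_measurable: "D r s (Suc n) \<in> borel_measurable (F (int k + int n))"
  unfolding D_def[abs_def]
  by (intro borel_measurable_sum borel_measurable_diff borel_measurable_times borel_measurable_const X_measurable) auto

lemma Gm_carrier: "Gm n \<omega> \<in> carrier_mat k k" by (simp add: Gm_def)

lemma Gm_measurable:
  assumes "r < k" "s < k"
  shows "(\<lambda>\<omega>. Gm n \<omega> $$ (r, s)) \<in> borel_measurable (F (int k + int n))"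
proof -
  have "(\<lambda>\<omega>. (\<Sum>i<n. X r i \<omega> * X s i \<omega>) / real n) \<in> borel_measurable (F (int k + int n))"
    by (intro borel_measurable_divide borel_measurable_sum borel_measurable_times borel_measurable_const X_measurable) auto
  then show ?thesis using assms by (simp add: Gm_def)
qed

lemma minv_measurable:
  assumes "r < k" "s < k"
  shows "(\<lambda>\<omega>. minv (Gm n \<omega>) r s) \<in> borel_measurable (F (int k + int n))"
  unfolding minv_def
  by (intro borel_measurable_divide adj_mat_measurable[OF Gm_carrier Gm_measurable assms]
      det_measurable[OF Gm_carrier Gm_measurable])

lemma bh_measurable: "bh j n \<in> borel_measurable (F (int k + int n))"
proof -
  have dl: "(\<lambda>\<omega>. dl n \<omega> s) \<in> borel_measurable (F (int k + int n))" if "s < k" for s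
    unfolding dl_def using that
    by (intro borel_measurable_sum borel_measurable_times borel_measurable_divide borel_measurable_const
        minv_measurable S_measurable) auto
  show ?thesis unfolding bh_def[abs_def]
  proof (rule mpow_measurable)
    show "(\<lambda>\<omega>. companion_fun (\<lambda>s. ac s + dl n \<omega> s) r s) \<in> borel_measurable (F (int k + int n))" if "r < k" "s < k" for r s
      unfolding companion_fun_def using dl[OF that(1)] by (cases "s = 0") simp_all
  qed (use k0 in auto)
qed

lemma U_measurable: "U h n \<in> borel_measurable (F (int k + int n))"
  unfolding U_def[abs_def] Hc_def
  by (intro borel_measurable_sum borel_measurable_times borel_measurable_divide borel_measurable_const
      bh_measurable minv_measurable S_measurable X_measurable) auto

lemma second_moments_AE:
  "AE \<omega> in M. \<forall>r<k. \<forall>s<k. (\<lambda>n. (\<Sum>i<n. X r i \<omega> * X s i \<omega>) / real n) \<longlonglongrightarrow> gmat r s"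
  using sample_covariance x_eq_xF
proof eventually_elim
  case (elim \<omega>)
  have le: "(\<lambda>n. (\<Sum>i<n. X r i \<omega> * X s i \<omega>) / real n) \<longlonglongrightarrow> gmat r s" if "s \<le> r" "r < k" for r s
  proof -
    have "(\<lambda>n. (\<Sum>t<n. x (int t) \<omega> * x (int (t + (r - s))) \<omega>) / real n) \<longlonglongrightarrow> gam (r - s)"
      using elim(1) by blast
    \<comment> \<open>The shift by \<open>k - r\<close> aligns averages that start at time 0 with
      the regressors, whose time starts at \<open>k\<close>.\<close>
    from average_advance[OF this, of "k - r"]
    have "(\<lambda>n. (\<Sum>t<n. x (int (t + (k - r))) \<omega> * x (int (t + (k - r) + (r - s))) \<omega>) / real n) \<longlonglongrightarrow> gam (r - s)" .
    moreover have "x (int (t + (k - r))) \<omega> * x (int (t + (k - r) + (r - s))) \<omega> = X r t \<omega> * X s t \<omega>" for t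
      using elim(2) that by (simp add: X_def of_nat_diff algebra_simps)
    moreover have "gmat r s = gam (r - s)" using that by (simp add: gmat_def nat_diff_distrib')
    ultimately show ?thesis by simp
  qed
  have sym: "gmat r s = gmat s r" for r s by (simp add: gmat_def abs_minus_commute)
  show ?case
  proof (intro allI impI)
    fix r s assume rs: "r < k" "s < k"
    show "(\<lambda>n. (\<Sum>i<n. X r i \<omega> * X s i \<omega>) / real n) \<longlonglongrightarrow> gmat r s"
    proof (cases "s \<le> r")
      case False
      then have "(\<lambda>n. (\<Sum>i<n. X s i \<omega> * X r i \<omega>) / real n) \<longlonglongrightarrow> gmat s r" using le[of r s] rs by simp
      then show ?thesis by (simp add: sym[of r s] mult.commute[of "X s _ \<omega>"])
    qed (use le rs in simp)
  qed
qed

text \<open>The path bound on the weights: one squared regressor over \<open>Suc i\<close> is at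
  most the average of all squares up to it, and these averages converge.\<close>

lemma noise_square_AE:
  "AE \<omega> in M. \<forall>r<k. \<forall>s<k. negl (\<lambda>n. \<Sum>i<n. X r i \<omega> * X s i \<omega> / real (Suc i) * ((E i \<omega>)\<^sup>2 - \<sigma>\<^sup>2))
     (\<lambda>n. \<Sum>i<n. \<bar>X r i \<omega> * X s i \<omega> / real (Suc i)\<bar>)"
proof -
  have "AE \<omega> in M. negl (\<lambda>n. \<Sum>i<n. X r i \<omega> * X s i \<omega> / real (Suc i) * ((E i \<omega>)\<^sup>2 - \<sigma>\<^sup>2))
     (\<lambda>n. \<Sum>i<n. \<bar>X r i \<omega> * X s i \<omega> / real (Suc i)\<bar>)" if rs: "r < k" "s < k" for r s
    unfolding E_def
  proof (rule noise_square_negl)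
    show "(\<lambda>\<omega>. X r i \<omega> * X s i \<omega> / real (Suc i)) \<in> borel_measurable (F (int k + int i))" for i
      by (intro borel_measurable_divide borel_measurable_times borel_measurable_const X_measurable) simp_all
    show "AE \<omega> in M. \<exists>K. \<forall>i. \<bar>X r i \<omega> * X s i \<omega> / real (Suc i)\<bar> \<le> K"
      using second_moments_AE
    proof eventually_elim
      case (elim \<omega>)
      have bd: "\<exists>K. \<forall>i. (X r i \<omega>)\<^sup>2 / real (Suc i) \<le> K" if "r < k" for r
      proof -
        have "(\<lambda>n. (\<Sum>i<n. X r i \<omega> * X r i \<omega>) / real n) \<longlonglongrightarrow> gmat r r" using elim that by blast
        then obtain K where K: "\<And>n. (\<Sum>i<n. X r i \<omega> * X r i \<omega>) / real n \<le> K" using tendsto_abs_bound by blast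
        have "(X r i \<omega>)\<^sup>2 / real (Suc i) \<le> K" for i
        proof -
          have "(X r i \<omega>)\<^sup>2 \<le> (\<Sum>j<Suc i. X r j \<omega> * X r j \<omega>)"
            by (simp add: power2_eq_square sum_nonneg)
          then have "(X r i \<omega>)\<^sup>2 / real (Suc i) \<le> (\<Sum>j<Suc i. X r j \<omega> * X r j \<omega>) / real (Suc i)"
            by (rule divide_right_mono) simp
          also have "\<dots> \<le> K" by (rule K)
          finally show ?thesis .
        qed
        then show ?thesis by blast
      qed
      obtain K where K: "\<And>i. (X r i \<omega>)\<^sup>2 / real (Suc i) \<le> K" using bd[OF rs(1)] by blast
      obtain K' where K': "\<And>i. (X s i \<omega>)\<^sup>2 / real (Suc i) \<le> K'" using bd[OF rs(2)] by blast
      have "\<bar>X r i \<omega> * X s i \<omega> / real (Suc i)\<bar> \<le> K + K'" for i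
      proof -
        have "\<bar>X r i \<omega> * X s i \<omega> / real (Suc i)\<bar> \<le> ((X r i \<omega>)\<^sup>2 + (X s i \<omega>)\<^sup>2) / real (Suc i)"
          using abs_mult_le_sum_squares[of "X r i \<omega>" "X s i \<omega>"] by (simp add: divide_right_mono)
        then show ?thesis using K[of i] K'[of i] by (simp add: add_divide_distrib)
      qed
      then show ?case by blast
    qed
  qed
  then have "AE \<omega> in M. r < k \<longrightarrow> s < k \<longrightarrow> negl (\<lambda>n. \<Sum>i<n. X r i \<omega> * X s i \<omega> / real (Suc i) * ((E i \<omega>)\<^sup>2 - \<sigma>\<^sup>2))
     (\<lambda>n. \<Sum>i<n. \<bar>X r i \<omega> * X s i \<omega> / real (Suc i)\<bar>)" for r s
    by (cases "r < k \<and> s < k") auto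
  then have "AE \<omega> in M. \<forall>r s. r < k \<longrightarrow> s < k \<longrightarrow> negl (\<lambda>n. \<Sum>i<n. X r i \<omega> * X s i \<omega> / real (Suc i) * ((E i \<omega>)\<^sup>2 - \<sigma>\<^sup>2))
     (\<lambda>n. \<Sum>i<n. \<bar>X r i \<omega> * X s i \<omega> / real (Suc i)\<bar>)"
    unfolding AE_all_countable by blast
  then show ?thesis by eventually_elim blast
qed

lemma noise_1_AE:
  "AE \<omega> in M. \<forall>r s. negl (\<lambda>n. \<Sum>i<n. S r i \<omega> * X s i \<omega> / real (Suc i) * E i \<omega>)
     (\<lambda>n. \<Sum>i<n. (S r i \<omega> * X s i \<omega> / real (Suc i))\<^sup>2)"
  unfolding AE_all_countable E_def
  by (intro allI noise_transform_negl borel_measurable_divide borel_measurable_times borel_measurable_const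
      S_measurable X_measurable order_refl)

lemma noise_2_AE:
  "AE \<omega> in M. \<forall>r s u v. negl (\<lambda>n. \<Sum>i<n. D r s (Suc i) \<omega> * S u i \<omega> * X v i \<omega> / (real (Suc (Suc i)))\<^sup>2 * E i \<omega>)
     (\<lambda>n. \<Sum>i<n. (D r s (Suc i) \<omega> * S u i \<omega> * X v i \<omega> / (real (Suc (Suc i)))\<^sup>2)\<^sup>2)"
  unfolding AE_all_countable E_def
  by (intro allI noise_transform_negl borel_measurable_divide borel_measurable_times borel_measurable_const
      S_measurable X_measurable D_measurable order_refl)

text \<open>The score is negligible against its variation, which is of order \<open>n\<close>; this
  yields consistency of the coefficients.\<close>

lemma S_average_AE: "AE \<omega> in M. \<forall>r<k. (\<lambda>n. S r n \<omega> / real n) \<longlonglongrightarrow> 0"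
proof -
  have "AE \<omega> in M. \<forall>r. negl (\<lambda>n. \<Sum>i<n. X r i \<omega> * E i \<omega>) (\<lambda>n. \<Sum>i<n. (X r i \<omega>)\<^sup>2)"
    unfolding AE_all_countable E_def by (intro allI noise_transform_negl X_measurable order_refl)
  then show ?thesis using second_moments_AE
  proof eventually_elim
    case (elim \<omega>)
    show ?case
    proof (intro allI impI)
      fix r assume r: "r < k"
      have "(\<lambda>n. (\<Sum>i<n. X r i \<omega> * X r i \<omega>) / real n) \<longlonglongrightarrow> gmat r r" using elim(2) r by blast
      then obtain K where K: "0 < K" "\<And>n. (\<Sum>i<n. X r i \<omega> * X r i \<omega>) / real n \<le> K"
        using tendsto_abs_bound by blast
      have le: "(\<Sum>i<n. (X r i \<omega>)\<^sup>2) \<le> K * real n + 0" for n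
      proof (cases "n = 0")
        case False
        then show ?thesis using K(2)[of n] by (simp add: divide_le_eq power2_eq_square)
      qed simp
      have "negl (\<lambda>n. S r n \<omega>) real"
        unfolding S_def by (rule negl_mono[OF elim(1)[rule_format] le K(1)])
      then show "(\<lambda>n. S r n \<omega> / real n) \<longlonglongrightarrow> 0"
        by (rule negl_imp_tendsto_zero) (rule filterlim_real_sequentially)
    qed
  qed
qed

lemma regression_path_AE:
  "AE \<omega> in M. regression_path k (\<lambda>r i. X r i \<omega>) (\<lambda>i. E i \<omega>) gmat (\<sigma>\<^sup>2) (\<lambda>r n. S r n \<omega>) (\<lambda>r s n. D r s n \<omega>)"
  using second_moments_AE noise_square_AE noise_1_AE noise_2_AE
proof eventually_elim
  case (elim \<omega>)
  show ?case
    by unfold_locales (use elim in \<open>simp_all add: S_def D_def\<close>)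
qed

text \<open>The multistep noises of neighbouring times overlap, so they are not martingale
  differences. Split by \<open>j\<close>, each term pairs \<open>U h N\<close> with a single noise
  later than \<open>k + N\<close>, which is a transform for a shifted filtration.\<close>

lemma cross_AE:
  "AE \<omega> in M. negl (\<lambda>n. \<Sum>N<n. U h N \<omega> * multistep_noise p a (\<lambda>t. \<epsilon> t \<omega>) (int (k + N)) h) (\<lambda>n. \<Sum>N<n. (U h N \<omega>)\<^sup>2)"
proof -
  have "AE \<omega> in M. \<forall>j. j < h \<longrightarrow> negl (\<lambda>n. \<Sum>N<n. U h N \<omega> * \<epsilon> (int (k + N) + int h - int j) \<omega>) (\<lambda>n. \<Sum>N<n. (U h N \<omega>)\<^sup>2)"
    unfolding AE_all_countable
  proof
    fix j
    show "AE \<omega> in M. j < h \<longrightarrow> negl (\<lambda>n. \<Sum>N<n. U h N \<omega> * \<epsilon> (int (k + N) + int h - int j) \<omega>) (\<lambda>n. \<Sum>N<n. (U h N \<omega>)\<^sup>2)"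
    proof (cases "j < h")
      case True
      define t where "t = int k + int h - int j - 1"
      have "AE \<omega> in M. negl (\<lambda>n. \<Sum>N<n. U h N \<omega> * \<epsilon> (t + int N + 1) \<omega>) (\<lambda>n. \<Sum>N<n. (U h N \<omega>)\<^sup>2)"
        by (rule noise_transform_negl, rule F_measurable_mono[OF U_measurable]) (use True in \<open>simp add: t_def\<close>)
      moreover have "t + int N + 1 = int (k + N) + int h - int j" for N by (simp add: t_def)
      ultimately show ?thesis by simp
    qed simp
  qed
  then show ?thesis
  proof eventually_elim
    case (elim \<omega>)
    have "negl (\<lambda>n. \<Sum>j<h. ma_coeff p a j * (\<Sum>N<n. U h N \<omega> * \<epsilon> (int (k + N) + int h - int j) \<omega>)) (\<lambda>n. \<Sum>N<n. (U h N \<omega>)\<^sup>2)"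
      by (rule negl_sum) (use elim in \<open>auto intro!: negl_cmult sum_nonneg\<close>)
    moreover have "(\<Sum>j<h. ma_coeff p a j * (\<Sum>N<n. U h N \<omega> * \<epsilon> (int (k + N) + int h - int j) \<omega>))
        = (\<Sum>N<n. U h N \<omega> * multistep_noise p a (\<lambda>t. \<epsilon> t \<omega>) (int (k + N)) h)" for n
    proof -
      have "(\<Sum>j<h. ma_coeff p a j * (\<Sum>N<n. U h N \<omega> * \<epsilon> (int (k + N) + int h - int j) \<omega>))
         = (\<Sum>j<h. \<Sum>N<n. U h N \<omega> * (ma_coeff p a j * \<epsilon> (int (k + N) + int h - int j) \<omega>))"
        by (simp add: sum_distrib_left mult_ac)
      also have "\<dots> = (\<Sum>N<n. \<Sum>j<h. U h N \<omega> * (ma_coeff p a j * \<epsilon> (int (k + N) + int h - int j) \<omega>))"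
        by (rule sum.swap)
      finally show ?thesis by (simp add: multistep_noise_def sum_distrib_left)
    qed
    ultimately show ?case by simp
  qed
qed

text \<open>For \<open>k + N\<close> observations and horizon 1 the divisor
  \<open>n - h - k + 1\<close> is \<open>N\<close>, the number of regressor vectors.\<close>

lemma sample_autocov_mat_eq: "sample_autocov_mat (\<lambda>t. xF t \<omega>) (k + N) 1 k = Gm N \<omega>"
proof (rule eq_matI)
  fix r s assume "r < dim_row (Gm N \<omega>)" "s < dim_col (Gm N \<omega>)"
  then have rs: "r < k" "s < k" by (simp_all add: Gm_def)
  have "(\<Sum>j\<in>{int k..int (k + N) - 1}. xF (j - int r) \<omega> * xF (j - int s) \<omega>) = (\<Sum>i<N. X r i \<omega> * X s i \<omega>)"
    unfolding sum_int_shift X_def ..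
  then show "sample_autocov_mat (\<lambda>t. xF t \<omega>) (k + N) 1 k $$ (r, s) = Gm N \<omega> $$ (r, s)"
    using rs by (simp add: sample_autocov_mat_def Gm_def lag_vec_def)
qed (simp_all add: sample_autocov_mat_def Gm_def)

text \<open>After inserting the recursion, the right side of the normal equations is the sample
  matrix times \<open>ac\<close> plus the score over \<open>N\<close>; nonsingularity gives the
  solution and its uniqueness.\<close>

lemma sample_coeff1_eq:
  assumes rec: "\<And>t. xF (t + 1) \<omega> = (\<Sum>i=1..p. a i * xF (t + 1 - int i) \<omega>) + \<epsilon> (t + 1) \<omega>"
    and d: "Determinant.det (Gm N \<omega>) \<noteq> 0"
  shows "sample_coeff1 (\<lambda>t. xF t \<omega>) (k + N) k = Matrix.vec k (\<lambda>s. ac s + dl N \<omega> s)"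
proof -
  define g where "g r = 1 / (real (k + N) - real k) * (\<Sum>j\<in>{int k..int (k + N) - 1}. xF (j - int r) \<omega> * xF (j + 1) \<omega>)" for r
  have g: "g r = (\<Sum>s<k. Gm N \<omega> $$ (r, s) * ac s) + S r N \<omega> / real N" if r: "r < k" for r
  proof -
    have "(\<Sum>j\<in>{int k..int (k + N) - 1}. xF (j - int r) \<omega> * xF (j + 1) \<omega>) = (\<Sum>i<N. X r i \<omega> * xF (int k + int i + 1) \<omega>)"
      unfolding sum_int_shift X_def ..
    also have "\<dots> = (\<Sum>i<N. (\<Sum>s<k. X r i \<omega> * X s i \<omega> * ac s) + X r i \<omega> * E i \<omega>)"
    proof (rule sum.cong)
      fix i
      have "xF (int k + int i + 1) \<omega> = (\<Sum>s<k. ac s * X s i \<omega>) + E i \<omega>"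
        using rec[of "int k + int i"] ar_coeff_sum[OF pk, of a "\<lambda>t. xF t \<omega>" "int k + int i"]
        by (simp add: ac_def X_def E_def)
      then show "X r i \<omega> * xF (int k + int i + 1) \<omega> = (\<Sum>s<k. X r i \<omega> * X s i \<omega> * ac s) + X r i \<omega> * E i \<omega>"
        by (simp add: distrib_left sum_distrib_left mult_ac)
    qed simp
    also have "\<dots> = (\<Sum>s<k. (\<Sum>i<N. X r i \<omega> * X s i \<omega>) * ac s) + S r N \<omega>"
      by (simp add: sum.distrib S_def sum_distrib_right) (rule sum.swap)
    finally show ?thesis using r
      by (simp add: g_def Gm_def add_divide_distrib sum_divide_distrib[of _ "{..<k}"])
  qed
  define v where "v = Matrix.vec k (\<lambda>s. ac s + dl N \<omega> s)"
  have mv: "vec_index (Gm N \<omega> *\<^sub>v w) r = (\<Sum>s<k. Gm N \<omega> $$ (r, s) * vec_index w s)" if "r < k" "w \<in> carrier_vec k" for r w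
    using that Gm_carrier[of N \<omega>] by (simp add: scalar_prod_def atLeast0LessThan)
  have dlv: "(\<Sum>s<k. Gm N \<omega> $$ (r, s) * dl N \<omega> s) = S r N \<omega> / real N" if r: "r < k" for r
  proof -
    have "(\<Sum>s<k. Gm N \<omega> $$ (r, s) * dl N \<omega> s)
        = (\<Sum>s<k. \<Sum>t<k. Gm N \<omega> $$ (r, s) * minv (Gm N \<omega>) s t * (S t N \<omega> / real N))"
      by (simp only: dl_def sum_distrib_left mult.assoc)
    also have "\<dots> = (\<Sum>t<k. \<Sum>s<k. Gm N \<omega> $$ (r, s) * minv (Gm N \<omega>) s t * (S t N \<omega> / real N))" by (rule sum.swap)
    also have "\<dots> = (\<Sum>t<k. if r = t then S t N \<omega> / real N else 0)"
      by (rule sum.cong) (use r in \<open>simp_all only: sum_distrib_right[symmetric] minv_right[OF Gm_carrier d] lessThan_iff, simp\<close>)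
    finally show ?thesis using r by (simp add: sum.delta)
  qed
  show ?thesis unfolding sample_coeff1_def sample_autocov_mat_eq v_def[symmetric]
  proof (rule the_equality)
    have "Gm N \<omega> *\<^sub>v v = Matrix.vec k g"
    proof (rule eq_vecI)
      fix r assume "r < dim_vec (Matrix.vec k g)"
      then have r: "r < k" by simp
      have "vec_index (Gm N \<omega> *\<^sub>v v) r = (\<Sum>s<k. Gm N \<omega> $$ (r, s) * (ac s + dl N \<omega> s))"
        using mv[OF r, of v] by (simp add: v_def)
      then show "vec_index (Gm N \<omega> *\<^sub>v v) r = vec_index (Matrix.vec k g) r"
        using r g[OF r] dlv[OF r] by (simp add: distrib_left sum.distrib)
    qed (use Gm_carrier[of N \<omega>] in simp)
    then show "v \<in> carrier_vec k \<and> Gm N \<omega> *\<^sub>v v = Matrix.vec k (\<lambda>r. 1 / (real (k + N) - real k) *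
        (\<Sum>j\<in>{int k..int (k + N) - 1}. vec_index (lag_vec (\<lambda>t. xF t \<omega>) k j) r * xF (j + 1) \<omega>))"
      by (auto simp: v_def g_def lag_vec_def intro!: eq_vecI)
  next
    fix w assume w: "w \<in> carrier_vec k \<and> Gm N \<omega> *\<^sub>v w = Matrix.vec k (\<lambda>r. 1 / (real (k + N) - real k) *
        (\<Sum>j\<in>{int k..int (k + N) - 1}. vec_index (lag_vec (\<lambda>t. xF t \<omega>) k j) r * xF (j + 1) \<omega>))"
    have gw: "(\<Sum>s<k. Gm N \<omega> $$ (r, s) * vec_index w s) = g r" if "r < k" for r
      using mv[OF that, of w] w that by (simp add: g_def lag_vec_def)
    have gv: "(\<Sum>s<k. Gm N \<omega> $$ (r, s) * (ac s + dl N \<omega> s)) = g r" if "r < k" for r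
      using g[OF that] dlv[OF that] by (simp add: distrib_left sum.distrib)
    show "w = v"
    proof (rule eq_vecI)
      fix r assume "r < dim_vec v"
      then have r: "r < k" by (simp add: v_def)
      show "vec_index w r = vec_index v r"
        using minv_solve[OF Gm_carrier d r gw] minv_solve[OF Gm_carrier d r gv] r by (simp add: v_def)
    qed (use w in \<open>simp add: v_def\<close>)
  qed
qed

text \<open>True and fitted forecasts weight the regressors by the first columns of the
  \<open>h\<close>-th powers of two companion matrices, and the telescoped difference is
  \<open>U\<close>. What the true forecast misses is the multistep noise.\<close>

lemma prediction_error:
  assumes rec: "\<And>t. xF (t + 1) \<omega> = (\<Sum>i=1..p. a i * xF (t + 1 - int i) \<omega>) + \<epsilon> (t + 1) \<omega>"
    and d: "Determinant.det (Gm N \<omega>) \<noteq> 0" and h: "0 < h"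
  shows "xF (int (k + N) + int h) \<omega> - plugin_predictor (\<lambda>t. xF t \<omega>) (k + N) h k
    = multistep_noise p a (\<lambda>t. \<epsilon> t \<omega>) (int (k + N)) h - U h N \<omega>"
proof -
  define v where "v = Matrix.vec k (\<lambda>s. ac s + dl N \<omega> s)"
  have v: "v \<in> carrier_vec k" by (simp add: v_def)
  have cv: "mpow k (companion_fun (vec_index v)) m r s = mpow k (companion_fun (\<lambda>s. ac s + dl N \<omega> s)) m r s" if "r < k" "s < k" for m r s
    by (rule mpow_cong) (use that in \<open>auto simp: companion_fun_def v_def\<close>)
  have pc: "vec_index (plugin_coeff (\<lambda>t. xF t \<omega>) (k + N) h k) r = mpow k (companion_fun (\<lambda>s. ac s + dl N \<omega> s)) h r 0" if r: "r < k" for r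
    unfolding plugin_coeff_def sample_coeff1_eq[OF rec d] v_def[symmetric] companion_pow_coeff[OF r v]
    using cv[OF r k0, of h] h by (simp del: mpow.simps)
  have dim: "dim_vec (plugin_coeff (\<lambda>t. xF t \<omega>) (k + N) h k) = k"
    unfolding plugin_coeff_def by (simp add: companion_def)
  have "plugin_predictor (\<lambda>t. xF t \<omega>) (k + N) h k
      = (\<Sum>r<k. X r N \<omega> * vec_index (plugin_coeff (\<lambda>t. xF t \<omega>) (k + N) h k) r)"
    by (simp add: plugin_predictor_def scalar_prod_def dim atLeast0LessThan lag_vec_def X_def)
  also have "\<dots> = (\<Sum>r<k. X r N \<omega> * mpow k (companion_fun (\<lambda>s. ac s + dl N \<omega> s)) h r 0)"
    by (rule sum.cong) (simp_all add: pc)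
  also have "\<dots> = (\<Sum>r<k. X r N \<omega> * (mpow k (companion_fun ac) h r 0 + (\<Sum>t<k. Hc h r t N \<omega> * (S t N \<omega> / real N))))"
  proof (rule sum.cong)
    fix r assume "r \<in> {..<k}"
    then have r: "r < k" by simp
    have "(\<Sum>t<k. Hc h r t N \<omega> * (S t N \<omega> / real N))
        = (\<Sum>t<k. \<Sum>j<h. \<Sum>s<k. bh j N \<omega> * (mpow k (companion_fun ac) (h - 1 - j) r s * (minv (Gm N \<omega>) s t * (S t N \<omega> / real N))))"
      by (simp only: Hc_def sum_distrib_right sum_distrib_left mult.assoc)
    also have "\<dots> = (\<Sum>j<h. \<Sum>t<k. \<Sum>s<k. bh j N \<omega> * (mpow k (companion_fun ac) (h - 1 - j) r s * (minv (Gm N \<omega>) s t * (S t N \<omega> / real N))))"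
      by (rule sum.swap)
    also have "\<dots> = (\<Sum>j<h. \<Sum>s<k. \<Sum>t<k. bh j N \<omega> * (mpow k (companion_fun ac) (h - 1 - j) r s * (minv (Gm N \<omega>) s t * (S t N \<omega> / real N))))"
      by (rule sum.cong[OF refl], rule sum.swap)
    also have "\<dots> = (\<Sum>j<h. bh j N \<omega> * (\<Sum>s<k. mpow k (companion_fun ac) (h - 1 - j) r s * dl N \<omega> s))"
      by (simp only: dl_def sum_distrib_left)
    finally have e: "(\<Sum>t<k. Hc h r t N \<omega> * (S t N \<omega> / real N)) = (\<Sum>j<h. bh j N \<omega> * (\<Sum>s<k. mpow k (companion_fun ac) (h - 1 - j) r s * dl N \<omega> s))" .
    show "X r N \<omega> * mpow k (companion_fun (\<lambda>s. ac s + dl N \<omega> s)) h r 0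
        = X r N \<omega> * (mpow k (companion_fun ac) h r 0 + (\<Sum>t<k. Hc h r t N \<omega> * (S t N \<omega> / real N)))"
      unfolding e bh_def using mpow_companion_diff[OF k0 r, of "\<lambda>s. ac s + dl N \<omega> s" h ac] by simp
  qed simp
  also have "\<dots> = (\<Sum>r<k. X r N \<omega> * mpow k (companion_fun ac) h r 0) + U h N \<omega>"
    by (simp add: U_def distrib_left sum.distrib sum_distrib_left mult_ac)
  finally have P: "plugin_predictor (\<lambda>t. xF t \<omega>) (k + N) h k = (\<Sum>r<k. X r N \<omega> * mpow k (companion_fun ac) h r 0) + U h N \<omega>" .
  have "xF (int (k + N) + int h) \<omega> = (\<Sum>r<k. xF (int (k + N) - int r) \<omega> * mpow k (companion_fun (ar_coeff p a)) h r 0)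
    + (\<Sum>j<h. \<epsilon> (int (k + N) + int h - int j) \<omega> * mpow k (companion_fun (ar_coeff p a)) j 0 0)"
    by (rule ar_iterate[of "\<lambda>t. xF t \<omega>" a p "\<lambda>t. \<epsilon> t \<omega>", OF rec pk k0])
  also have "(\<Sum>j<h. \<epsilon> (int (k + N) + int h - int j) \<omega> * mpow k (companion_fun (ar_coeff p a)) j 0 0)
      = multistep_noise p a (\<lambda>t. \<epsilon> t \<omega>) (int (k + N)) h"
    unfolding multistep_noise_def by (rule sum.cong) (simp_all add: mpow_ar_coeff[OF pk k0] mult.commute)
  also have "(\<Sum>r<k. xF (int (k + N) - int r) \<omega> * mpow k (companion_fun (ar_coeff p a)) h r 0) = (\<Sum>r<k. X r N \<omega> * mpow k (companion_fun ac) h r 0)"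
    by (simp add: X_def ac_def)
  finally show ?thesis using P by simp
qed

section \<open>Limits of the fitted quantities and the trace formula\<close>

definition J where "J = minv (autocov_mat M x k)"
definition Lf where "Lf h r s = (\<Sum>j<h. ma_coeff p a j * mpow k (companion_fun ac) (h - 1 - j) r s)"
text \<open>\<open>J\<close>, \<open>Lf\<close> and \<open>Hinf\<close> hold the entries of
  \<open>Gamma^-1\<close>, \<open>L\<close> and \<open>L Gamma^-1\<close>; the last is the limit of
  \<open>Hc\<close>.\<close>

definition Hinf where "Hinf h r t = (\<Sum>s<k. Lf h r s * J s t)"

lemma autocov_mat_carrier: "autocov_mat M x k \<in> carrier_mat k k" by (simp add: autocov_mat_def)

lemma autocov_mat_det: "Determinant.det (autocov_mat M x k) \<noteq> 0"
proof
  assume "Determinant.det (autocov_mat M x k) = 0"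
  then obtain v where v: "v \<in> carrier_vec k" "v \<noteq> 0\<^sub>v k" "autocov_mat M x k *\<^sub>v v = 0\<^sub>v k"
    using det_0_iff_vec_prod_zero[OF autocov_mat_carrier] by blast
  have "(\<Sum>s<k. gmat r s * vec_index v s) = 0" if r: "r < k" for r
  proof -
    have "vec_index (autocov_mat M x k *\<^sub>v v) r = (\<Sum>s<k. autocov_mat M x k $$ (r, s) * vec_index v s)"
      using r v(1) autocov_mat_carrier by (simp add: scalar_prod_def atLeast0LessThan)
    also have "\<dots> = (\<Sum>s<k. gmat r s * vec_index v s)"
      by (rule sum.cong) (use r in \<open>simp_all add: autocov_mat_index\<close>)
    finally show ?thesis using v(3) r by simp
  qed
  then have "vec_index v s = 0" if "s < k" for s by (rule gmat_nonsingular) (use that in auto)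
  then have "v = 0\<^sub>v k" by (intro eq_vecI) (use v(1) in auto)
  with v(2) show False ..
qed

lemma J_left: "r < k \<Longrightarrow> s < k \<Longrightarrow> (\<Sum>t<k. J r t * gmat t s) = (if r = s then 1 else 0)"
  using minv_left[OF autocov_mat_carrier autocov_mat_det, of r s]
  by (simp add: J_def autocov_mat_index)

lemma autocov_mat_inv_index:
  "autocov_mat_inv M x k \<in> carrier_mat k k" "r < k \<Longrightarrow> s < k \<Longrightarrow> autocov_mat_inv M x k $$ (r, s) = J r s"
  using mat_inverse_index[OF autocov_mat_carrier autocov_mat_det] by (auto simp: autocov_mat_inv_def J_def)

text \<open>The padded coefficients solve the Yule-Walker equations, so for \<open>k \<ge> p\<close>
  the companion matrix in \<open>L_mat\<close> is that of the true model.\<close>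

lemma direct_coeff_index:
  assumes r: "r < k" shows "vec_index (direct_coeff M x 1 k) r = ac r"
proof -
  have "vec_index (direct_coeff M x 1 k) r = (\<Sum>t<k. autocov_mat_inv M x k $$ (r, t) * gam (Suc t))"
    using r autocov_mat_inv_index(1) by (simp add: direct_coeff_def scalar_prod_def atLeast0LessThan autocov_eq)
  also have "\<dots> = (\<Sum>t<k. minv (autocov_mat M x k) r t * gam (Suc t))"
    by (rule sum.cong) (use r in \<open>simp_all add: autocov_mat_inv_index(2) J_def\<close>)
  also have "\<dots> = ac r"
  proof (rule minv_solve[OF autocov_mat_carrier autocov_mat_det r, symmetric])
    fix t assume t: "t < k"
    have "(\<Sum>s<k. autocov_mat M x k $$ (t, s) * ac s) = (\<Sum>s<k. gmat t s * ac s)"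
      by (rule sum.cong) (use t in \<open>simp_all add: autocov_mat_index\<close>)
    then show "(\<Sum>s<k. autocov_mat M x k $$ (t, s) * ac s) = gam (Suc t)"
      using yule_walker[OF pk, of t] by (simp add: ac_def ar_coeff_def)
  qed
  finally show ?thesis .
qed

lemma L_mat_index: "r < k \<Longrightarrow> s < k \<Longrightarrow> L_mat M p a x h k $$ (r, s) = Lf h r s"
proof -
  assume rs: "r < k" "s < k"
  have "mpow k (companion_fun (vec_index (direct_coeff M x 1 k))) m r s = mpow k (companion_fun ac) m r s" for m
    by (rule mpow_cong) (use rs in \<open>auto simp: companion_fun_def direct_coeff_index[unfolded One_nat_def]\<close>)
  then show ?thesis using rs by (simp add: L_mat_def companion_pow_index Lf_def)
qed

text \<open>With \<open>H = L Gamma^-1\<close> both sides are \<open>\<sigma>^2\<close> times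
  tr(Gamma H Gamma H'), since \<open>H Gamma = L\<close>. The fourfold sum is the form in which the
  limits of the sums \<open>T\<close> arrive.\<close>

lemma f_plugin_eq:
  "f_plugin M p a \<sigma> x h k = (\<Sum>r<k. \<Sum>t<k. \<Sum>r'<k. \<Sum>t'<k. (Hinf h r t * Hinf h r' t') * (\<sigma>\<^sup>2 * gmat r r' * gmat t t'))"
proof -
  have Lc: "L_mat M p a x h k \<in> carrier_mat k k" by (simp add: L_mat_def)
  note c = autocov_mat_carrier Lc autocov_mat_inv_index(1)
  have c1: "autocov_mat M x k * L_mat M p a x h k \<in> carrier_mat k k" using c by simp
  have c2: "autocov_mat M x k * L_mat M p a x h k * autocov_mat_inv M x k \<in> carrier_mat k k" using c by simp
  have ct: "transpose_mat (L_mat M p a x h k) \<in> carrier_mat k k" using c by simp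
  have "mat_trace (autocov_mat M x k * L_mat M p a x h k * autocov_mat_inv M x k * transpose_mat (L_mat M p a x h k))
      = (\<Sum>i<k. \<Sum>c<k. (autocov_mat M x k * L_mat M p a x h k * autocov_mat_inv M x k) $$ (i, c) * Lf h i c)"
  proof -
    have "dim_row (autocov_mat M x k * L_mat M p a x h k * autocov_mat_inv M x k * transpose_mat (L_mat M p a x h k)) = k"
      using autocov_mat_carrier by simp
    moreover have "transpose_mat (L_mat M p a x h k) $$ (c, i) = Lf h i c" if "i < k" "c < k" for i c
      using that Lc by (simp add: L_mat_index)
    ultimately show ?thesis unfolding mat_trace_def
      by (auto simp: mult_mat_index[OF c2 ct] intro!: sum.cong)
  qed
  also have "\<dots> = (\<Sum>i<k. \<Sum>c<k. (\<Sum>r<k. gmat i r * Hinf h r c) * Lf h i c)"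
  proof (intro sum.cong refl arg_cong2[of _ _ _ _ "(*)"])
    fix i c assume "i \<in> {..<k}" "c \<in> {..<k}"
    then have ic: "i < k" "c < k" by auto
    have "(autocov_mat M x k * L_mat M p a x h k * autocov_mat_inv M x k) $$ (i, c)
        = (\<Sum>s<k. (\<Sum>r<k. gmat i r * Lf h r s) * J s c)"
      unfolding mult_mat_index[OF c1 c(3) ic]
      by (rule sum.cong) (use ic in \<open>simp_all add: mult_mat_index[OF c(1,2)] autocov_mat_inv_index(2) autocov_mat_index L_mat_index\<close>)
    also have "\<dots> = (\<Sum>s<k. \<Sum>r<k. gmat i r * (Lf h r s * J s c))" by (simp add: sum_distrib_right mult.assoc)
    also have "\<dots> = (\<Sum>r<k. \<Sum>s<k. gmat i r * (Lf h r s * J s c))" by (rule sum.swap)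
    also have "\<dots> = (\<Sum>r<k. gmat i r * Hinf h r c)" by (simp add: Hinf_def sum_distrib_left)
    finally show "(autocov_mat M x k * L_mat M p a x h k * autocov_mat_inv M x k) $$ (i, c) = (\<Sum>r<k. gmat i r * Hinf h r c)" .
  qed
  finally have tr: "f_plugin M p a \<sigma> x h k = \<sigma>\<^sup>2 * (\<Sum>i<k. \<Sum>c<k. (\<Sum>r<k. gmat i r * Hinf h r c) * Lf h i c)"
    by (simp add: f_plugin_def)
  have HG: "(\<Sum>t<k. Hinf h r t * gmat t t') = Lf h r t'" if t': "t' < k" for r t'
  proof -
    have "(\<Sum>t<k. Hinf h r t * gmat t t') = (\<Sum>t<k. \<Sum>s<k. Lf h r s * (J s t * gmat t t'))"
      by (simp add: Hinf_def sum_distrib_right mult.assoc)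
    also have "\<dots> = (\<Sum>s<k. \<Sum>t<k. Lf h r s * (J s t * gmat t t'))" by (rule sum.swap)
    also have "\<dots> = (\<Sum>s<k. if t' = s then Lf h r s else 0)"
      by (rule sum.cong) (use t' in \<open>simp_all add: sum_distrib_left[symmetric] J_left\<close>)
    finally show ?thesis using t' by (simp add: sum.delta)
  qed
  have "(\<Sum>r<k. \<Sum>t<k. \<Sum>r'<k. \<Sum>t'<k. (Hinf h r t * Hinf h r' t') * (\<sigma>\<^sup>2 * gmat r r' * gmat t t'))
      = (\<Sum>r<k. \<Sum>r'<k. \<Sum>t<k. \<Sum>t'<k. (Hinf h r t * Hinf h r' t') * (\<sigma>\<^sup>2 * gmat r r' * gmat t t'))"
    by (rule sum.cong[OF refl], rule sum.swap)
  also have "\<dots> = (\<Sum>r<k. \<Sum>r'<k. \<Sum>t'<k. \<Sum>t<k. (Hinf h r t * Hinf h r' t') * (\<sigma>\<^sup>2 * gmat r r' * gmat t t'))"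
    by (rule sum.cong[OF refl], rule sum.cong[OF refl], rule sum.swap)
  also have "\<dots> = (\<Sum>r<k. \<Sum>r'<k. \<Sum>t'<k. \<sigma>\<^sup>2 * (gmat r r' * Hinf h r' t') * (\<Sum>t<k. Hinf h r t * gmat t t'))"
    by (simp add: sum_distrib_left mult_ac)
  also have "\<dots> = (\<Sum>r<k. \<Sum>r'<k. \<Sum>t'<k. \<sigma>\<^sup>2 * (gmat r r' * Hinf h r' t') * Lf h r t')"
    by (intro sum.cong refl) (simp add: HG)
  also have "\<dots> = (\<Sum>r<k. \<Sum>t'<k. \<Sum>r'<k. \<sigma>\<^sup>2 * (gmat r r' * Hinf h r' t') * Lf h r t')"
    by (rule sum.cong[OF refl], rule sum.swap)
  also have "\<dots> = f_plugin M p a \<sigma> x h k"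
    by (simp add: tr sum_distrib_left sum_distrib_right mult_ac)
  finally show ?thesis ..
qed

lemma Gm_tendsto:
  assumes "\<forall>r<k. \<forall>s<k. (\<lambda>n. (\<Sum>i<n. X r i \<omega> * X s i \<omega>) / real n) \<longlonglongrightarrow> gmat r s" and "r < k" "s < k"
  shows "(\<lambda>n. Gm n \<omega> $$ (r, s)) \<longlonglongrightarrow> autocov_mat M x k $$ (r, s)"
  using assms by (simp add: Gm_def autocov_mat_index)

lemma minv_Gm_tendsto:
  assumes sm: "\<forall>r<k. \<forall>s<k. (\<lambda>n. (\<Sum>i<n. X r i \<omega> * X s i \<omega>) / real n) \<longlonglongrightarrow> gmat r s" and rs: "r < k" "s < k"
  shows "(\<lambda>n. minv (Gm n \<omega>) r s) \<longlonglongrightarrow> J r s"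
  unfolding minv_def J_def
  by (intro tendsto_divide adj_mat_tendsto[OF Gm_carrier autocov_mat_carrier Gm_tendsto[OF sm] rs]
      det_tendsto[OF Gm_carrier autocov_mat_carrier Gm_tendsto[OF sm]] autocov_mat_det)

text \<open>The coefficient error \<open>dl\<close> vanishes in the limit, so the fitted impulse
  response tends to \<open>ma_coeff\<close>.\<close>

lemma Hc_tendsto:
  assumes sm: "\<forall>r<k. \<forall>s<k. (\<lambda>n. (\<Sum>i<n. X r i \<omega> * X s i \<omega>) / real n) \<longlonglongrightarrow> gmat r s"
    and Sa: "\<forall>r<k. (\<lambda>n. S r n \<omega> / real n) \<longlonglongrightarrow> 0" and rt: "r < k" "t < k"
  shows "(\<lambda>n. Hc h r t n \<omega>) \<longlonglongrightarrow> Hinf h r t"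
proof -
  have dl: "(\<lambda>n. dl n \<omega> s) \<longlonglongrightarrow> 0" if "s < k" for s
  proof -
    have "(\<lambda>n. dl n \<omega> s) \<longlonglongrightarrow> (\<Sum>t<k. J s t * 0)"
      unfolding dl_def by (intro tendsto_sum tendsto_mult minv_Gm_tendsto[OF sm]) (use that Sa in auto)
    then show ?thesis by simp
  qed
  have bh: "(\<lambda>n. bh j n \<omega>) \<longlonglongrightarrow> ma_coeff p a j" for j
    unfolding bh_def mpow_ar_coeff[OF pk k0, symmetric] ac_def[symmetric]
  proof (rule mpow_tendsto)
    fix r s assume rs: "r < k" "s < k"
    have "(\<lambda>n. ac r + dl n \<omega> r) \<longlonglongrightarrow> ac r + 0" by (intro tendsto_add tendsto_const dl rs)
    then show "(\<lambda>n. companion_fun (\<lambda>s. ac s + dl n \<omega> s) r s) \<longlonglongrightarrow> companion_fun ac r s"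
      by (cases "s = 0") (simp_all add: companion_fun_def)
  qed (use k0 in auto)
  have "(\<lambda>n. Hc h r t n \<omega>) \<longlonglongrightarrow> (\<Sum>j<h. ma_coeff p a j * (\<Sum>s<k. mpow k (companion_fun ac) (h - 1 - j) r s * J s t))"
    unfolding Hc_def by (intro tendsto_sum tendsto_mult bh tendsto_const minv_Gm_tendsto[OF sm]) (use rt in auto)
  also have "(\<Sum>j<h. ma_coeff p a j * (\<Sum>s<k. mpow k (companion_fun ac) (h - 1 - j) r s * J s t)) = Hinf h r t"
  proof -
    have "(\<Sum>j<h. ma_coeff p a j * (\<Sum>s<k. mpow k (companion_fun ac) (h - 1 - j) r s * J s t))
        = (\<Sum>j<h. \<Sum>s<k. ma_coeff p a j * mpow k (companion_fun ac) (h - 1 - j) r s * J s t)"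
      by (simp add: sum_distrib_left mult.assoc)
    also have "\<dots> = (\<Sum>s<k. \<Sum>j<h. ma_coeff p a j * mpow k (companion_fun ac) (h - 1 - j) r s * J s t)" by (rule sum.swap)
    finally show ?thesis by (simp add: Hinf_def Lf_def sum_distrib_right)
  qed
  finally show ?thesis .
qed

lemma U_square_log:
  assumes rp: "regression_path k (\<lambda>r i. X r i \<omega>) (\<lambda>i. E i \<omega>) gmat (\<sigma>\<^sup>2) (\<lambda>r n. S r n \<omega>) (\<lambda>r s n. D r s n \<omega>)"
    and sm: "\<forall>r<k. \<forall>s<k. (\<lambda>n. (\<Sum>i<n. X r i \<omega> * X s i \<omega>) / real n) \<longlonglongrightarrow> gmat r s"
    and Sa: "\<forall>r<k. (\<lambda>n. S r n \<omega> / real n) \<longlonglongrightarrow> 0"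
  shows "negl (\<lambda>n. (\<Sum>N<n. (U h N \<omega>)\<^sup>2) - f_plugin M p a \<sigma> x h k * hsum n) hsum"
proof -
  interpret rp: regression_path k "\<lambda>r i. X r i \<omega>" "\<lambda>i. E i \<omega>" gmat "\<sigma>\<^sup>2" "\<lambda>r n. S r n \<omega>" "\<lambda>r s n. D r s n \<omega>"
    by (rule rp)
  \<comment> \<open>\<open>U\<close> divides by \<open>N\<close> but \<open>T\<close> by
    \<open>Suc N\<close>; the squared ratio in the weights corrects this. At \<open>N = 0\<close>
    both forms are 0, as division by 0 gives 0.\<close>
  define c where "c r t r' t' N = Hc h r t N \<omega> * Hc h r' t' N \<omega> * (real (Suc N) / real N)\<^sup>2" for r t r' t' N
  define \<tau> where "\<tau> r t r' t' N = X r N \<omega> * X r' N \<omega> * (S t N \<omega> * S t' N \<omega>) / (real (Suc N))\<^sup>2" for r t r' t' N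
  have ratio: "(\<lambda>N. real (Suc N) / real N) \<longlonglongrightarrow> 1" by real_asymp
  have clim: "(\<lambda>N. c r t r' t' N) \<longlonglongrightarrow> Hinf h r t * Hinf h r' t'" if "r < k" "t < k" "r' < k" "t' < k" for r t r' t'
  proof -
    have "(\<lambda>N. c r t r' t' N) \<longlonglongrightarrow> Hinf h r t * Hinf h r' t' * 1\<^sup>2"
      unfolding c_def by (intro tendsto_mult tendsto_power ratio Hc_tendsto[OF sm Sa] that)
    then show ?thesis by simp
  qed
  have n1: "negl (\<lambda>n. (\<Sum>N<n. c r t r' t' N * \<tau> r t r' t' N) - (Hinf h r t * Hinf h r' t') * (\<sigma>\<^sup>2 * gmat r r' * gmat t t') * hsum n) hsum"
    if "r < k" "t < k" "r' < k" "t' < k" for r t r' t'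
    unfolding \<tau>_def using rp.weighted_T_log[OF that(1,3,2,4) clim[OF that]] .
  have n2: "negl (\<lambda>n. \<Sum>r<k. \<Sum>t<k. \<Sum>r'<k. \<Sum>t'<k. (\<Sum>N<n. c r t r' t' N * \<tau> r t r' t' N) - (Hinf h r t * Hinf h r' t') * (\<sigma>\<^sup>2 * gmat r r' * gmat t t') * hsum n) hsum"
    by (intro negl_sum n1 hsum_nonneg) auto
  have ct: "c r t r' t' N * \<tau> r t r' t' N
      = (Hc h r t N \<omega> * X r N \<omega> * S t N \<omega> / real N) * (Hc h r' t' N \<omega> * X r' N \<omega> * S t' N \<omega> / real N)" for r t r' t' N
  proof -
    have gen: "P * (u / v)\<^sup>2 * (Q / u\<^sup>2) = P * Q * (1 / (v * v))" if "u \<noteq> 0" for P Q u v :: real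
      using that by (simp add: power_divide power2_eq_square)
    have "c r t r' t' N * \<tau> r t r' t' N
        = Hc h r t N \<omega> * Hc h r' t' N \<omega> * (X r N \<omega> * X r' N \<omega> * (S t N \<omega> * S t' N \<omega>)) * (1 / (real N * real N))"
      unfolding c_def \<tau>_def by (rule gen) simp
    then show ?thesis by (simp add: mult_ac)
  qed
  have sq: "(U h N \<omega>)\<^sup>2 = (\<Sum>r<k. \<Sum>t<k. \<Sum>r'<k. \<Sum>t'<k. c r t r' t' N * \<tau> r t r' t' N)" for N
  proof -
    have "(U h N \<omega>)\<^sup>2 = (\<Sum>r<k. \<Sum>t<k. (Hc h r t N \<omega> * X r N \<omega> * S t N \<omega> / real N)) * (\<Sum>r'<k. \<Sum>t'<k. (Hc h r' t' N \<omega> * X r' N \<omega> * S t' N \<omega> / real N))"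
      by (simp only: U_def power2_eq_square)
    then show ?thesis by (simp only: ct sum_distrib_right) (simp only: sum_distrib_left)
  qed
  have "(\<Sum>N<n. (U h N \<omega>)\<^sup>2) = (\<Sum>r<k. \<Sum>t<k. \<Sum>r'<k. \<Sum>t'<k. \<Sum>N<n. c r t r' t' N * \<tau> r t r' t' N)" for n
    unfolding sq by (induction n) (simp_all add: sum.distrib)
  then have "(\<Sum>N<n. (U h N \<omega>)\<^sup>2) - f_plugin M p a \<sigma> x h k * hsum n
    = (\<Sum>r<k. \<Sum>t<k. \<Sum>r'<k. \<Sum>t'<k. (\<Sum>N<n. c r t r' t' N * \<tau> r t r' t' N) - (Hinf h r t * Hinf h r' t') * (\<sigma>\<^sup>2 * gmat r r' * gmat t t') * hsum n)" for n
    unfolding f_plugin_eq by (simp only: sum_subtractf sum_distrib_right)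
  then show ?thesis using n2 by (simp only:)
qed

text \<open>The error is \<open>\<eta> - U\<close>, so the excess is
  \<open>U^2 - 2 U \<eta>\<close>. The squares supply the logarithm; the cross term is negligible
  against them, and they are by then known to be \<open>O(hsum)\<close>.\<close>

lemma APE_plugin_asymptotics:
  assumes h: "0 < h"
  shows "AE \<omega> in M.
    (\<lambda>n. APE_plugin (\<lambda>t. x t \<omega>) K n h k
         - (\<Sum>i\<in>{start_index (\<lambda>t. x t \<omega>) h K..n - h}.
              (multistep_noise p a (\<lambda>t. \<epsilon> t \<omega>) (int i) h)\<^sup>2)
         - f_plugin M p a \<sigma> x h k * ln (real n))
    \<in> o(\<lambda>n. ln (real n))"
  using x_eq_xF x_recursion_all second_moments_AE S_average_AE regression_path_AE cross_AE[of h]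
proof eventually_elim
  case (elim \<omega>)
  have eq: "(\<lambda>t. x t \<omega>) = (\<lambda>t. xF t \<omega>)" using elim(1) by auto
  have rec: "xF (t + 1) \<omega> = (\<Sum>i=1..p. a i * xF (t + 1 - int i) \<omega>) + \<epsilon> (t + 1) \<omega>" for t
    using elim(2) unfolding elim(1)[rule_format] by blast
  define \<eta> where "\<eta> i = multistep_noise p a (\<lambda>t. \<epsilon> t \<omega>) (int i) h" for i
  define f where "f = f_plugin M p a \<sigma> x h k"
  define w where "w N = (U h N \<omega>)\<^sup>2 - 2 * (U h N \<omega> * \<eta> (k + N))" for N
  define g where "g i = (xF (int i + int h) \<omega> - plugin_predictor (\<lambda>t. xF t \<omega>) i h k)\<^sup>2 - (\<eta> i)\<^sup>2" for i
  \<comment> \<open>The limit matrix is nonsingular, so the sample matrices are singular for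
    finitely many sizes only.\<close>
  have "(\<lambda>n. Determinant.det (Gm n \<omega>)) \<longlonglongrightarrow> Determinant.det (autocov_mat M x k)"
    by (rule det_tendsto[OF Gm_carrier autocov_mat_carrier Gm_tendsto[OF elim(3)]])
  then have "eventually (\<lambda>n. Determinant.det (Gm n \<omega>) \<noteq> 0) sequentially"
    by (rule tendsto_imp_eventually_ne) (rule autocov_mat_det)
  then obtain N0 where N0: "\<And>N. N0 \<le> N \<Longrightarrow> Determinant.det (Gm N \<omega>) \<noteq> 0"
    unfolding eventually_sequentially by blast
  have gw: "g (k + N) = w N" if "N0 \<le> N" for N
    unfolding g_def prediction_error[OF rec N0[OF that] h] \<eta>_def[symmetric] w_def
    by (simp add: power2_diff)
  have U2: "negl (\<lambda>n. (\<Sum>N<n. (U h N \<omega>)\<^sup>2) - f * hsum n) hsum"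
    unfolding f_def by (rule U_square_log[OF elim(5,3,4)])
  obtain C where C: "\<And>n. \<bar>(\<Sum>N<n. (U h N \<omega>)\<^sup>2) - f * hsum n\<bar> \<le> 1 * hsum n + C"
    using neglE[OF U2, of 1] by auto
  have bd: "(\<Sum>N<n. (U h N \<omega>)\<^sup>2) \<le> (\<bar>f\<bar> + 1) * hsum n + C" for n
    using C[of n] mult_right_mono[OF abs_ge_self hsum_nonneg, of f n] by (simp add: distrib_right)
  have cross: "negl (\<lambda>n. \<Sum>N<n. U h N \<omega> * \<eta> (k + N)) hsum"
    unfolding \<eta>_def by (rule negl_mono[OF elim(6) bd]) simp
  have "negl (\<lambda>n. ((\<Sum>N<n. (U h N \<omega>)\<^sup>2) - f * hsum n) - 2 * (\<Sum>N<n. U h N \<omega> * \<eta> (k + N))) hsum"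
    by (intro negl_diff U2 negl_cmult cross)
  moreover have "((\<Sum>N<n. (U h N \<omega>)\<^sup>2) - f * hsum n) - 2 * (\<Sum>N<n. U h N \<omega> * \<eta> (k + N)) = (\<Sum>N<n. w N) - f * hsum n" for n
    by (simp add: w_def sum_subtractf sum_distrib_left)
  ultimately have W: "negl (\<lambda>n. (\<Sum>N<n. w N) - f * hsum n) hsum" by simp
  have "APE_plugin (\<lambda>t. xF t \<omega>) K n h k - (\<Sum>i\<in>{start_index (\<lambda>t. xF t \<omega>) h K..n - h}. (\<eta> i)\<^sup>2)
      = (\<Sum>i\<in>{start_index (\<lambda>t. xF t \<omega>) h K..n - h}. g i)" for n
    by (simp add: APE_plugin_def g_def sum_subtractf)
  then show ?case unfolding eq \<eta>_def[symmetric] f_def[symmetric]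
    using log_asymptotics[of N0 g k w h f, OF gw k0 h W] by simp
qed

end

theorem theorem3p1:
  fixes M :: "'a measure" and F :: "int \<Rightarrow> 'a measure"
    and \<epsilon> x :: "int \<Rightarrow> 'a \<Rightarrow> real" and a :: "nat \<Rightarrow> real"
    and \<sigma> \<alpha> :: real and p\<^sub>1 K h k :: nat
  assumes "prob_space M"
    and "1 \<le> p\<^sub>1" and "p\<^sub>1 \<le> K" and "1 \<le> h"
    and "a p\<^sub>1 \<noteq> 0"
    and "\<forall>z::complex. norm z \<le> 1 \<longrightarrow> poly (map_poly of_real (ar_poly p\<^sub>1 a)) z \<noteq> 0"
    and "stationary_AR M p\<^sub>1 a \<epsilon> x"
    and "martingale_diff_seq M F \<epsilon>"
    and "\<sigma>\<^sup>2 > 0" and "\<alpha> > 2"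
    and "\<forall>t. AE \<omega> in M. real_cond_exp M (F (t - 1)) (\<lambda>\<omega>. (\<epsilon> t \<omega>)\<^sup>2) \<omega> = \<sigma>\<^sup>2"
    and "AE \<omega> in M. (SUP t. cond_abs_moment M F \<epsilon> \<alpha> t \<omega>) < \<infinity>"
    and "p\<^sub>1 \<le> k" and "k \<le> K"
  shows "AE \<omega> in M.
    (\<lambda>n. APE_plugin (\<lambda>t. x t \<omega>) K n h k
         - (\<Sum>i\<in>{start_index (\<lambda>t. x t \<omega>) h K..n - h}.
              (multistep_noise p\<^sub>1 a (\<lambda>t. \<epsilon> t \<omega>) (int i) h)\<^sup>2)
         - f_plugin M p\<^sub>1 a \<sigma> x h k * ln (real n))
    \<in> o(\<lambda>n. ln (real n))"
proof -
  interpret prob_space M by fact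
  interpret ar_fit M F \<epsilon> x a \<sigma> \<alpha> p\<^sub>1 k
    by (intro ar_fit.intro ar_process.intro ar_process_axioms.intro ar_fit_axioms.intro assms)
      (use assms(2,13) in linarith)
  show ?thesis by (rule APE_plugin_asymptotics) (use assms in simp)
qed

end
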